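(* Let $k$ be a positive integer and let $\mathcal{T}$ be an orientable 3-manifold triangulation with no boundary faces and with $n$ tetrahedra, whose face pairing graph $\Gamma(\mathcal{T})$ has cutwidth $\leq k$, and for which a corresponding layout of nodes (an ordering of the nodes of $\Gamma(\mathcal{T})$ all of whose cuts into an initial segment and its complement have width at most $k$) is known (i.e. given along with $\mathcal{T}$). Then \textsc{taut angle structure} (the problem of determining whether a taut angle structure on $\mathcal{T}$ exists) can be solved for $\mathcal{T}$ in $O(nk\cdot 3^{3k/2})$ time.
   Context: A 3-manifold triangulation is a finite collection of $n$ abstract tetrahedra, some or all of whose triangular faces are affinely identified ("glued") in pairs (two faces of the same tetrahedron may be glued). Each face is glued to exactly one partner (internal face) or to nothing (boundary face). Tetrahedron edges identified through the gluings form equivalence classes called edges of the triangulation; no edge may be identified with itself in reverse. There is no condition on vertex links. The input is the list of face gluings. \textsc{taut angle structure}: given an orientable 3-manifold triangulation $\mathcal{T}$ with no boundary faces, determine whether there exists a taut angle structure on $\mathcal{T}$, i.e. a choice of two opposite edges to mark in each tetrahedron of $\mathcal{T}$ (the edges with angle $\pi$; the other four have angle $0$) so that every edge of the triangulation is marked exactly twice, counting with multiplicity all tetrahedron edges identified to it. The face pairing graph $\Gamma(\mathcal{T})$ is the multigraph whose nodes are the tetrahedra of $\mathcal{T}$ and whose arcs are the pairs of tetrahedron faces glued together (loops and multiple arcs are allowed). A cut of a graph $G$ is a partition of its nodes into two disjoint subsets $N_1,N_2$; its width is the number of arcs with one endpoint in $N_1$ and the other in $N_2$. The cutwidth of $G$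 is the smallest $k$ for which there is an ordering (layout) $\nu_1,\ldots,\nu_n$ of the nodes of $G$ such that every cut $(\{\nu_1,\ldots,\nu_i\},\{\nu_{i+1},\ldots,\nu_n\})$ has width at most $k$. Running times are in the word RAM model, where simple arithmetical operations on $(\log n)$-bit integers take constant time. The implied constant in $O(\cdot)$ is absolute. *)

theory Defs
  imports Complex_Main "HOL-Combinatorics.Permutations"
begin

section \<open>Triangulations\<close>

text \<open>
  The tetrahedra are \<open>0, \<dots>, ntet T - 1\<close>, each with vertices \<open>0, 1, 2, 3\<close>; face \<open>f\<close> of a
  tetrahedron is the one opposite vertex \<open>f\<close>.  \<open>glue T t f = None\<close> says that face \<open>f\<close> of
  tetrahedron \<open>t\<close> is a boundary face.  \<open>glue T t f = Some (u, p)\<close> says that this face is glued to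
  face \<open>p f\<close> of tetrahedron \<open>u\<close>, by the affine map taking vertex \<open>v \<noteq> f\<close> of \<open>t\<close> to
  vertex \<open>p v\<close> of \<open>u\<close>.  The bijection of the three face vertices is thus
  extended to a permutation of all four by sending the vertex opposite one face to the vertex
  opposite the other.
\<close>

record tri =
  ntet :: nat
  glue :: "nat \<Rightarrow> nat \<Rightarrow> (nat \<times> (nat \<Rightarrow> nat)) option"

text \<open>Tetrahedron edges, and their identifications, without and with orientation.\<close>

definition tet_edges :: "tri \<Rightarrow> (nat \<times> nat set) set" where
  "tet_edges T = {(t, e). t < ntet T \<and> e \<subseteq> {..<4} \<and> card e = 2}"

definition edge_glue :: "tri \<Rightarrow> ((nat \<times> nat set) \<times> (nat \<times> nat set)) set" where
  "edge_glue T = {((t, e), (u, p ` e)) | t e f u p.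
     t < ntet T \<and> f < 4 \<and> glue T t f = Some (u, p) \<and> e \<subseteq> {..<4} - {f} \<and> card e = 2}"

definition oriented_edge_glue :: "tri \<Rightarrow> ((nat \<times> nat \<times> nat) \<times> (nat \<times> nat \<times> nat)) set" where
  "oriented_edge_glue T = {((t, a, b), (u, p a, p b)) | t a b f u p.
     t < ntet T \<and> f < 4 \<and> glue T t f = Some (u, p) \<and> a \<in> {..<4} - {f} \<and> b \<in> {..<4} - {f} \<and> a \<noteq> b}"

definition triangulation :: "tri \<Rightarrow> bool" where
  "triangulation T \<longleftrightarrow>
     0 < ntet T \<and>
     (\<forall>t < ntet T. \<forall>f < 4. \<forall>u p. glue T t f = Some (u, p) \<longrightarrow>
        u < ntet T \<and> p permutes {..<4} \<and> (u, p f) \<noteq> (t, f) \<and>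
        glue T u (p f) = Some (t, inv p)) \<and>
     (\<forall>t < ntet T. \<forall>a < 4. \<forall>b < 4. a \<noteq> b \<longrightarrow>
        ((t, a, b), (t, b, a)) \<notin> (oriented_edge_glue T)\<^sup>*)"

definition no_boundary_faces :: "tri \<Rightarrow> bool" where
  "no_boundary_faces T \<longleftrightarrow> (\<forall>t < ntet T. \<forall>f < 4. glue T t f \<noteq> None)"

text \<open>
  An orientation of a tetrahedron is a choice between its two classes of vertex orderings modulo
  even permutations; \<open>c t\<close> tells whether the class of \<open>(0, 1, 2, 3)\<close> is chosen in \<open>t\<close>.  The
  orientations of two glued tetrahedra are compatible iff the gluing reverses the induced
  orientations of the face; as \<open>p\<close> matches the two vertices that lie on opposite
  sides of that face, this means that \<open>p\<close> is odd if \<open>c\<close> takes the same value on both, and even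
  otherwise.
\<close>

definition orientable :: "tri \<Rightarrow> bool" where
  "orientable T \<longleftrightarrow> (\<exists>c :: nat \<Rightarrow> bool. \<forall>t < ntet T. \<forall>f < 4. \<forall>u p.
     glue T t f = Some (u, p) \<longrightarrow> (c t = c u \<longleftrightarrow> \<not> evenperm p))"

text \<open>
  For a triangulation, \<open>edge_glue\<close> is symmetric (every gluing occurs in both directions), so
  its reflexive transitive closure is the generated equivalence relation.
\<close>

definition tri_edges :: "tri \<Rightarrow> (nat \<times> nat set) set set" where
  "tri_edges T = tet_edges T // (edge_glue T)\<^sup>*"

section \<open>Taut angle structures\<close>

definition opposite_edge_pairs :: "nat set set set" where
  "opposite_edge_pairs = {{e, {..<4} - e} | e. e \<subseteq> {..<4} \<and> card e = 2}"

text \<open>\<open>m t\<close> is the pair of edges of tetrahedron \<open>t\<close> that are marked (have angle \<open>\<pi>\<close>).\<close>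

definition taut_angle_structure :: "tri \<Rightarrow> (nat \<Rightarrow> nat set set) \<Rightarrow> bool" where
  "taut_angle_structure T m \<longleftrightarrow>
     (\<forall>t < ntet T. m t \<in> opposite_edge_pairs) \<and>
     (\<forall>E \<in> tri_edges T. card {(t, e) \<in> E. e \<in> m t} = 2)"

section \<open>Multigraphs, layouts and cutwidth\<close>

record ('v, 'a) multigraph =
  nodes :: "'v set"
  arcs :: "'a set"
  ends :: "'a \<Rightarrow> 'v set"  \<comment> \<open>a singleton for a loop\<close>

definition cut_width :: "('v, 'a) multigraph \<Rightarrow> 'v set \<Rightarrow> 'v set \<Rightarrow> nat" where
  "cut_width G N1 N2 = card {a \<in> arcs G. \<exists>x \<in> N1. \<exists>y \<in> N2. ends G a = {x, y}}"

definition layout :: "('v, 'a) multigraph \<Rightarrow> 'v list \<Rightarrow> bool" where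
  "layout G vs \<longleftrightarrow> distinct vs \<and> set vs = nodes G"

definition layout_width_le :: "('v, 'a) multigraph \<Rightarrow> 'v list \<Rightarrow> nat \<Rightarrow> bool" where
  "layout_width_le G vs k \<longleftrightarrow>
     (\<forall>i \<le> length vs. cut_width G (set (take i vs)) (set (drop i vs)) \<le> k)"

definition cutwidth :: "('v, 'a) multigraph \<Rightarrow> nat" where
  "cutwidth G = (LEAST k. \<exists>vs. layout G vs \<and> layout_width_le G vs k)"

text \<open>An arc of the face pairing graph is the set of the two tetrahedron faces glued together.\<close>

definition face_pairing_graph :: "tri \<Rightarrow> (nat, (nat \<times> nat) set) multigraph" where
  "face_pairing_graph T =
     \<lparr> nodes = {..<ntet T},
       arcs = {{(t, f), (u, p f)} | t f u p. t < ntet T \<and> f < 4 \<and> glue T t f = Some (u, p)},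
       ends = (\<lambda>a. fst ` a) \<rparr>"

section \<open>Word RAM\<close>

text \<open>
  The machine has registers and an indirectly addressed memory, both holding natural numbers.
  With word size \<open>w\<close>, a number occupies as many words as its binary expansion requires, and every
  instruction is charged for all the words it handles, addresses included.  Hence an instruction
  takes constant time on \<open>O(w)\<close>-bit numbers, and longer numbers (which are unavoidable once the
  memory in use exceeds \<open>2 ^ w\<close> cells) are charged as in multi-word arithmetic: linearly for
  transfers, comparisons, addition and subtraction, and by the schoolbook method for
  multiplication and division.
\<close>

datatype arith_op = Add | Sub | Mul | Div | Mod

datatype instr =
    Const nat nat                  \<comment> \<open>destination register, constant\<close>
  | Arith arith_op nat nat nat     \<comment> \<open>destination register, two operand registers\<close>
  | Load nat nat                   \<comment> \<open>destination register, address register\<close>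
  | Store nat nat                  \<comment> \<open>address register, source register\<close>
  | Jump nat
  | Jump_Less nat nat nat          \<comment> \<open>two registers, target\<close>

type_synonym program = "instr list"

record config =
  pc :: nat
  reg :: "nat \<Rightarrow> nat"
  mem :: "nat \<Rightarrow> nat"

text \<open>Subtraction is truncated at 0, and division by 0 follows the HOL convention.\<close>

fun arith_fun :: "arith_op \<Rightarrow> nat \<Rightarrow> nat \<Rightarrow> nat" where
  "arith_fun Add x y = x + y"
| "arith_fun Sub x y = x - y"
| "arith_fun Mul x y = x * y"
| "arith_fun Div x y = x div y"
| "arith_fun Mod x y = x mod y"

fun exec_instr :: "instr \<Rightarrow> config \<Rightarrow> config" where
  "exec_instr (Const r c) s = s\<lparr>pc := pc s + 1, reg := (reg s)(r := c)\<rparr>"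
| "exec_instr (Arith f r a b) s =
     s\<lparr>pc := pc s + 1, reg := (reg s)(r := arith_fun f (reg s a) (reg s b))\<rparr>"
| "exec_instr (Load r a) s = s\<lparr>pc := pc s + 1, reg := (reg s)(r := mem s (reg s a))\<rparr>"
| "exec_instr (Store a r) s = s\<lparr>pc := pc s + 1, mem := (mem s)(reg s a := reg s r)\<rparr>"
| "exec_instr (Jump l) s = s\<lparr>pc := l\<rparr>"
| "exec_instr (Jump_Less a b l) s = s\<lparr>pc := (if reg s a < reg s b then l else pc s + 1)\<rparr>"

definition bit_length :: "nat \<Rightarrow> nat" where
  "bit_length x = (LEAST b. x < 2 ^ b)"

definition num_words :: "nat \<Rightarrow> nat \<Rightarrow> nat" where
  "num_words w x = nat \<lceil>real (bit_length x) / real w\<rceil>"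

fun arith_cost :: "nat \<Rightarrow> arith_op \<Rightarrow> nat \<Rightarrow> nat \<Rightarrow> nat" where
  "arith_cost w Add x y = 1 + num_words w x + num_words w y"
| "arith_cost w Sub x y = 1 + num_words w x + num_words w y"
| "arith_cost w Mul x y = (1 + num_words w x) * (1 + num_words w y)"
| "arith_cost w Div x y = (1 + num_words w x) * (1 + num_words w y)"
| "arith_cost w Mod x y = (1 + num_words w x) * (1 + num_words w y)"

fun instr_cost :: "nat \<Rightarrow> instr \<Rightarrow> config \<Rightarrow> nat" where
  "instr_cost w (Const r c) s = 1 + num_words w c"
| "instr_cost w (Arith f r a b) s = arith_cost w f (reg s a) (reg s b)"
| "instr_cost w (Load r a) s = 1 + num_words w (reg s a) + num_words w (mem s (reg s a))"
| "instr_cost w (Store a r) s = 1 + num_words w (reg s a) + num_words w (reg s r)"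
| "instr_cost w (Jump l) s = 1"
| "instr_cost w (Jump_Less a b l) s = 1 + num_words w (reg s a) + num_words w (reg s b)"

text \<open>
  \<open>runs w P s t s'\<close>: started in \<open>s\<close>, program \<open>P\<close> halts in \<open>s'\<close> after total time \<open>t\<close>.
  The machine halts when the program counter leaves the program.
\<close>

inductive runs :: "nat \<Rightarrow> program \<Rightarrow> config \<Rightarrow> nat \<Rightarrow> config \<Rightarrow> bool" for w P where
  halt: "length P \<le> pc s \<Longrightarrow> runs w P s 0 s"
| step: "pc s < length P \<Longrightarrow> runs w P (exec_instr (P ! pc s) s) t s' \<Longrightarrow>
    runs w P s (instr_cost w (P ! pc s) s + t) s'"

definition initial_config :: "nat list \<Rightarrow> config" where
  "initial_config xs =
     \<lparr> pc = 0, reg = (\<lambda>_. 0), mem = (\<lambda>a. if a < length xs then xs ! a else 0) \<rparr>"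

text \<open>The answer is left in register 0.\<close>

definition decides_in_time :: "nat \<Rightarrow> program \<Rightarrow> nat list \<Rightarrow> bool \<Rightarrow> nat \<Rightarrow> bool" where
  "decides_in_time w P xs answer t \<longleftrightarrow>
     (\<exists>s. runs w P (initial_config xs) t s \<and> reg s 0 = (if answer then 1 else 0))"

section \<open>Encoding of the input\<close>

text \<open>The out-of-range tetrahedron number \<open>ntet T\<close> stands for a boundary face.\<close>

definition encode_face :: "tri \<Rightarrow> nat \<Rightarrow> nat \<Rightarrow> nat list" where
  "encode_face T t f =
     (case glue T t f of
        None \<Rightarrow> [ntet T, 0, 0, 0, 0]
      | Some (u, p) \<Rightarrow> [u, p 0, p 1, p 2, p 3])"

definition encode_tri :: "tri \<Rightarrow> nat list" where
  "encode_tri T =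
     ntet T # concat (map (\<lambda>t. concat (map (encode_face T t) [0..<4])) [0..<ntet T])"

definition encode_input :: "tri \<Rightarrow> nat list \<Rightarrow> nat list" where
  "encode_input T vs = encode_tri T @ vs"

end

theory Submission
  imports Defs
begin

text \<open>
  Dynamic programming along the layout.  For a set of processed tetrahedra, the classes of
  tetrahedron edges under the gluings among them are either closed, and then are edges of the
  triangulation, or have exactly two loose ends on faces glued to unprocessed tetrahedra.  As such a
  face carries three loose ends and there are at most \<open>k\<close> such faces, there are at most \<open>3k/2\<close> open
  classes.  A table indexed by base-3 numbers of that many digits records which vectors of numbers of
  marks (0, 1 or 2) on the open classes can be attained such that all closed classes have two marks.
  Adding a tetrahedron appends six digits, a gluing of two loose ends adds up two digits if they
  belong to different classes, and otherwise closes a class, whose digit must then be 2.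

  A division that extracts a high digit could cost more than \<open>O(k)\<close>.  Hence the digits concerned are
  first brought to the lowest positions by exchanging digits, in place and with nested counters.  A
  constant number of instructions per table entry then suffices, each at cost \<open>O(k)\<close>, because all
  numbers have \<open>O(log n + k)\<close> bits.
\<close>

section \<open>Structured programs\<close>

text \<open>An open class has two loose ends because a tetrahedron edge lies in exactly two faces of
  its tetrahedron: under gluing, the edges form paths that finally close up to cycles. A path end is
  a face together with an edge of it, called a dart below. Which darts are loose once a tetrahedron
  has been treated depends only on the set of treated tetrahedra, not on the order of the gluings or
  of the stack; this set of darts, the frontier, carries the estimate by the width of the cut.
  Digits can stop at 2, because the marks on a class never decrease when classes merge. The time
  bound is obtained in two stages. Structured programs are analysed by counting instructions, while
  a bound \<open>N\<close> on all operands is enforced; the compilation theorem then multiplies the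
  count by the largest cost of an instruction within this bound. With K the integer part of 3k/2,
  \<open>N\<close> is of order n + 3^K; as a word has the bit length of n, an operand takes O(1 + K)
  words, which gives the factor k. The six extra classes that are open while a tetrahedron is
  attached cost only a constant factor 3^6.\<close>

type_synonym store = "(nat \<Rightarrow> nat) \<times> (nat \<Rightarrow> nat)"

datatype com =
    Basic "instr list"
  | Seq com com  (infixr ";;" 60)
  | If_Less nat nat com com
  | While_Less nat nat com

text \<open>
  The bound \<open>N\<close> limits all operands, and multiplicative operations must have one operand that is at
  most 1000, so that the cost of an instruction is linear in the length of \<open>N\<close>.
\<close>

fun instr_ok :: "nat \<Rightarrow> instr \<Rightarrow> store \<Rightarrow> bool" where
  "instr_ok N (Const r c) s \<longleftrightarrow> c \<le> N"
| "instr_ok N (Arith f r a b) s \<longleftrightarrow> fst s a \<le> N \<and> fst s b \<le> N \<and>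
     (f \<in> {Mul, Div, Mod} \<longrightarrow> fst s a \<le> 1000 \<or> fst s b \<le> 1000)"
| "instr_ok N (Load r a) s \<longleftrightarrow> fst s a \<le> N \<and> snd s (fst s a) \<le> N"
| "instr_ok N (Store a r) s \<longleftrightarrow> fst s a \<le> N \<and> fst s r \<le> N"
| "instr_ok N (Jump l) s \<longleftrightarrow> False"
| "instr_ok N (Jump_Less a b l) s \<longleftrightarrow> False"

fun instr_eff :: "instr \<Rightarrow> store \<Rightarrow> store" where
  "instr_eff (Const r c) (R, M) = (R(r := c), M)"
| "instr_eff (Arith f r a b) (R, M) = (R(r := arith_fun f (R a) (R b)), M)"
| "instr_eff (Load r a) (R, M) = (R(r := M (R a)), M)"
| "instr_eff (Store a r) (R, M) = (R, M(R a := R r))"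
| "instr_eff (Jump l) s = s"
| "instr_eff (Jump_Less a b l) s = s"

fun block_ok :: "nat \<Rightarrow> instr list \<Rightarrow> store \<Rightarrow> bool" where
  "block_ok N [] s \<longleftrightarrow> True"
| "block_ok N (i # is) s \<longleftrightarrow> instr_ok N i s \<and> block_ok N is (instr_eff i s)"

fun block_eff :: "instr list \<Rightarrow> store \<Rightarrow> store" where
  "block_eff [] s = s"
| "block_eff (i # is) s = block_eff is (instr_eff i s)"

text \<open>The increments are the jumps of the compiled code: the else branch stands first and ends
  with a jump over the other branch, hence 2 against 1; a loop takes its test and one further jump
  in every round, and again on exit. The bound on the larger of the two compared registers covers
  both.\<close>

inductive exec :: "nat \<Rightarrow> com \<Rightarrow> store \<Rightarrow> nat \<Rightarrow> store \<Rightarrow> bool" for N where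
  exec_Basic: "block_ok N is s \<Longrightarrow> exec N (Basic is) s (length is) (block_eff is s)"
| exec_Seq: "exec N c s i s' \<Longrightarrow> exec N d s' j s'' \<Longrightarrow> exec N (c ;; d) s (i + j) s''"
| exec_If_True: "fst s a < fst s b \<Longrightarrow> fst s b \<le> N \<Longrightarrow> exec N c s i s' \<Longrightarrow>
    exec N (If_Less a b c d) s (i + 1) s'"
| exec_If_False: "\<not> fst s a < fst s b \<Longrightarrow> fst s a \<le> N \<Longrightarrow> exec N d s i s' \<Longrightarrow>
    exec N (If_Less a b c d) s (i + 2) s'"
| exec_While_True: "fst s a < fst s b \<Longrightarrow> fst s b \<le> N \<Longrightarrow> exec N c s i s' \<Longrightarrow>
    exec N (While_Less a b c) s' j s'' \<Longrightarrow> exec N (While_Less a b c) s (i + j + 2) s''"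
| exec_While_False: "\<not> fst s a < fst s b \<Longrightarrow> fst s a \<le> N \<Longrightarrow> exec N (While_Less a b c) s 2 s"

section \<open>Compilation to code with jumps\<close>

fun csize :: "com \<Rightarrow> nat" where
  "csize (Basic is) = length is"
| "csize (c ;; d) = csize c + csize d"
| "csize (If_Less a b c d) = csize c + csize d + 2"
| "csize (While_Less a b c) = csize c + 3"

fun compile :: "nat \<Rightarrow> com \<Rightarrow> program" where
  "compile l (Basic is) = is"
| "compile l (c ;; d) = compile l c @ compile (l + csize c) d"
| "compile l (If_Less a b c d) =
     Jump_Less a b (l + csize d + 2) # compile (l + 1) d @
     Jump (l + csize d + csize c + 2) # compile (l + csize d + 2) c"
| "compile l (While_Less a b c) =
     Jump_Less a b (l + 2) # Jump (l + csize c + 3) # compile (l + 2) c @ [Jump l]"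

lemma length_compile [simp]: "length (compile l c) = csize c"
  by (induction l c rule: compile.induct) auto

definition code_at :: "program \<Rightarrow> nat \<Rightarrow> program \<Rightarrow> bool" where
  "code_at P l cs \<longleftrightarrow> l + length cs \<le> length P \<and> (\<forall>i < length cs. P ! (l + i) = cs ! i)"

lemma code_at_append:
  "code_at P l (cs @ ds) \<longleftrightarrow> code_at P l cs \<and> code_at P (l + length cs) ds"
proof
  assume a: "code_at P l (cs @ ds)"
  have "P ! (l + length cs + i) = ds ! i" if "i < length ds" for i
    using a that unfolding code_at_def
    by (metis (no_types, lifting) add.assoc length_append nat_add_left_cancel_less nth_append_length_plus)
  with a show "code_at P l cs \<and> code_at P (l + length cs) ds"
    by (auto simp: code_at_def nth_append)
next
  assume a: "code_at P l cs \<and> code_at P (l + length cs) ds"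
  have "P ! (l + i) = (cs @ ds) ! i" if "i < length cs + length ds" for i
  proof (cases "i < length cs")
    case False
    then obtain j where "i = length cs + j" by (metis le_add_diff_inverse not_less)
    then show ?thesis using a that by (auto simp: nth_append code_at_def add.assoc)
  qed (use a in \<open>auto simp: code_at_def nth_append\<close>)
  with a show "code_at P l (cs @ ds)" by (auto simp: code_at_def)
qed

lemma code_at_Cons:
  "code_at P l (i # cs) \<longleftrightarrow> l < length P \<and> P ! l = i \<and> code_at P (Suc l) cs"
  using code_at_append[of P l "[i]" cs] by (auto simp: code_at_def)

abbreviation at_pc :: "nat \<Rightarrow> store \<Rightarrow> config" where
  "at_pc l s \<equiv> \<lparr>pc = l, reg = fst s, mem = snd s\<rparr>"

section \<open>Lengths of numbers and costs of instructions\<close>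

lemma less_power_bit_length: "x < 2 ^ bit_length x"
  unfolding bit_length_def by (rule LeastI_ex) (use less_exp in blast)

lemma bit_length_le: "x < 2 ^ b \<Longrightarrow> bit_length x \<le> b"
  unfolding bit_length_def by (rule Least_le)

lemma bit_length_mono: "x \<le> y \<Longrightarrow> bit_length x \<le> bit_length y"
  using less_power_bit_length[of y] by (intro bit_length_le) linarith

lemma num_words_mono: "x \<le> y \<Longrightarrow> num_words w x \<le> num_words w y"
  unfolding num_words_def
  by (intro nat_mono ceiling_mono divide_right_mono) (auto simp: bit_length_mono)

lemma num_words_le_bit_length:
  assumes "0 < w" shows "num_words w x \<le> bit_length x"
proof -
  have "real (bit_length x) / real w \<le> real (bit_length x)"
    using assms by (simp add: divide_le_eq mult_le_cancel_left1)
  then show ?thesis unfolding num_words_def by (simp add: nat_le_iff ceiling_le_iff)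
qed

text \<open>11 is 1 + 10: a number up to 1000 has at most 10 bits, hence at most 10 words for every
  positive word size. This settles multiplication and division with one small operand; transfers and
  additions are covered as well.\<close>

definition max_cost :: "nat \<Rightarrow> nat \<Rightarrow> nat" where
  "max_cost w N = 11 * (1 + num_words w N)"

lemma num_words_small:
  assumes "0 < w" "y \<le> 1000" shows "num_words w y \<le> 10"
proof -
  have "bit_length y \<le> 10" using assms by (intro bit_length_le) simp
  with num_words_le_bit_length[OF assms(1), of y] show ?thesis by linarith
qed

lemma mult_cost_le:
  assumes "0 < w" "x \<le> N" "y \<le> N" "x \<le> 1000 \<or> y \<le> 1000"
  shows "(1 + num_words w x) * (1 + num_words w y) \<le> max_cost w N"
proof -
  consider "num_words w x \<le> 10" | "num_words w y \<le> 10"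
    using assms num_words_small by blast
  then show ?thesis
  proof cases
    case 1
    then have "(1 + num_words w x) * (1 + num_words w y) \<le> 11 * (1 + num_words w N)"
      using num_words_mono[OF assms(3), of w] by (intro mult_mono) auto
    then show ?thesis by (simp add: max_cost_def)
  next
    case 2
    then have "(1 + num_words w x) * (1 + num_words w y) \<le> (1 + num_words w N) * 11"
      using num_words_mono[OF assms(2), of w] by (intro mult_mono) auto
    then show ?thesis by (simp add: max_cost_def)
  qed
qed

lemma add_cost_le:
  assumes "x \<le> N" "y \<le> N"
  shows "1 + num_words w x + num_words w y \<le> max_cost w N"
  using num_words_mono[OF assms(1), of w] num_words_mono[OF assms(2), of w]
  by (simp add: max_cost_def)

lemma instr_cost_le:
  assumes "0 < w" "instr_ok N i (R, M)"
  shows "instr_cost w i \<lparr>pc = l, reg = R, mem = M\<rparr> \<le> max_cost w N"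
proof (cases i)
  case (Const r c)
  then show ?thesis using assms add_cost_le[of c N c w] by simp
next
  case (Arith f r a b)
  then show ?thesis using assms add_cost_le[of "R a" N "R b" w] mult_cost_le[of w "R a" N "R b"]
    by (cases f) auto
next
  case (Load r a)
  then show ?thesis using assms add_cost_le[of "R a" N "M (R a)" w] by simp
next
  case (Store a r)
  then show ?thesis using assms add_cost_le[of "R a" N "R r" w] by simp
qed (use assms in auto)

lemma exec_instr_eff:
  assumes "instr_ok N i s"
  shows "exec_instr i (at_pc l s) = at_pc (Suc l) (instr_eff i s)"
  using assms by (cases i; cases s) auto

lemma runs_step:
  assumes "0 < w" "code_at P l [i]" "instr_ok N i s"
    "runs w P (at_pc (Suc l) (instr_eff i s)) t s'"
  shows "\<exists>t'. runs w P (at_pc l s) (t' + t) s' \<and> t' \<le> max_cost w N"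
proof -
  have P: "l < length P" "P ! l = i" using assms(2) by (auto simp: code_at_def)
  have "runs w P (at_pc l s) (instr_cost w (P ! pc (at_pc l s)) (at_pc l s) + t) s'"
    by (rule runs.step) (use P assms exec_instr_eff[OF assms(3)] in auto)
  then show ?thesis
    using instr_cost_le[of w N i "fst s" "snd s" l] P assms by auto
qed

lemma runs_Jump:
  assumes "code_at P l [Jump l']" "runs w P (at_pc l' s) t s'"
  shows "\<exists>t'. runs w P (at_pc l s) (t' + t) s' \<and> t' \<le> max_cost w N"
proof -
  have P: "l < length P" "P ! l = Jump l'" using assms(1) by (auto simp: code_at_def)
  have "runs w P (at_pc l s) (instr_cost w (P ! pc (at_pc l s)) (at_pc l s) + t) s'"
    by (rule runs.step) (use P assms in auto)
  then show ?thesis using P by (auto simp: max_cost_def intro!: exI[of _ 1])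
qed

lemma runs_Jump_Less:
  assumes "code_at P l [Jump_Less a b l']" "fst s a \<le> N" "fst s b \<le> N"
    "runs w P (at_pc (if fst s a < fst s b then l' else Suc l) s) t s'"
  shows "\<exists>t'. runs w P (at_pc l s) (t' + t) s' \<and> t' \<le> max_cost w N"
proof -
  have P: "l < length P" "P ! l = Jump_Less a b l'" using assms(1) by (auto simp: code_at_def)
  have "runs w P (at_pc l s) (instr_cost w (P ! pc (at_pc l s)) (at_pc l s) + t) s'"
    by (rule runs.step) (use P assms in auto)
  then show ?thesis using P add_cost_le[OF assms(2,3), of w]
    by (auto intro!: exI[of _ "Suc (num_words w (fst s a) + num_words w (fst s b))"])
qed

lemma runs_block:
  assumes "0 < w" "block_ok N is s" "code_at P l is"
    "runs w P (at_pc (l + length is) (block_eff is s)) t s'"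
  shows "\<exists>t'. runs w P (at_pc l s) (t' + t) s' \<and> t' \<le> length is * max_cost w N"
  using assms(2-4)
proof (induction "is" arbitrary: l s)
  case Nil
  then show ?case by (auto intro!: exI[of _ 0])
next
  case (Cons i "is")
  then obtain t1 where t1: "runs w P (at_pc (Suc l) (instr_eff i s)) (t1 + t) s'"
      "t1 \<le> length is * max_cost w N"
    by (fastforce simp: code_at_Cons)
  have "code_at P l [i]" using Cons.prems(2) by (auto simp: code_at_Cons code_at_def)
  then obtain t2 where t2: "runs w P (at_pc l s) (t2 + (t1 + t)) s'" "t2 \<le> max_cost w N"
    using runs_step[OF assms(1) _ _ t1(1)] Cons.prems(1) by auto
  show ?case using t1 t2 by (intro exI[of _ "t2 + t1"]) (auto simp: add.assoc)
qed

text \<open>\<open>runs\<close> speaks only of complete runs up to halting. A code fragment is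
  therefore described by what it puts in front of an arbitrary continuation of time
  \<open>t\<close>, so that sequences and loops can be treated by induction without splitting
  runs.\<close>

theorem compile_correct:
  assumes "0 < w" "exec N c s j s'" "code_at P l (compile l c)"
    "runs w P (at_pc (l + csize c) s') t u"
  shows "\<exists>t'. runs w P (at_pc l s) (t' + t) u \<and> t' \<le> j * max_cost w N"
  using assms(2-4)
proof (induction arbitrary: l t rule: exec.induct)
  case (exec_Basic "is" s)
  then show ?case using runs_block[OF assms(1)] by auto
next
  case (exec_Seq c s i s' d j s'')
  have c: "code_at P l (compile l c)" "code_at P (l + csize c) (compile (l + csize c) d)"
    using exec_Seq.prems(1) by (auto simp: code_at_append)
  obtain t1 where t1: "runs w P (at_pc (l + csize c) s') (t1 + t) u" "t1 \<le> j * max_cost w N"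
    using exec_Seq.IH(2)[OF c(2)] exec_Seq.prems(2) by (auto simp: add.assoc)
  obtain t2 where t2: "runs w P (at_pc l s) (t2 + (t1 + t)) u" "t2 \<le> i * max_cost w N"
    using exec_Seq.IH(1)[OF c(1) t1(1)] by auto
  then show ?case using t1
    by (intro exI[of _ "t2 + t1"]) (auto simp: add.assoc algebra_simps)
next
  case (exec_If_True s a b c i s' d)
  have c: "code_at P l [Jump_Less a b (l + csize d + 2)]"
      "code_at P (l + csize d + 2) (compile (l + csize d + 2) c)"
    using exec_If_True.prems(1) by (auto simp: code_at_append code_at_Cons code_at_def[of _ _ "[]"])
  have "runs w P (at_pc (l + csize d + 2 + csize c) s') t u"
    using exec_If_True.prems(2) by (simp add: ac_simps)
  then obtain t1 where t1: "runs w P (at_pc (l + csize d + 2) s) (t1 + t) u" "t1 \<le> i * max_cost w N"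
    using exec_If_True.IH[OF c(2)] by blast
  obtain t2 where t2: "runs w P (at_pc l s) (t2 + (t1 + t)) u" "t2 \<le> max_cost w N"
    using runs_Jump_Less[OF c(1), of s N w "t1 + t" u] exec_If_True.hyps t1 by auto
  then show ?case using t1
    by (intro exI[of _ "t2 + t1"]) (auto simp: add.assoc algebra_simps)
next
  case (exec_If_False s a b d i s' c)
  let ?e = "l + csize d + csize c + 2"
  have c: "code_at P l [Jump_Less a b (l + csize d + 2)]"
      "code_at P (l + 1) (compile (l + 1) d)" "code_at P (l + 1 + csize d) [Jump ?e]"
    using exec_If_False.prems(1) by (auto simp: code_at_append code_at_Cons code_at_def[of _ _ "[]"])
  obtain t0 where t0: "runs w P (at_pc (l + 1 + csize d) s') (t0 + t) u" "t0 \<le> max_cost w N"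
    using runs_Jump[OF c(3), of w s' t u N] exec_If_False.prems(2) by (auto simp: algebra_simps)
  obtain t1 where t1: "runs w P (at_pc (l + 1) s) (t1 + (t0 + t)) u" "t1 \<le> i * max_cost w N"
    using exec_If_False.IH[OF c(2) t0(1)] by auto
  have b: "fst s b \<le> N" using exec_If_False.hyps by simp
  obtain t2 where t2: "runs w P (at_pc l s) (t2 + (t1 + (t0 + t))) u" "t2 \<le> max_cost w N"
    using runs_Jump_Less[OF c(1), of s N w "t1 + (t0 + t)" u] exec_If_False.hyps b t1 by auto
  then show ?case using t1 t0
    by (intro exI[of _ "t2 + t1 + t0"]) (auto simp: add.assoc algebra_simps)
next
  case (exec_While_True s a b c i s' j s'')
  have c: "code_at P l [Jump_Less a b (l + 2)]"
      "code_at P (l + 2) (compile (l + 2) c)" "code_at P (l + 2 + csize c) [Jump l]"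
    using exec_While_True.prems(1) by (auto simp: code_at_append code_at_Cons code_at_def[of _ _ "[]"])
  obtain t0 where t0: "runs w P (at_pc l s') (t0 + t) u" "t0 \<le> j * max_cost w N"
    using exec_While_True.IH(2)[OF exec_While_True.prems] by auto
  obtain t1 where t1: "runs w P (at_pc (l + 2 + csize c) s') (t1 + (t0 + t)) u" "t1 \<le> max_cost w N"
    using runs_Jump[OF c(3) t0(1), of N] by auto
  obtain t2 where t2: "runs w P (at_pc (l + 2) s) (t2 + (t1 + (t0 + t))) u" "t2 \<le> i * max_cost w N"
    using exec_While_True.IH(1)[OF c(2) t1(1)] by auto
  obtain t3 where t3: "runs w P (at_pc l s) (t3 + (t2 + (t1 + (t0 + t)))) u" "t3 \<le> max_cost w N"
    using runs_Jump_Less[OF c(1), of s N w "t2 + (t1 + (t0 + t))" u] exec_While_True.hyps t2 by auto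
  then show ?case using t2 t1 t0
    by (intro exI[of _ "t3 + t2 + t1 + t0"]) (auto simp: add.assoc algebra_simps)
next
  case (exec_While_False s a b c)
  have c: "code_at P l [Jump_Less a b (l + 2)]" "code_at P (l + 1) [Jump (l + csize c + 3)]"
    using exec_While_False.prems(1) by (auto simp: code_at_append code_at_Cons code_at_def[of _ _ "[]"])
  obtain t1 where t1: "runs w P (at_pc (l + 1) s) (t1 + t) u" "t1 \<le> max_cost w N"
    using runs_Jump[OF c(2), of w s t u N] exec_While_False.prems(2) by (auto simp: algebra_simps)
  have b: "fst s b \<le> N" using exec_While_False.hyps by simp
  obtain t2 where t2: "runs w P (at_pc l s) (t2 + (t1 + t)) u" "t2 \<le> max_cost w N"
    using runs_Jump_Less[OF c(1), of s N w "t1 + t" u] exec_While_False.hyps b t1 by auto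
  then show ?case using t1
    by (intro exI[of _ "t2 + t1"]) (auto simp: add.assoc algebra_simps)
qed

section \<open>Total correctness with a bound on the number of steps\<close>

definition hoare :: "nat \<Rightarrow> nat \<Rightarrow> (store \<Rightarrow> bool) \<Rightarrow> com \<Rightarrow> (store \<Rightarrow> bool) \<Rightarrow> bool" where
  "hoare N j P c Q \<longleftrightarrow> (\<forall>s. P s \<longrightarrow> (\<exists>i s'. exec N c s i s' \<and> i \<le> j \<and> Q s'))"

lemma hoareI: "(\<And>s. P s \<Longrightarrow> \<exists>i s'. exec N c s i s' \<and> i \<le> j \<and> Q s') \<Longrightarrow> hoare N j P c Q"
  by (simp add: hoare_def)

lemma hoare_conseq:
  assumes "hoare N j P c Q" "\<And>s. P' s \<Longrightarrow> P s" "\<And>s. Q s \<Longrightarrow> Q' s" "j \<le> j'"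
  shows "hoare N j' P' c Q'"
  using assms unfolding hoare_def by (meson order_trans)

lemma hoare_Basic:
  assumes "\<And>R M. P (R, M) \<Longrightarrow> block_ok N is (R, M) \<and> Q (block_eff is (R, M))"
    "length is \<le> j"
  shows "hoare N j P (Basic is) Q"
proof (rule hoareI)
  fix s assume "P s"
  then show "\<exists>i s'. exec N (Basic is) s i s' \<and> i \<le> j \<and> Q s'"
    using assms exec_Basic[of N "is" s] by (cases s) blast
qed

lemma hoare_Seq:
  assumes "hoare N i P c Q" "hoare N j Q d R" "i + j \<le> k"
  shows "hoare N k P (c ;; d) R"
proof (rule hoareI)
  fix s assume "P s"
  then obtain i' s' where 1: "exec N c s i' s'" "i' \<le> i" "Q s'"
    using assms(1) unfolding hoare_def by blast
  then obtain j' s'' where 2: "exec N d s' j' s''" "j' \<le> j" "R s''"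
    using assms(2) unfolding hoare_def by blast
  show "\<exists>i s'. exec N (c ;; d) s i s' \<and> i \<le> k \<and> R s'"
    using exec_Seq[OF 1(1) 2(1)] 1 2 assms(3) by (intro exI[of _ "i' + j'"] exI[of _ s'']) simp
qed

lemma hoare_If:
  assumes "\<And>s. P s \<Longrightarrow> fst s a \<le> N \<and> fst s b \<le> N"
    "hoare N j (\<lambda>s. P s \<and> fst s a < fst s b) c Q"
    "hoare N j (\<lambda>s. P s \<and> \<not> fst s a < fst s b) d Q"
    "j + 2 \<le> k"
  shows "hoare N k P (If_Less a b c d) Q"
proof (rule hoareI)
  fix s assume P: "P s"
  show "\<exists>i s'. exec N (If_Less a b c d) s i s' \<and> i \<le> k \<and> Q s'"
  proof (cases "fst s a < fst s b")
    case True
    with assms(2) P obtain i s' where "exec N c s i s'" "i \<le> j" "Q s'" unfolding hoare_def by blast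
    then show ?thesis using exec_If_True[OF True] assms(1)[OF P] assms(4)
      by (intro exI[of _ "i + 1"] exI[of _ s']) simp
  next
    case False
    with assms(3) P obtain i s' where "exec N d s i s'" "i \<le> j" "Q s'" unfolding hoare_def by blast
    then show ?thesis using exec_If_False[OF False] assms(1)[OF P] assms(4)
      by (intro exI[of _ "i + 2"] exI[of _ s']) simp
  qed
qed

text \<open>The variant \<open>v\<close> is a parameter of the invariant and may drop by any amount;
  a search loop uses this to stop early by falling to 0 at once.\<close>

lemma hoare_While:
  assumes "\<And>v s. I v s \<Longrightarrow> (fst s a < fst s b \<longleftrightarrow> 0 < v) \<and> fst s a \<le> N \<and> fst s b \<le> N"
    "\<And>v. 0 < v \<Longrightarrow> hoare N j (I v) c (\<lambda>s. \<exists>v' < v. I v' s)"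
    "v * (j + 2) + 2 \<le> k"
  shows "hoare N k (I v) (While_Less a b c) (I 0)"
proof (rule hoareI)
  fix s assume "I v s"
  then have "\<exists>i s'. exec N (While_Less a b c) s i s' \<and> i \<le> v * (j + 2) + 2 \<and> I 0 s'"
  proof (induction v arbitrary: s rule: less_induct)
    case (less v)
    show ?case
    proof (cases "0 < v")
      case False
      then show ?thesis using assms(1)[OF less.prems] less.prems
        by (intro exI[of _ 2] exI[of _ s]) (auto intro: exec_While_False)
    next
      case True
      obtain i s' v' where 1: "exec N c s i s'" "i \<le> j" "v' < v" "I v' s'"
        using assms(2)[OF True] less.prems unfolding hoare_def by blast
      obtain i' s'' where 2: "exec N (While_Less a b c) s' i' s''" "i' \<le> v' * (j + 2) + 2" "I 0 s''"
        using less.IH[OF 1(3,4)] by blast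
      have "exec N (While_Less a b c) s (i + i' + 2) s''"
        using exec_While_True[OF _ _ 1(1) 2(1)] assms(1)[OF less.prems] True by auto
      moreover have "(v' + 1) * (j + 2) \<le> v * (j + 2)"
        using 1(3) by (intro mult_le_mono1) simp
      then have "i + i' + 2 \<le> v * (j + 2) + 2" using 1(2) 2(2) by simp
      ultimately show ?thesis using 2(3) by blast
    qed
  qed
  then show "\<exists>i s'. exec N (While_Less a b c) s i s' \<and> i \<le> k \<and> I 0 s'"
    using assms(3) by (meson order_trans)
qed

lemma hoare_ex: "(\<And>x. hoare N j (P x) c Q) \<Longrightarrow> hoare N j (\<lambda>s. \<exists>x. P x s) c Q"
  by (auto simp: hoare_def)

lemma hoare_pre: "(A \<Longrightarrow> hoare N j P c Q) \<Longrightarrow> hoare N j (\<lambda>s. A \<and> P s) c Q"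
  by (auto simp: hoare_def)

section \<open>Base-3 encoding of digit lists\<close>

text \<open>Lowest digit first, so that the head of the list, which will be the top of the stack,
  can be split off or prepended by arithmetic with the constant 3.\<close>

fun enc :: "nat list \<Rightarrow> nat" where
  "enc [] = 0"
| "enc (d # ds) = d + 3 * enc ds"

lemma enc_append: "enc (xs @ ys) = enc xs + 3 ^ length xs * enc ys"
  by (induction xs) auto

lemma enc_less: "set ds \<subseteq> {..<3} \<Longrightarrow> enc ds < 3 ^ length ds"
  by (induction ds) auto

lemma enc_inj:
  assumes "length xs = length ys" "set xs \<subseteq> {..<3}" "set ys \<subseteq> {..<3}" "enc xs = enc ys"
  shows "xs = ys"
  using assms
proof (induction xs ys rule: list_induct2)
  case (Cons x xs y ys)
  then have "(x + 3 * enc xs) mod 3 = (y + 3 * enc ys) mod 3" by simp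
  then have "x = y" using Cons.prems by simp
  with Cons show ?case by auto
qed simp

lemma enc_surj: "x < 3 ^ m \<Longrightarrow> \<exists>ds. length ds = m \<and> set ds \<subseteq> {..<3} \<and> enc ds = x"
proof (induction m arbitrary: x)
  case (Suc m)
  then have "x div 3 < 3 ^ m" by auto
  with Suc.IH obtain ds where "length ds = m" "set ds \<subseteq> {..<3}" "enc ds = x div 3" by blast
  then show ?case by (intro exI[of _ "x mod 3 # ds"]) auto
qed simp

section \<open>Exchange of the head with another list entry\<close>

definition swap_head :: "nat \<Rightarrow> 'a list \<Rightarrow> 'a list" where
  "swap_head p xs = xs[0 := xs ! p, p := xs ! 0]"

lemma length_swap_head [simp]: "length (swap_head p xs) = length xs"
  by (simp add: swap_head_def)

lemma nth_swap_head:
  "p < length xs \<Longrightarrow> i < length xs \<Longrightarrow>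
    swap_head p xs ! i = xs ! (if i = 0 then p else if i = p then 0 else i)"
  by (cases xs) (auto simp: swap_head_def nth_list_update nth_Cons split: nat.splits)

lemma swap_head_swap_head [simp]:
  assumes "p < length xs" shows "swap_head p (swap_head p xs) = xs"
proof (rule nth_equalityI)
  have "xs \<noteq> []" using assms by auto
  then show "swap_head p (swap_head p xs) ! i = xs ! i" if "i < length (swap_head p (swap_head p xs))" for i
    using assms that by (auto simp: nth_swap_head)
qed simp

lemma set_swap_head_subset: "p < length xs \<Longrightarrow> set (swap_head p xs) \<subseteq> set xs"
  unfolding swap_head_def
  by (metis insert_subset length_greater_0_conv list.size(3) not_less_zero nth_mem order_refl
      set_update_subset_insert subset_trans set_update_subsetI)

lemma set_swap_head [simp]: "p < length xs \<Longrightarrow> set (swap_head p xs) = set xs"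
  using set_swap_head_subset[of p xs] set_swap_head_subset[of p "swap_head p xs"] by auto

lemma map_swap_head: "p < length xs \<Longrightarrow> map f (swap_head p xs) = swap_head p (map f xs)"
  by (cases xs) (auto simp: swap_head_def map_update nth_Cons split: nat.splits)

lemma sorted_wrt_swap_head:
  assumes "\<And>x y. R x y \<Longrightarrow> R y x" "sorted_wrt R xs" "p < length xs"
  shows "sorted_wrt R (swap_head p xs)"
proof -
  have R: "R (xs ! i) (xs ! j)" if "i < length xs" "j < length xs" "i \<noteq> j" for i j
    using assms that by (metis linorder_neqE_nat sorted_wrt_nth_less)
  show ?thesis unfolding sorted_wrt_iff_nth_less
    using assms(3) by (auto simp: nth_swap_head intro!: R)
qed

section \<open>Darts and edge classes\<close>

text \<open>
  The dart \<open>(t, f, g)\<close> is face \<open>f\<close> of tetrahedron \<open>t\<close> together with its edge opposite to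
  vertex \<open>g\<close>; the other face of \<open>t\<close> that contains this edge is \<open>g\<close>.
\<close>

type_synonym dart = "nat \<times> nat \<times> nat"

fun dart_edge :: "dart \<Rightarrow> nat \<times> nat set" where
  "dart_edge (t, f, g) = (t, {..<4} - {f, g})"

definition darts_in :: "nat set \<Rightarrow> dart set" where
  "darts_in X = {(t, f, g). t \<in> X \<and> f < 4 \<and> g < 4 \<and> f \<noteq> g}"

definition edges_in :: "nat set \<Rightarrow> (nat \<times> nat set) set" where
  "edges_in X = {(t, e). t \<in> X \<and> e \<subseteq> {..<4} \<and> card e = 2}"

definition count_marked :: "(nat \<Rightarrow> nat set set) \<Rightarrow> (nat \<times> nat set) set \<Rightarrow> nat" where
  "count_marked m P = card {(t, e) \<in> P. e \<in> m t}"

lemma finite_edges_in: "finite X \<Longrightarrow> finite (edges_in X)"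
  by (rule finite_subset[of _ "X \<times> Pow {..<4}"]) (auto simp: edges_in_def)

lemma complements_4:
  "{..<4} - {0, 1} = {2, 3::nat}" "{..<4} - {0, 2} = {1, 3::nat}"
  "{..<4} - {0, 3} = {1, 2::nat}" "{..<4} - {1, 2} = {0, 3::nat}"
  "{..<4} - {1, 3} = {0, 2::nat}" "{..<4} - {2, 3} = {0, 1::nat}"
  "{..<4} - {0, Suc 0} = {2, 3::nat}" "{..<4} - {Suc 0, 2} = {0, 3::nat}"
  "{..<4} - {Suc 0, 3} = {0, 2::nat}"
  by auto

lemma two_subset_4:
  assumes "e \<subseteq> {..<4::nat}" "card e = 2"
  shows "e \<in> {{0,1}, {0,2}, {0,3}, {1,2}, {1,3}, {2,3}}"
proof -
  obtain a b where e: "e = {a, b}" "a \<noteq> b" using assms(2) by (auto simp: card_2_iff)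
  have "a \<in> {0,1,2,3}" "b \<in> {0,1,2,3}" using assms e by auto
  then show ?thesis using e(2) unfolding e(1)
    by (elim insertE emptyE) (simp_all add: doubleton_eq_iff)
qed

lemma edge_complement:
  fixes f :: nat
  assumes "e \<subseteq> {..<4} - {f}" "card e = 2" "f < 4"
  obtains g where "g < 4" "g \<noteq> f" "e = {..<4} - {f, g}"
proof -
  have "card ({..<4} - {f} - e) = 1"
    using assms by (subst card_Diff_subset) (auto intro: finite_subset)
  then obtain g where g: "{..<4} - {f} - e = {g}" by (auto simp: card_1_singleton_iff)
  then have "g < 4" "g \<noteq> f" "e = {..<4} - {f, g}" using assms(1) by blast+
  then show ?thesis using that by blast
qed

lemma card_edge_complement:
  fixes f g :: nat
  assumes "f < 4" "g < 4" "f \<noteq> g"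
  shows "card ({..<4} - {f, g}) = 2"
  using assms by (subst card_Diff_subset) auto

lemma dart_edge_in: "d \<in> darts_in X \<Longrightarrow> dart_edge d \<in> edges_in X"
  by (auto simp: darts_in_def edges_in_def card_edge_complement)

lemma opposite_edge_pairs_eq:
  "opposite_edge_pairs = {{{0,1},{2,3}}, {{0,2},{1,3}}, {{0,3},{1,2}}}" (is "?L = ?R")
proof -
  have *: "{e, {..<4} - e} \<in> ?R" if "e \<subseteq> {..<4::nat}" "card e = 2" for e
  proof -
    have "e \<in> {{0,1}, {0,2}, {0,3}, {1,2}, {1,3}, {2,3}}" using two_subset_4[OF that] .
    then show ?thesis
      by (elim insertE emptyE) (simp_all add: complements_4 doubleton_eq_iff)
  qed
  have "?L \<subseteq> ?R"
  proof
    fix y assume "y \<in> ?L"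
    then obtain e where "e \<subseteq> {..<4}" "card e = 2" "y = {e, {..<4} - e}"
      unfolding opposite_edge_pairs_def mem_Collect_eq by (elim exE conjE)
    then show "y \<in> ?R" using *[of e] by (simp only:)
  qed
  moreover have L: "{{0,i},{..<4} - {0,i}} \<in> ?L" if "i < 4" "i \<noteq> 0" for i
    unfolding opposite_edge_pairs_def mem_Collect_eq
    by (rule exI[of _ "{0, i}"]) (use that in simp)
  have "?R \<subseteq> ?L" using L[of 1] L[of 2] L[of 3] by (simp add: complements_4)
  ultimately show ?thesis by (rule subset_antisym)
qed

text \<open>If \<open>y\<close> has lowest digit \<open>s\<close> and the remaining digits encode
  \<open>e\<close>, then \<open>z\<close> is \<open>s + 9 * e\<close>, with the two lowest digits
  \<open>s\<close> and 0. Moving one unit from the lowest digit to the next changes the index by 3 -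
  1 = 2, so \<open>z\<close>, \<open>z + 2\<close>, \<open>z + 4\<close> run through the ways to
  split \<open>s\<close>; for a 0/1 table, \<open>min 1\<close> of the sum is their
  disjunction.\<close>

definition merge_table :: "(nat \<Rightarrow> nat) \<Rightarrow> nat \<Rightarrow> nat" where
  "merge_table A y = (let z = 3 * y - 2 * (y mod 3) in
     min 1 (A z + (if 1 \<le> y mod 3 then A (z + 2) else 0) + (if y mod 3 = 2 then A (z + 4) else 0)))"

lemma merge_table_enc:
  assumes "s < 3"
  shows "merge_table A (enc (s # ds)) =
    min 1 (\<Sum>b\<le>s. A (enc ((s - b) # b # ds)))"
proof -
  define z where "z = s + 9 * enc ds"
  have "3 * (s + 3 * enc ds) - 2 * s = z" "(s + 3 * enc ds) mod 3 = s"
    using assms by (auto simp: z_def)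
  then have 1: "merge_table A (enc (s # ds)) =
      min 1 (A z + (if 1 \<le> s then A (z + 2) else 0) + (if s = 2 then A (z + 4) else 0))"
    by (simp add: merge_table_def)
  have 2: "(\<Sum>b\<le>s. A (enc ((s - b) # b # ds))) = (\<Sum>b\<le>s. A (z + 2 * b))"
  proof (intro sum.cong refl)
    fix b assume "b \<in> {..s}"
    then have "enc ((s - b) # b # ds) = z + 2 * b" by (simp add: z_def)
    then show "A (enc ((s - b) # b # ds)) = A (z + 2 * b)" by (simp only:)
  qed
  have 3: "{..1} = {0, 1::nat}" "{..2} = {0, 1, 2::nat}" by auto
  consider "s = 0" | "s = 1" | "s = 2" using assms by linarith
  then show ?thesis unfolding 1 2
    by cases (simp_all only: 3, simp_all add: eval_nat_numeral add.assoc)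
qed

lemma count_marked_Un:
  assumes "P \<inter> Q = {}" "finite P" "finite Q"
  shows "count_marked m (P \<union> Q) = count_marked m P + count_marked m Q"
proof -
  have "{(t, e) \<in> P \<union> Q. e \<in> m t} = {(t, e) \<in> P. e \<in> m t} \<union> {(t, e) \<in> Q. e \<in> m t}" by auto
  then show ?thesis unfolding count_marked_def using assms
    by (simp, subst card_Un_disjoint) (auto intro: finite_subset)
qed

section \<open>Gluing of darts and classes of edges\<close>

locale closed_triangulation =
  fixes T :: tri
  assumes tri: "triangulation T" and no_boundary: "no_boundary_faces T"
begin

abbreviation "n \<equiv> ntet T"

abbreviation "darts \<equiv> darts_in {..<n}"

text \<open>The gluing \<open>p\<close> takes the edge of face \<open>f\<close> opposite
  \<open>g\<close> to the edge of face \<open>p f\<close> opposite \<open>p g\<close>; applying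
  \<open>p\<close> to both entries thus gives the same glued edge as seen from the other side of the
  face.\<close>

definition twin :: "dart \<Rightarrow> dart" where
  "twin d = (case d of (t, f, g) \<Rightarrow> case the (glue T t f) of (u, p) \<Rightarrow> (u, p f, p g))"

lemma tet_edges_eq: "tet_edges T = edges_in {..<n}"
  by (auto simp: tet_edges_def edges_in_def)

lemma glueE:
  assumes "t < n" "f < 4"
  obtains u p where "glue T t f = Some (u, p)" "u < n" "p permutes {..<4}" "(u, p f) \<noteq> (t, f)"
    "glue T u (p f) = Some (t, inv p)" "p f < 4"
proof -
  obtain u p where up: "glue T t f = Some (u, p)"
    using assms no_boundary unfolding no_boundary_faces_def by fastforce
  then have *: "u < n" "p permutes {..<4}" "(u, p f) \<noteq> (t, f)" "glue T u (p f) = Some (t, inv p)"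
    using assms tri unfolding triangulation_def by blast+
  have "p f < 4" using permutes_in_image[OF *(2), of f] assms by simp
  with up * show ?thesis using that by blast
qed

text \<open>Each gluing is recorded from both sides by mutually inverse maps, and no face is glued
  to itself; so \<open>twin\<close> is an involution without fixed points.\<close>

lemma twin_props:
  assumes "d \<in> darts"
  shows "twin d \<in> darts \<and> twin (twin d) = d \<and> twin d \<noteq> d"
proof -
  obtain t f g where d: "d = (t, f, g)" "t < n" "f < 4" "g < 4" "f \<noteq> g"
    using assms by (auto simp: darts_in_def)
  obtain u p where p: "glue T t f = Some (u, p)" "u < n" "p permutes {..<4}" "(u, p f) \<noteq> (t, f)"
    "glue T u (p f) = Some (t, inv p)" "p f < 4" using glueE[OF d(2,3)] .
  have "p g < 4" using permutes_in_image[OF p(3), of g] d by simp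
  moreover have "inj p" using p(3) by (rule permutes_inj)
  then have "p f \<noteq> p g" using d(5) by (auto dest: injD)
  ultimately show ?thesis using p d permutes_inverses(2)[OF p(3)]
    by (auto simp: twin_def darts_in_def)
qed

lemma twin_in [simp]: "d \<in> darts \<Longrightarrow> twin d \<in> darts"
  and twin_twin [simp]: "d \<in> darts \<Longrightarrow> twin (twin d) = d"
  and twin_neq [simp]: "d \<in> darts \<Longrightarrow> twin d \<noteq> d"
  using twin_props by auto

text \<open>An edge of face \<open>f\<close> is given by the vertex \<open>g\<close> of that face
  opposite to it, and permutations commute with complements; so the identifications of edges are
  indexed by darts.\<close>

lemma edge_glue_eq: "edge_glue T = {(dart_edge d, dart_edge (twin d)) | d. d \<in> darts}"
proof -
  have img: "p ` ({..<4} - {f, g}) = {..<4} - {p f, p g}" if "p permutes {..<4::nat}" for p f g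
    using that by (simp add: image_set_diff permutes_inj permutes_image)
  show ?thesis
  proof (intro equalityI subsetI)
    fix x assume "x \<in> edge_glue T"
    then obtain t e f u p where x: "x = ((t, e), (u, p ` e))" "t < n" "f < 4"
        "glue T t f = Some (u, p)" "e \<subseteq> {..<4} - {f}" "card e = 2"
      unfolding edge_glue_def mem_Collect_eq by metis
    then obtain g where g: "g < 4" "g \<noteq> f" "e = {..<4} - {f, g}" using edge_complement by metis
    have p: "p permutes {..<4}" using glueE[OF x(2,3)] x(4) by force
    have "(t, f, g) \<in> darts" using x g by (auto simp: darts_in_def)
    moreover have "x = (dart_edge (t, f, g), dart_edge (twin (t, f, g)))"
      using x g img[OF p] by (simp add: twin_def)
    ultimately show "x \<in> {(dart_edge d, dart_edge (twin d)) | d. d \<in> darts}" by blast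
  next
    fix x assume "x \<in> {(dart_edge d, dart_edge (twin d)) | d. d \<in> darts}"
    then obtain t f g where x: "x = (dart_edge (t, f, g), dart_edge (twin (t, f, g)))"
        "t < n" "f < 4" "g < 4" "f \<noteq> g" by (auto simp: darts_in_def)
    obtain u p where p: "glue T t f = Some (u, p)" "p permutes {..<4}" using glueE[OF x(2,3)] .
    have "x = ((t, {..<4} - {f, g}), (u, p ` ({..<4} - {f, g})))"
      using x(1) img[OF p(2)] p by (simp add: twin_def)
    then show "x \<in> edge_glue T"
      unfolding edge_glue_def mem_Collect_eq
      using x(2,3) p(1) card_edge_complement[OF x(3-5)]
      by (intro exI[of _ t] exI[of _ "{..<4} - {f, g}"] exI[of _ f] exI[of _ u] exI[of _ p]) auto
  qed
qed

lemma edge_glueI: "d \<in> darts \<Longrightarrow> (dart_edge d, dart_edge (twin d)) \<in> edge_glue T"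
  unfolding edge_glue_eq by blast

lemma sym_edge_glue: "sym (edge_glue T)"
proof (rule symI)
  fix x y assume "(x, y) \<in> edge_glue T"
  then obtain d where "d \<in> darts" "x = dart_edge d" "y = dart_edge (twin d)"
    unfolding edge_glue_eq by blast
  then show "(y, x) \<in> edge_glue T" using edge_glueI[of "twin d"] by simp
qed

text \<open>Connectedness puts \<open>P\<close> inside one equivalence class, and closure under
  twins makes it the whole class.\<close>

lemma edge_class_in_tri_edges:
  assumes "P \<subseteq> edges_in {..<n}" "x \<in> P" "\<forall>y\<in>P. \<forall>z\<in>P. (y, z) \<in> (edge_glue T)\<^sup>*"
    "\<forall>d\<in>darts. dart_edge d \<in> P \<longrightarrow> dart_edge (twin d) \<in> P"
  shows "P \<in> tri_edges T"
proof -
  have "y \<in> P" if "(x, y) \<in> (edge_glue T)\<^sup>*" for y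
    using that
  proof (induction rule: rtrancl_induct)
    case (step y z)
    then obtain d where "d \<in> darts" "y = dart_edge d" "z = dart_edge (twin d)"
      unfolding edge_glue_eq by blast
    then show ?case using step.IH assms(4) by blast
  qed (rule assms(2))
  then have "P = (edge_glue T)\<^sup>* `` {x}" using assms(2,3) by blast
  moreover have "x \<in> tet_edges T" using assms(1,2) by (auto simp: tet_edges_eq)
  ultimately show ?thesis unfolding tri_edges_def by (simp add: quotientI)
qed

text \<open>Equivalence classes that meet are equal, so a family of classes that covers all
  tetrahedron edges misses none.\<close>

lemma tri_edges_covered:
  assumes "Ks \<subseteq> tri_edges T" "\<Union>Ks = edges_in {..<n}"
  shows "Ks = tri_edges T"
proof
  have eq: "equiv UNIV ((edge_glue T)\<^sup>*)"
    using sym_edge_glue by (simp add: equiv_def refl_rtrancl sym_rtrancl trans_rtrancl)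
  show "tri_edges T \<subseteq> Ks"
  proof
    fix E assume E: "E \<in> tri_edges T"
    then obtain x where x: "x \<in> edges_in {..<n}" "E = (edge_glue T)\<^sup>* `` {x}"
      unfolding tri_edges_def tet_edges_eq by (rule quotientE)
    then obtain K where K: "K \<in> Ks" "x \<in> K" using assms(2) by blast
    then have "K \<in> tet_edges T // (edge_glue T)\<^sup>*" using assms(1) by (auto simp: tri_edges_def)
    then obtain y where y: "K = (edge_glue T)\<^sup>* `` {y}" by (rule quotientE)
    then have "K = E" using K(2) x(2) equiv_class_eq[OF eq, of y x] by simp
    with K show "E \<in> Ks" by simp
  qed
qed (rule assms(1))

definition marking :: "(nat \<Rightarrow> nat set set) \<Rightarrow> bool" where
  "marking m \<longleftrightarrow> (\<forall>t < n. m t \<in> opposite_edge_pairs)"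

lemma taut_iff:
  "taut_angle_structure T m \<longleftrightarrow> marking m \<and> (\<forall>E\<in>tri_edges T. count_marked m E = 2)"
  by (simp add: taut_angle_structure_def marking_def count_marked_def)


section \<open>Invariant of the dynamic program\<close>

type_synonym open_class = "(nat \<times> nat set) set \<times> dart \<times> dart"

text \<open>A path of edges with its two ends. The twins of \<open>a\<close> and \<open>b\<close>
  are left free: they may lie in treated tetrahedra too, as long as that gluing has not been carried
  out, and \<open>a\<close> and \<open>b\<close> may even be twins of each other.\<close>

definition open_class :: "nat set \<Rightarrow> open_class \<Rightarrow> bool" where
  "open_class X z \<longleftrightarrow> (case z of (P, a, b) \<Rightarrow>
     P \<subseteq> edges_in X \<and> a \<in> darts \<and> b \<in> darts \<and> a \<noteq> b \<and> dart_edge a \<in> P \<and> dart_edge b \<in> P \<and>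
     (\<forall>x\<in>P. \<forall>y\<in>P. (x, y) \<in> (edge_glue T)\<^sup>*) \<and>
     (\<forall>d\<in>darts. dart_edge d \<in> P \<longrightarrow> d = a \<or> d = b \<or> dart_edge (twin d) \<in> P))"

definition open_darts :: "open_class list \<Rightarrow> dart set" where
  "open_darts zs = (\<Union>(P, a, b)\<in>set zs. {a, b})"

abbreviation disjoint_classes :: "open_class list \<Rightarrow> bool" where
  "disjoint_classes \<equiv> sorted_wrt (\<lambda>z z'. fst z \<inter> fst z' = {})"

text \<open>The marking lives on all tetrahedra, although only its values on the treated ones
  influence the counts. Thus the notion does not depend on the set of treated tetrahedra, and a
  marking may be altered elsewhere at will.\<close>

definition feasible ::
    "(nat \<times> nat set) set set \<Rightarrow> (nat \<times> nat set) set list \<Rightarrow> nat list \<Rightarrow> bool" where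
  "feasible Ks Ps ds \<longleftrightarrow>
     (\<exists>m. marking m \<and> (\<forall>K\<in>Ks. count_marked m K = 2) \<and> map (count_marked m) Ps = ds)"

text \<open>
  \<open>X\<close> are the tetrahedra processed so far, \<open>Ks\<close> the edge classes without open darts, and the
  table \<open>A\<close> tells which numbers of markings of the open classes can be attained.
\<close>

definition dp_inv ::
    "nat set \<Rightarrow> open_class list \<Rightarrow> (nat \<times> nat set) set set \<Rightarrow> (nat \<Rightarrow> nat) \<Rightarrow> bool" where
  "dp_inv X zs Ks A \<longleftrightarrow>
     X \<subseteq> {..<n} \<and> (\<forall>z\<in>set zs. open_class X z) \<and> disjoint_classes zs \<and> Ks \<subseteq> tri_edges T \<and>
     \<Union>(fst ` set zs) \<union> \<Union>Ks = edges_in X \<and>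
     (\<forall>ds. length ds = length zs \<longrightarrow> set ds \<subseteq> {..<3} \<longrightarrow>
        A (enc ds) = (if feasible Ks (map fst zs) ds then 1 else 0))"

lemma dp_inv_table:
  assumes "dp_inv X zs Ks A" "length ds = length zs" "set ds \<subseteq> {..<3}"
  shows "A (enc ds) = (if feasible Ks (map fst zs) ds then 1 else 0)"
  using assms unfolding dp_inv_def by blast

lemma dp_inv_table_le:
  assumes "dp_inv X zs Ks A" "x < 3 ^ length zs" shows "A x \<le> 1"
  using enc_surj[OF assms(2)] assms(1) unfolding dp_inv_def by fastforce

lemma dp_inv_init: "dp_inv {} [] {} (\<lambda>_. 1)"
proof -
  have "{{0,1},{2,3}} \<in> opposite_edge_pairs" by (simp add: opposite_edge_pairs_eq)
  then have "marking (\<lambda>_. {{0,1},{2,3}})" unfolding marking_def by blast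
  then have "feasible {} [] []" unfolding feasible_def by auto
  then show ?thesis by (auto simp: dp_inv_def edges_in_def)
qed

lemma dp_inv_final:
  assumes "dp_inv {..<n} [] Ks A"
  shows "A 0 = (if \<exists>m. taut_angle_structure T m then 1 else 0)"
proof -
  have "Ks = tri_edges T"
    using assms by (intro tri_edges_covered) (auto simp: dp_inv_def)
  then have "feasible Ks [] [] \<longleftrightarrow> (\<exists>m. taut_angle_structure T m)"
    by (auto simp: feasible_def taut_iff)
  moreover have "A (enc []) = (if feasible Ks [] [] then 1 else 0)"
    using dp_inv_table[OF assms, of "[]"] by simp
  ultimately show ?thesis by simp
qed

lemma open_darts_edge:
  assumes "\<forall>z\<in>set zs. open_class X z" "x \<in> open_darts zs"
  shows "\<exists>z\<in>set zs. dart_edge x \<in> fst z"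
  using assms unfolding open_darts_def open_class_def by fastforce

lemma not_open_darts:
  assumes "\<forall>z\<in>set zs. open_class X z" "\<forall>z\<in>set zs. P \<inter> fst z = {}" "dart_edge x \<in> P"
  shows "x \<notin> open_darts zs"
  using open_darts_edge[OF assms(1), of x] assms(2,3) by blast

text \<open>A dart determines its edge, so disjoint classes have different ends.\<close>

lemma card_open_darts:
  assumes "\<forall>z\<in>set zs. open_class X z" "disjoint_classes zs"
  shows "finite (open_darts zs) \<and> card (open_darts zs) = 2 * length zs"
  using assms
proof (induction zs)
  case (Cons z zs)
  obtain P a b where z: "z = (P, a, b)" by (cases z)
  have ab: "a \<noteq> b" "dart_edge a \<in> P" "dart_edge b \<in> P"
    using Cons.prems z by (auto simp: open_class_def)
  have "a \<notin> open_darts zs \<and> b \<notin> open_darts zs"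
    using not_open_darts[of zs X P] Cons.prems z ab by auto
  moreover have "open_darts (z # zs) = insert a (insert b (open_darts zs))"
    using z by (auto simp: open_darts_def)
  ultimately show ?case using Cons ab by auto
qed (simp add: open_darts_def)

lemma dp_inv_open_darts:
  assumes "dp_inv X zs Ks A"
  shows "open_darts zs \<subseteq> darts" "finite (open_darts zs)" "card (open_darts zs) = 2 * length zs"
  using assms card_open_darts[of zs X] unfolding dp_inv_def open_darts_def open_class_def by auto

section \<open>Table operations and the invariant\<close>

lemma dp_inv_swap:
  assumes "dp_inv X zs Ks A" "p < length zs"
    "\<And>ds. length ds = length zs \<Longrightarrow> set ds \<subseteq> {..<3} \<Longrightarrow> A' (enc ds) = A (enc (swap_head p ds))"
  shows "dp_inv X (swap_head p zs) Ks A'"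
proof -
  have f: "feasible Ks (map fst (swap_head p zs)) ds \<longleftrightarrow> feasible Ks (map fst zs) (swap_head p ds)"
    if "length ds = length zs" for ds
  proof -
    have "map (count_marked m) (map fst (swap_head p zs)) = ds \<longleftrightarrow>
        map (count_marked m) (map fst zs) = swap_head p ds" for m
      using assms(2) that by (metis length_map map_swap_head swap_head_swap_head)
    then show ?thesis unfolding feasible_def by simp
  qed
  have "disjoint_classes (swap_head p zs)"
    by (rule sorted_wrt_swap_head) (use assms in \<open>auto simp: dp_inv_def\<close>)
  with assms f show ?thesis unfolding dp_inv_def by auto
qed

lemma open_darts_swap [simp]: "p < length zs \<Longrightarrow> open_darts (swap_head p zs) = open_darts zs"
  by (simp add: open_darts_def)

text \<open>When the two ends are twins, the path becomes a cycle that no further edge can join. It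
  is then an edge of the triangulation and needs exactly two marks: only the indices with lowest
  digit 2 are kept, and that digit is dropped.\<close>

lemma dp_inv_close:
  assumes inv: "dp_inv X ((P, a, b) # zs) Ks A" and tw: "twin a = b"
  shows "dp_inv X zs (insert P Ks) (\<lambda>x. A (3 * x + 2))"
    and "open_darts zs = open_darts ((P, a, b) # zs) - {a, b}"
proof -
  have P: "open_class X (P, a, b)" and X: "X \<subseteq> {..<n}" using inv by (auto simp: dp_inv_def)
  have "P \<in> tri_edges T"
  proof (rule edge_class_in_tri_edges)
    show "P \<subseteq> edges_in {..<n}" using P X by (auto simp: open_class_def edges_in_def)
    have "twin b = a" using tw P by (auto simp: open_class_def)
    then show "\<forall>d\<in>darts. dart_edge d \<in> P \<longrightarrow> dart_edge (twin d) \<in> P"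
      using P tw by (auto simp: open_class_def)
  qed (use P in \<open>auto simp: open_class_def\<close>)
  moreover have "A (3 * enc ds + 2) = (if feasible (insert P Ks) (map fst zs) ds then 1 else 0)"
    if "length ds = length zs" "set ds \<subseteq> {..<3}" for ds
  proof -
    have "A (enc (2 # ds)) = (if feasible Ks (P # map fst zs) (2 # ds) then 1 else 0)"
      using dp_inv_table[OF inv, of "2 # ds"] that by (simp del: enc.simps)
    moreover have "feasible Ks (P # map fst zs) (2 # ds) \<longleftrightarrow> feasible (insert P Ks) (map fst zs) ds"
      by (auto simp: feasible_def)
    ultimately show ?thesis by (simp add: add.commute)
  qed
  ultimately show "dp_inv X zs (insert P Ks) (\<lambda>x. A (3 * x + 2))"
    using inv unfolding dp_inv_def by auto
  have "a \<notin> open_darts zs" "b \<notin> open_darts zs"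
    using not_open_darts[of zs X P] inv P by (auto simp: dp_inv_def open_class_def)
  then show "open_darts zs = open_darts ((P, a, b) # zs) - {a, b}" by (auto simp: open_darts_def)
qed

text \<open>Gluing an end of one path to an end of another concatenates them and leaves the outer
  ends \<open>a'\<close> and \<open>c'\<close>. Equations between unordered pairs avoid four cases
  for the order of the ends. As the classes are disjoint, their counts add up.\<close>

lemma dp_inv_merge:
  assumes inv: "dp_inv X ((P, a, b) # (Q, c, d) # zs) Ks A"
    and ab: "{a, b} = {x, a'}" and cd: "{c, d} = {y, c'}" and tw: "twin y = x"
  shows "dp_inv X ((P \<union> Q, a', c') # zs) Ks (merge_table A)"
    and "open_darts ((P \<union> Q, a', c') # zs) = open_darts ((P, a, b) # (Q, c, d) # zs) - {x, y}"
proof -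
  have P: "open_class X (P, a, b)" and Q: "open_class X (Q, c, d)" and X: "X \<subseteq> {..<n}"
    and PQ: "P \<inter> Q = {}" using inv by (auto simp: dp_inv_def)
  have xy: "x \<in> darts" "y \<in> darts" "dart_edge x \<in> P" "dart_edge y \<in> Q" "dart_edge a' \<in> P"
      "dart_edge c' \<in> Q" "a' \<in> darts" "c' \<in> darts" "x \<noteq> a'" "y \<noteq> c'"
    using P Q ab cd by (auto simp: open_class_def doubleton_eq_iff)
  have tw': "twin x = y" using tw xy by auto
  have g: "(dart_edge y, dart_edge x) \<in> (edge_glue T)\<^sup>*" "(dart_edge x, dart_edge y) \<in> (edge_glue T)\<^sup>*"
    using edge_glueI[OF xy(1)] edge_glueI[OF xy(2)] tw tw' by auto
  have cP: "(u, v) \<in> (edge_glue T)\<^sup>*" if "u \<in> P" "v \<in> P" for u v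
    using that P by (auto simp: open_class_def)
  have cQ: "(u, v) \<in> (edge_glue T)\<^sup>*" if "u \<in> Q" "v \<in> Q" for u v
    using that Q by (auto simp: open_class_def)
  have "(u, v) \<in> (edge_glue T)\<^sup>*" if "u \<in> P \<union> Q" "v \<in> P \<union> Q" for u v
    using that cP[OF _ xy(3)] cP[OF xy(3)] cQ[OF _ xy(4)] cQ[OF xy(4)] cP cQ g
    by (elim UnE) (blast intro: rtrancl_trans)+
  moreover have "e = a' \<or> e = c' \<or> dart_edge (twin e) \<in> P \<union> Q"
    if e: "e \<in> darts" "dart_edge e \<in> P \<union> Q" for e
  proof (cases "dart_edge e \<in> P")
    case True
    then have "e \<in> {a, b} \<or> dart_edge (twin e) \<in> P" using P e by (auto simp: open_class_def)
    then show ?thesis using ab tw' xy by auto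
  next
    case False
    then have "e \<in> {c, d} \<or> dart_edge (twin e) \<in> Q" using Q e by (auto simp: open_class_def)
    then show ?thesis using cd tw xy by auto
  qed
  moreover have "a' \<noteq> c'" using xy PQ by auto
  ultimately have new: "open_class X (P \<union> Q, a', c')"
    using P Q xy by (auto simp: open_class_def)
  have fin: "finite P" "finite Q" using P Q X finite_edges_in[of X] finite_subset[of X "{..<n}"]
    by (auto simp: open_class_def intro: finite_subset)
  have "merge_table A (enc ds) = (if feasible Ks (map fst ((P \<union> Q, a', c') # zs)) ds then 1 else 0)"
    if ds: "length ds = length ((P \<union> Q, a', c') # zs)" "set ds \<subseteq> {..<3}" for ds
  proof -
    obtain s ds' where s: "ds = s # ds'" "s < 3" "length ds' = length zs" "set ds' \<subseteq> {..<3}"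
      using ds by (cases ds) auto
    have A: "A (enc ((s - i) # i # ds')) =
        (if feasible Ks (P # Q # map fst zs) ((s - i) # i # ds') then 1 else 0)" if "i \<le> s" for i
    proof -
      have "length ((s - i) # i # ds') = length ((P, a, b) # (Q, c, d) # zs)"
        "set ((s - i) # i # ds') \<subseteq> {..<3}" using s that by auto
      then show ?thesis using dp_inv_table[OF inv] by (simp del: enc.simps)
    qed
    have 1: "feasible Ks ((P \<union> Q) # map fst zs) ds \<longleftrightarrow>
        (\<exists>i\<le>s. feasible Ks (P # Q # map fst zs) ((s - i) # i # ds'))" (is "?l \<longleftrightarrow> ?r")
    proof
      assume ?l
      then obtain m where m: "marking m" "\<forall>K\<in>Ks. count_marked m K = 2"
          "count_marked m P + count_marked m Q = s" "map (count_marked m) (map fst zs) = ds'"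
        unfolding feasible_def s(1) by (auto simp: count_marked_Un[OF PQ fin])
      \<comment> \<open>The second digit of the split is what the marking puts on
        \<open>Q\<close>.\<close>
      then show ?r unfolding feasible_def
        by (intro exI[of _ "count_marked m Q"] conjI exI[of _ m]) auto
    next
      assume ?r
      then show ?l unfolding feasible_def s(1) by (auto simp: count_marked_Un[OF PQ fin])
    qed
    have 2: "(\<Sum>i\<le>s. A (enc ((s - i) # i # ds'))) = 0 \<longleftrightarrow>
        \<not> (\<exists>i\<le>s. feasible Ks (P # Q # map fst zs) ((s - i) # i # ds'))"
      by (auto simp: A simp del: enc.simps)
    have 3: "min (1::nat) S = (if F then 1 else 0)" if "F \<longleftrightarrow> G" "S = 0 \<longleftrightarrow> \<not> G" for S F G
      using that by auto
    show ?thesis using 3[OF 1 2] merge_table_enc[OF s(2), of A ds'] unfolding s(1) list.map fst_conv by (rule trans[rotated])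
  qed
  with inv new show "dp_inv X ((P \<union> Q, a', c') # zs) Ks (merge_table A)"
    unfolding dp_inv_def by auto
  have "x \<notin> open_darts zs" "y \<notin> open_darts zs"
    using not_open_darts[of zs X P x] not_open_darts[of zs X Q y] inv xy(3,4)
    by (auto simp: dp_inv_def)
  moreover have "x \<noteq> c'" "y \<noteq> a'" using xy(3-6) PQ by auto
  ultimately have U: "{a', c'} \<union> open_darts zs = {x, a'} \<union> {y, c'} \<union> open_darts zs - {x, y}"
    using xy(9,10) by auto
  have "open_darts ((P, a, b) # (Q, c, d) # zs) = {a, b} \<union> {c, d} \<union> open_darts zs"
    by (auto simp: open_darts_def)
  then have O: "open_darts ((P, a, b) # (Q, c, d) # zs) = {x, a'} \<union> {y, c'} \<union> open_darts zs"
    by (simp only: ab cd)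
  have "open_darts ((P \<union> Q, a', c') # zs) = {a', c'} \<union> open_darts zs"
    by (auto simp: open_darts_def)
  then show
    "open_darts ((P \<union> Q, a', c') # zs) = open_darts ((P, a, b) # (Q, c, d) # zs) - {x, y}"
    by (simp only: U O)
qed

end

section \<open>Attaching a tetrahedron\<close>

definition tet_pairs :: "(nat \<times> nat) list" where
  "tet_pairs = [(0,1), (2,3), (0,2), (1,3), (0,3), (1,2)]"

text \<open>Before any gluing each edge is a path by itself, whose ends are its darts in the two
  faces that contain it.\<close>

definition tet_classes :: "nat \<Rightarrow> ((nat \<times> nat set) set \<times> dart \<times> dart) list" where
  "tet_classes t = map (\<lambda>(f, g). ({dart_edge (t, f, g)}, (t, f, g), (t, g, f))) tet_pairs"

text \<open>
  The low six digits stand for the edges of a new tetrahedron in the order of \<open>tet_pairs\<close>;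
  marking a pair of opposite edges gives one of \<open>3^0 + 3^1\<close>, \<open>3^2 + 3^3\<close>, \<open>3^4 + 3^5\<close>.
\<close>

definition add_table :: "(nat \<Rightarrow> nat) \<Rightarrow> nat \<Rightarrow> nat" where
  "add_table A y = (if y mod 729 \<in> {4, 36, 324} then A (y div 729) else 0)"

lemma add_table_enc:
  assumes "length xs = 6" "set xs \<subseteq> {..<3}"
  shows "add_table A (enc (xs @ ds)) =
    (if xs \<in> {[1,1,0,0,0,0], [0,0,1,1,0,0], [0,0,0,0,1,1]} then A (enc ds) else 0)"
proof -
  have "enc xs < 729" using enc_less[OF assms(2)] assms(1) by simp
  then have "enc (xs @ ds) mod 729 = enc xs" "enc (xs @ ds) div 729 = enc ds"
    using assms(1) by (auto simp: enc_append)
  moreover have "enc xs = 4 \<longleftrightarrow> xs = [1,1,0,0,0,0]" "enc xs = 36 \<longleftrightarrow> xs = [0,0,1,1,0,0]"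
      "enc xs = 324 \<longleftrightarrow> xs = [0,0,0,0,1,1]"
    using enc_inj[of xs "[1,1,0,0,0,0]"] enc_inj[of xs "[0,0,1,1,0,0]"]
      enc_inj[of xs "[0,0,0,0,1,1]"] assms by auto
  ultimately show ?thesis unfolding add_table_def by auto
qed

lemma count_marked_singleton: "count_marked m {(t, e)} = (if e \<in> m t then 1 else 0)"
proof -
  have "{(t', e') \<in> {(t, e)}. e' \<in> m t'} = (if e \<in> m t then {(t, e)} else {})" by auto
  then show ?thesis unfolding count_marked_def by simp
qed

lemma map_fst_tet_classes:
  "map fst (tet_classes t) =
    [{(t,{2,3})}, {(t,{0,1})}, {(t,{1,3})}, {(t,{0,2})}, {(t,{1,2})}, {(t,{0,3})}]"
  by (simp add: tet_classes_def tet_pairs_def complements_4)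

lemma count_tet_classes:
  shows "m t = {{0,1},{2,3}} \<Longrightarrow> map (count_marked m) (map fst (tet_classes t)) = [1,1,0,0,0,0]"
    and "m t = {{0,2},{1,3}} \<Longrightarrow> map (count_marked m) (map fst (tet_classes t)) = [0,0,1,1,0,0]"
    and "m t = {{0,3},{1,2}} \<Longrightarrow> map (count_marked m) (map fst (tet_classes t)) = [0,0,0,0,1,1]"
  by (simp_all add: map_fst_tet_classes count_marked_singleton doubleton_eq_iff)

lemma edges_in_insert: "edges_in (insert t X) = edges_in {t} \<union> edges_in X"
  by (auto simp: edges_in_def)

lemma edges_in_singleton: "edges_in {t} = \<Union>(fst ` set (tet_classes t))"
proof -
  let ?E = "{{0,1}, {0,2}, {0,3}, {1,2}, {1,3}, {2,3::nat}}"
  have "{e. e \<subseteq> {..<4} \<and> card e = 2} \<subseteq> ?E" using two_subset_4 by blast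
  moreover have "?E \<subseteq> {e. e \<subseteq> {..<4} \<and> card e = 2}" by simp
  ultimately have "{e. e \<subseteq> {..<4} \<and> card e = 2} = ?E" by (rule subset_antisym)
  moreover have "edges_in {t} = Pair t ` {e. e \<subseteq> {..<4} \<and> card e = 2}"
    by (auto simp: edges_in_def)
  ultimately have "edges_in {t} = Pair t ` ?E" by simp
  also have "\<dots> = \<Union>(set (map fst (tet_classes t)))" unfolding map_fst_tet_classes by auto
  finally show ?thesis by simp
qed

lemma count_marked_cong:
  assumes "P \<subseteq> edges_in X" "\<And>t. t \<in> X \<Longrightarrow> m t = m' t"
  shows "count_marked m P = count_marked m' P"
proof -
  have "{(t, e) \<in> P. e \<in> m t} = {(t, e) \<in> P. e \<in> m' t}"
    using assms by (auto simp: edges_in_def)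
  then show ?thesis by (simp add: count_marked_def)
qed

text \<open>An edge determines the two vertices off it, hence it belongs to just two darts, one for
  each order of these vertices.\<close>

lemma dart_edge_eq_iff:
  assumes "f < 4" "g < 4" "f \<noteq> g" "d \<in> darts_in X" "dart_edge d = dart_edge (t, f, g)"
  shows "d = (t, f, g) \<or> d = (t, g, f)"
proof -
  obtain f' g' where d: "d = (t, f', g')" "f' < 4" "g' < 4" "f' \<noteq> g'"
    using assms(4,5) by (auto simp: darts_in_def)
  have "{..<4} - {f', g'} = {..<4} - {f, g}" using assms(5) d by simp
  then have "{f', g'} = {f, g}" using assms d by blast
  then show ?thesis using d by (auto simp: doubleton_eq_iff)
qed

context closed_triangulation
begin

text \<open>A marking can be overridden at \<open>t\<close> without changing the counts on edges of
  \<open>X\<close>, so the choice in the new tetrahedron is independent of the rest. Its three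
  possibilities give the three digit patterns.\<close>

lemma feasible_add:
  assumes "t < n" "t \<notin> X" "\<forall>P\<in>set Ps. P \<subseteq> edges_in X" "\<forall>K\<in>Ks. K \<subseteq> edges_in X" "length xs = 6"
  shows "feasible Ks (map fst (tet_classes t) @ Ps) (xs @ ds) \<longleftrightarrow>
    xs \<in> {[1,1,0,0,0,0], [0,0,1,1,0,0], [0,0,0,0,1,1]} \<and> feasible Ks Ps ds"
proof -
  have len: "length (map (count_marked m) (map fst (tet_classes t))) = length xs" for m
    using assms(5) by (simp add: tet_classes_def tet_pairs_def)
  have split: "map (count_marked m) (map fst (tet_classes t) @ Ps) = xs @ ds \<longleftrightarrow>
      map (count_marked m) (map fst (tet_classes t)) = xs \<and> map (count_marked m) Ps = ds" for m
    using len[of m] unfolding map_append by (simp del: length_map)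
  show ?thesis
  proof
    assume "feasible Ks (map fst (tet_classes t) @ Ps) (xs @ ds)"
    then obtain m where m: "marking m" "\<forall>K\<in>Ks. count_marked m K = 2"
        "map (count_marked m) (map fst (tet_classes t)) = xs" "map (count_marked m) Ps = ds"
      unfolding feasible_def split by (elim exE conjE)
    have "m t \<in> {{{0,1},{2,3}}, {{0,2},{1,3}}, {{0,3},{1,2}}}"
      using m(1) assms(1) unfolding marking_def opposite_edge_pairs_eq by (simp only:)
    then consider "m t = {{0,1},{2,3}}" | "m t = {{0,2},{1,3}}" | "m t = {{0,3},{1,2}}" by (elim insertE emptyE)
    then have "xs \<in> {[1,1,0,0,0,0], [0,0,1,1,0,0], [0,0,0,0,1,1]}"
      by cases (use m(3) count_tet_classes[of m t] in \<open>simp_all only: insert_iff simp_thms\<close>)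
    moreover have "feasible Ks Ps ds" using m unfolding feasible_def by (intro exI[of _ m] conjI) simp_all
    ultimately show "xs \<in> {[1,1,0,0,0,0], [0,0,1,1,0,0], [0,0,0,0,1,1]} \<and> feasible Ks Ps ds" ..
  next
    assume a: "xs \<in> {[1,1,0,0,0,0], [0,0,1,1,0,0], [0,0,0,0,1,1]} \<and> feasible Ks Ps ds"
    then obtain m where m: "marking m" "\<forall>K\<in>Ks. count_marked m K = 2" "map (count_marked m) Ps = ds"
      unfolding feasible_def by blast
    consider "xs = [1,1,0,0,0,0]" | "xs = [0,0,1,1,0,0]" | "xs = [0,0,0,0,1,1]" using a by blast
    then obtain q where q: "q \<in> opposite_edge_pairs"
        "map (count_marked (m(t := q))) (map fst (tet_classes t)) = xs"
    proof cases
      case 1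
      show ?thesis
        by (rule that[of "{{0,1},{2,3}}"], simp add: opposite_edge_pairs_eq, unfold 1,
            rule count_tet_classes, simp)
    next
      case 2
      show ?thesis
        by (rule that[of "{{0,2},{1,3}}"], simp add: opposite_edge_pairs_eq, unfold 2,
            rule count_tet_classes, simp)
    next
      case 3
      show ?thesis
        by (rule that[of "{{0,3},{1,2}}"], simp add: opposite_edge_pairs_eq, unfold 3,
            rule count_tet_classes, simp)
    qed
    have "count_marked (m(t := q)) P = count_marked m P" if "P \<subseteq> edges_in X" for P
      using that assms(2) by (intro count_marked_cong[of P X]) auto
    then have "\<forall>K\<in>Ks. count_marked (m(t := q)) K = 2" "map (count_marked (m(t := q))) Ps = ds"
      using m assms(3,4) by (auto simp: map_eq_conv)
    moreover have "marking (m(t := q))" using m(1) q(1) by (simp add: marking_def)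
    ultimately show "feasible Ks (map fst (tet_classes t) @ Ps) (xs @ ds)"
      unfolding feasible_def split using q(2) by (intro exI[of _ "m(t := q)"] conjI)
  qed
qed

lemma open_class_tet:
  assumes "t < n" "z \<in> set (tet_classes t)" shows "open_class (insert t X) z"
proof -
  have pairs: "f < 4 \<and> g < 4 \<and> f \<noteq> g" if "(f, g) \<in> set tet_pairs" for f g
    using that by (auto simp: tet_pairs_def)
  obtain f g where z: "z = ({dart_edge (t, f, g)}, (t, f, g), (t, g, f))" "f < 4" "g < 4" "f \<noteq> g"
    using assms(2) pairs by (auto simp: tet_classes_def)
  define e where "e = dart_edge (t, f, g)"
  have "dart_edge (t, g, f) = e" by (simp add: e_def insert_commute)
  moreover have "e \<in> edges_in (insert t X)"
    unfolding e_def using z(2-4) by (intro dart_edge_in) (simp add: darts_in_def)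
  moreover have "(t, f, g) \<in> darts" "(t, g, f) \<in> darts" using z(2-4) assms(1) by (auto simp: darts_in_def)
  moreover have "d = (t, f, g) \<or> d = (t, g, f)" if "d \<in> darts" "dart_edge d = e" for d
    using dart_edge_eq_iff[OF z(2-4) that[unfolded e_def]] .
  ultimately show ?thesis unfolding open_class_def z(1) e_def[symmetric] case_prod_conv
    using z(4) by (auto simp: e_def[symmetric] simp del: dart_edge.simps)
qed

lemma open_class_mono: "open_class X z \<Longrightarrow> X \<subseteq> Y \<Longrightarrow> open_class Y z"
  by (auto simp: open_class_def edges_in_def)

lemma open_darts_tet_classes: "open_darts (tet_classes t @ zs) = darts_in {t} \<union> open_darts zs"
proof -
  have "open_darts (tet_classes t) = darts_in {t}"
    unfolding open_darts_def tet_classes_def tet_pairs_def darts_in_def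
    by (auto simp: numeral_eq_Suc less_Suc_eq)
  then show ?thesis by (auto simp: open_darts_def)
qed

lemma dp_inv_add:
  assumes inv: "dp_inv X zs Ks A" and t: "t < n" "t \<notin> X"
  shows "dp_inv (insert t X) (tet_classes t @ zs) Ks (add_table A)"
proof -
  have sub: "P \<subseteq> edges_in X" if "P \<in> set (map fst zs) \<union> Ks" for P
    using inv that unfolding dp_inv_def by auto
  have disj: "edges_in {t} \<inter> edges_in X = {}" using t by (auto simp: edges_in_def)
  have "disjoint_classes (tet_classes t)"
    by (simp add: tet_classes_def tet_pairs_def complements_4 doubleton_eq_iff)
  moreover have "fst z \<inter> fst z' = {}" if z: "z \<in> set (tet_classes t)" "z' \<in> set zs" for z z'
  proof -
    have "fst z \<subseteq> edges_in {t}" using z(1) unfolding edges_in_singleton by blast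
    moreover have "fst z' \<subseteq> edges_in X" using z(2) by (intro sub) simp
    ultimately show ?thesis using disj by blast
  qed
  moreover have "disjoint_classes zs" using inv by (simp add: dp_inv_def)
  ultimately have D: "disjoint_classes (tet_classes t @ zs)" by (simp add: sorted_wrt_append)
  have E: "add_table A (enc ds) =
      (if feasible Ks (map fst (tet_classes t @ zs)) ds then 1 else 0)"
    if ds: "length ds = length (tet_classes t @ zs)" "set ds \<subseteq> {..<3}" for ds
  proof -
    have l6: "length (tet_classes t) = 6" by (simp add: tet_classes_def tet_pairs_def)
    define xs ds' where xs: "xs = take 6 ds" "ds' = drop 6 ds"
    then have ds_eq: "ds = xs @ ds'" by simp
    have len: "length xs = 6" "length ds' = length zs" using ds(1) l6 xs by auto
    have sets: "set xs \<subseteq> {..<3}" "set ds' \<subseteq> {..<3}" using ds(2) ds_eq by auto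
    show ?thesis
      unfolding ds_eq add_table_enc[OF len(1) sets(1)] dp_inv_table[OF inv len(2) sets(2)] map_append
      using feasible_add[of t X "map fst zs" Ks xs ds'] t sub len(1) by auto
  qed
  have C: "open_class (insert t X) z" if "z \<in> set (tet_classes t @ zs)" for z
  proof (cases "z \<in> set zs")
    case True
    with inv have "open_class X z" by (simp only: dp_inv_def)
    then show ?thesis by (rule open_class_mono) (rule subset_insertI)
  next
    case False
    then show ?thesis using that by (intro open_class_tet[OF t(1)]) simp
  qed
  have "\<Union>(fst ` set zs) \<union> \<Union>Ks = edges_in X" using inv by (simp add: dp_inv_def)
  then have U: "\<Union>(fst ` set (tet_classes t @ zs)) \<union> \<Union>Ks = edges_in (insert t X)"
    unfolding edges_in_insert[of t X] edges_in_singleton set_append image_Un by (simp add: Un_assoc)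
  show ?thesis
    unfolding dp_inv_def
  proof (intro conjI ballI allI impI C D U E)
    show "insert t X \<subseteq> {..<n}" "Ks \<subseteq> tri_edges T" using inv t(1) by (auto simp only: dp_inv_def insert_subset lessThan_iff)
  qed
qed

section \<open>Gluing the faces of a tetrahedron, and the frontier\<close>

text \<open>The guard skips twins in tetrahedra not yet treated, and gluings already carried out
  from the other side, which occur when two faces of the same tetrahedron are glued.\<close>

definition glue_dart :: "dart \<Rightarrow> dart set \<Rightarrow> dart set" where
  "glue_dart d D = (if d \<in> D \<and> twin d \<in> D then D - {d, twin d} else D)"

definition tet_darts :: "nat \<Rightarrow> dart list" where
  "tet_darts t = map (\<lambda>(f, g). (t, f, g)) (tet_pairs @ map prod.swap tet_pairs)"

lemma set_tet_darts: "set (tet_darts t) = darts_in {t}"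
  unfolding tet_darts_def tet_pairs_def darts_in_def
  by (auto simp: numeral_eq_Suc less_Suc_eq)

text \<open>Darts disappear only together with their twins, so the removal of one pair never affects
  another, and the order of the gluings is irrelevant.\<close>

lemma mem_fold_glue_dart:
  assumes "D \<subseteq> darts"
  shows "x \<in> fold glue_dart ds D \<longleftrightarrow>
    x \<in> D \<and> \<not> ((x \<in> set ds \<or> twin x \<in> set ds) \<and> twin x \<in> D)"
  using assms
proof (induction ds arbitrary: D)
  case (Cons d ds)
  show ?case
  proof (cases "x \<in> darts")
    case x: True
    show ?thesis
    proof (cases "d \<in> D \<and> twin d \<in> D")
      case False
      then have "x \<in> D \<and> twin x \<in> D \<Longrightarrow> x \<noteq> d \<and> twin x \<noteq> d" using x twin_twin by metis
      then show ?thesis using False Cons.IH[OF Cons.prems] by (auto simp: glue_dart_def)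
    next
      case True
      then have d: "d \<in> darts" using Cons.prems by blast
      have eq: "twin x = twin d \<longleftrightarrow> x = d" "twin x = d \<longleftrightarrow> x = twin d"
        using twin_twin x d by metis+
      have "fold glue_dart (d # ds) D = fold glue_dart ds (D - {d, twin d})"
        using True by (simp add: glue_dart_def)
      moreover have "D - {d, twin d} \<subseteq> darts" using Cons.prems by blast
      ultimately have "x \<in> fold glue_dart (d # ds) D \<longleftrightarrow> x \<in> D - {d, twin d} \<and>
          \<not> ((x \<in> set ds \<or> twin x \<in> set ds) \<and> twin x \<in> D - {d, twin d})"
        using Cons.IH by simp
      then show ?thesis using True eq by auto
    qed
  next
    case False
    have "glue_dart d D \<subseteq> D" by (auto simp: glue_dart_def)
    then show ?thesis using False Cons by auto
  qed
qed simp

definition frontier :: "nat set \<Rightarrow> dart set" where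
  "frontier X = {d \<in> darts. fst d \<in> X \<and> fst (twin d) \<notin> X}"

text \<open>The twins of the old frontier lie outside \<open>X\<close>. Hence if a dart and its twin
  are both present, one of them belongs to \<open>t\<close>, and gluing all darts of
  \<open>t\<close> finds every such pair.\<close>

lemma frontier_insert:
  assumes "X \<subseteq> {..<n}" "t < n" "t \<notin> X"
  shows "fold glue_dart (tet_darts t) (darts_in {t} \<union> frontier X) = frontier (insert t X)"
proof -
  let ?D = "darts_in {t} \<union> frontier X"
  have D: "?D \<subseteq> darts" using assms by (auto simp: darts_in_def frontier_def)
  have t: "d \<in> darts_in {t} \<longleftrightarrow> d \<in> darts \<and> fst d = t" for d
    using assms by (auto simp: darts_in_def)
  have tw: "fst (twin (twin d)) = fst d" if "d \<in> darts" for d using that by simp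
  show ?thesis
  proof (rule set_eqI)
    fix x
    show "x \<in> fold glue_dart (tet_darts t) ?D \<longleftrightarrow> x \<in> frontier (insert t X)"
    proof (cases "x \<in> darts")
      case True
      then have "twin x \<in> darts" by simp
      then show ?thesis unfolding mem_fold_glue_dart[OF D] set_tet_darts
        using True assms(3) tw[OF True] by (auto simp: frontier_def t)
    next
      case False
      then show ?thesis unfolding mem_fold_glue_dart[OF D] using D by (auto simp: frontier_def)
    qed
  qed
qed

text \<open>A face glued across the cut carries three darts. Its arc determines the face, because
  only one of the two glued faces lies on the side of \<open>X\<close>.\<close>

lemma card_frontier_le:
  assumes "distinct vs" "set vs = {..<n}"
  shows "card (frontier (set (take i vs))) \<le>
    3 * cut_width (face_pairing_graph T) (set (take i vs)) (set (drop i vs))"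
proof -
  define X where "X = set (take i vs)"
  define Y where "Y = set (drop i vs)"
  have XY: "X \<union> Y = {..<n}" "X \<inter> Y = {}"
    using assms unfolding X_def Y_def
    by (metis append_take_drop_id set_append, metis append_take_drop_id assms(1) distinct_append)
  define nb where "nb = (\<lambda>(t, f). case the (glue T t f) of (u, p) \<Rightarrow> (u, p f))"
  define F where "F = {(t, f). t \<in> X \<and> f < 4 \<and> fst (nb (t, f)) \<notin> X}"
  have F: "finite F" by (rule finite_subset[of _ "{..<n} \<times> {..<4}"]) (use XY in \<open>auto simp: F_def\<close>)
  have "frontier X \<subseteq> (\<Union>(t, f)\<in>F. (\<lambda>g. (t, f, g)) ` ({..<4} - {f}))"
  proof
    fix d assume d: "d \<in> frontier X"
    obtain t f g where tfg: "d = (t, f, g)" by (cases d)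
    obtain u p where up: "the (glue T t f) = (u, p)" by (cases "the (glue T t f)")
    have "(t, f) \<in> F" "g \<in> {..<4} - {f}"
      using d tfg up by (auto simp: frontier_def F_def nb_def darts_in_def twin_def)
    then show "d \<in> (\<Union>(t, f)\<in>F. (\<lambda>g. (t, f, g)) ` ({..<4} - {f}))" unfolding tfg by blast
  qed
  then have "card (frontier X) \<le> card (\<Union>(t, f)\<in>F. (\<lambda>g. (t, f, g)) ` ({..<4} - {f}))"
    using F by (intro card_mono) auto
  also have "\<dots> \<le> (\<Sum>tf\<in>F. card ((case tf of (t, f) \<Rightarrow> (\<lambda>g. (t, f, g)) ` ({..<4} - {f}))))"
    using F by (intro card_UN_le)
  also have "\<dots> \<le> (\<Sum>tf\<in>F. 3)"
    by (intro sum_mono) (auto simp: F_def intro!: order_trans[OF card_image_le])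
  also have "\<dots> = 3 * card F" by simp
  finally have 1: "card (frontier X) \<le> 3 * card F" .
  let ?A = "{a \<in> arcs (face_pairing_graph T). \<exists>x\<in>X. \<exists>y\<in>Y. ends (face_pairing_graph T) a = {x, y}}"
  have nb: "nb (t, f) \<in> {..<n} \<times> {..<4} \<and> {(t, f), nb (t, f)} \<in> arcs (face_pairing_graph T)"
    if "t < n" "f < 4" for t f
    using glueE[OF that] that by (fastforce simp: nb_def face_pairing_graph_def)
  have "finite ?A"
  proof (rule finite_subset)
    show "?A \<subseteq> Pow ({..<n} \<times> {..<4})"
    proof
      fix a assume "a \<in> ?A"
      then obtain t f u p where "a = {(t, f), (u, p f)}" "t < n" "f < 4" "glue T t f = Some (u, p)"
        by (auto simp: face_pairing_graph_def)
      then show "a \<in> Pow ({..<n} \<times> {..<4})" using nb[of t f] by (simp add: nb_def)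
    qed
  qed simp
  moreover have "inj_on (\<lambda>x. {x, nb x}) F"
  proof (rule inj_onI)
    fix x y assume "x \<in> F" "y \<in> F" "{x, nb x} = {y, nb y}"
    then show "x = y" by (auto simp: F_def doubleton_eq_iff)
  qed
  moreover have "(\<lambda>x. {x, nb x}) ` F \<subseteq> ?A"
  proof (clarsimp simp: F_def)
    fix t f assume a: "t \<in> X" "f < 4" "fst (nb (t, f)) \<notin> X"
    then have "t < n" using XY by auto
    from nb[OF this a(2)] have b: "nb (t, f) \<in> {..<n} \<times> {..<4}"
      "{(t, f), nb (t, f)} \<in> arcs (face_pairing_graph T)" by auto
    then have "fst (nb (t, f)) \<in> Y" using a XY by (metis Un_iff mem_Times_iff)
    moreover have "ends (face_pairing_graph T) {(t, f), nb (t, f)} = {t, fst (nb (t, f))}"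
      by (simp add: face_pairing_graph_def)
    ultimately show "{(t, f), nb (t, f)} \<in> arcs (face_pairing_graph T) \<and>
        (\<exists>x\<in>X. \<exists>y\<in>Y. ends (face_pairing_graph T) {(t, f), nb (t, f)} = {x, y})"
      using a b by blast
  qed
  ultimately have "card F \<le> card ?A" by (rule card_inj_on_le[rotated 2])
  then show ?thesis using 1 unfolding cut_width_def X_def Y_def by linarith
qed

end

section \<open>Machine states\<close>

text \<open>
  The stack of open classes and the table are kept behind the input; the head of the list \<open>cs\<close> is the
  top of the stack and belongs to digit 0 of the table indices.  At most \<open>12 n\<close> darts are
  on the stack, so that \<open>16 n\<close> cells suffice.  Registers:
  1: number of tetrahedra; 2, 3: base addresses of stack and table; 4: address of the
  next node of the layout; 5: current tetrahedron; 6, 7: sizes of stack and table; 9: constant 0;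
  12, 13: codes of the two darts to be glued.
\<close>

definition stack_base :: "nat \<Rightarrow> nat" where "stack_base n = 1 + 21 * n"
definition table_base :: "nat \<Rightarrow> nat" where "table_base n = 1 + 37 * n"

fun stack :: "(nat \<Rightarrow> nat) \<Rightarrow> nat \<Rightarrow> (nat \<times> nat) list \<Rightarrow> bool" where
  "stack M b [] \<longleftrightarrow> True"
| "stack M b (c # cs) \<longleftrightarrow>
     M (b + 2 * length cs) = fst c \<and> M (b + 2 * length cs + 1) = snd c \<and> stack M b cs"

lemma stack_cong:
  "(\<And>a. b \<le> a \<Longrightarrow> a < b + 2 * length cs \<Longrightarrow> M a = M' a) \<Longrightarrow> stack M b cs = stack M' b cs"
  by (induction cs) auto

lemma stack_iff_nth:
  "stack M b cs \<longleftrightarrow> (\<forall>p < length cs. M (b + 2 * (length cs - 1 - p)) = fst (cs ! p) \<and>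
     M (b + 2 * (length cs - 1 - p) + 1) = snd (cs ! p))"
  by (induction cs) (auto simp: All_less_Suc2)

definition globals ::
    "nat \<Rightarrow> (nat \<Rightarrow> nat) \<Rightarrow> nat \<Rightarrow> nat \<Rightarrow> nat \<Rightarrow> nat \<Rightarrow> (nat \<times> nat) list \<Rightarrow> store \<Rightarrow> bool" where
  "globals n I vp t d d' cs s \<longleftrightarrow> (case s of (R, M) \<Rightarrow>
     R 1 = n \<and> R 2 = stack_base n \<and> R 3 = table_base n \<and> R 4 = vp \<and> R 5 = t \<and>
     R 6 = 2 * length cs \<and> R 9 = 0 \<and> R 12 = d \<and> R 13 = d' \<and>
     (\<forall>a < stack_base n. M a = I a) \<and> stack M (stack_base n) cs)"

definition table :: "nat \<Rightarrow> nat \<Rightarrow> (nat \<Rightarrow> nat) \<Rightarrow> store \<Rightarrow> bool" where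
  "table n Z A s \<longleftrightarrow> (case s of (R, M) \<Rightarrow> R 7 = Z \<and> (\<forall>x < Z. M (table_base n + x) = A x))"

abbreviation ram_state where
  "ram_state n I vp t d d' cs Z A s \<equiv> globals n I vp t d d' cs s \<and> table n Z A s"

text \<open>The first condition leaves room for the constants of the program, for the addresses of
  input and stack, and for table addresses together with a few intermediate sums.\<close>

definition bounds :: "nat \<Rightarrow> nat \<Rightarrow> nat \<Rightarrow> nat \<Rightarrow> nat \<Rightarrow> nat \<Rightarrow> (nat \<times> nat) list \<Rightarrow> nat \<Rightarrow> (nat \<Rightarrow> nat) \<Rightarrow> bool" where
  "bounds N n vp t d d' cs Z A \<longleftrightarrow>
     2000 + 200 * n + 10 * Z \<le> N \<and> vp \<le> stack_base n \<and> t < n \<and> d < 16 * n \<and> d' < 16 * n \<and>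
     2 * length cs \<le> 16 * n \<and> (\<forall>c\<in>set cs. fst c < 16 * n \<and> snd c < 16 * n) \<and> (\<forall>x < Z. A x \<le> 1)"

lemma globals_reg [simp]:
  assumes "r \<notin> {1, 2, 3, 4, 5, 6, 9, 12, 13}"
  shows "globals n I vp t d d' cs (R(r := x), M) \<longleftrightarrow> globals n I vp t d d' cs (R, M)"
  using assms by (auto simp: globals_def)

lemma globals_mem:
  assumes "table_base n \<le> a" "2 * length cs \<le> 16 * n"
  shows "globals n I vp t d d' cs (R, M(a := x)) \<longleftrightarrow> globals n I vp t d d' cs (R, M)"
proof -
  have "stack (M(a := x)) (stack_base n) cs = stack M (stack_base n) cs"
    using assms by (intro stack_cong) (auto simp: stack_base_def table_base_def)
  moreover have "(M(a := x)) b = M b" if "b < stack_base n" for b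
    using that assms by (auto simp: stack_base_def table_base_def)
  ultimately show ?thesis by (simp add: globals_def)
qed

lemma table_reg [simp]: "r \<noteq> 7 \<Longrightarrow> table n Z A (R(r := x), M) \<longleftrightarrow> table n Z A (R, M)"
  by (simp add: table_def)

lemma table_mem: "a < table_base n \<Longrightarrow> table n Z A (R, M(a := x)) \<longleftrightarrow> table n Z A (R, M)"
  by (auto simp: table_def)

lemma globalsD:
  assumes "globals n I vp t d d' cs (R, M)"
  shows "R (Suc 0) = n" "R 2 = stack_base n" "R 3 = table_base n" "R 4 = vp" "R 5 = t"
    "R 6 = 2 * length cs" "R 9 = 0" "R 12 = d" "R 13 = d'"
  using assms by (auto simp: globals_def)

section \<open>Loops with a counter\<close>

lemma hoare_up:
  assumes "\<And>y. y < K \<Longrightarrow> hoare N j (Inv y) c (Inv (Suc y))"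
    "\<And>y s. y \<le> K \<Longrightarrow> Inv y s \<Longrightarrow> (fst s a < fst s b \<longleftrightarrow> y < K) \<and> fst s a \<le> N \<and> fst s b \<le> N"
    "K * (j + 2) + 2 \<le> k"
  shows "hoare N k (Inv 0) (While_Less a b c) (Inv K)"
proof -
  let ?I = "\<lambda>v s. v \<le> K \<and> Inv (K - v) s"
  have "hoare N k (?I K) (While_Less a b c) (?I 0)"
  proof (rule hoare_While[where j = j])
    fix v s assume "?I v s"
    then show "(fst s a < fst s b \<longleftrightarrow> 0 < v) \<and> fst s a \<le> N \<and> fst s b \<le> N"
      using assms(2)[of "K - v" s] by auto
  next
    fix v :: nat assume v: "0 < v"
    show "hoare N j (?I v) c (\<lambda>s. \<exists>v'<v. ?I v' s)"
    proof (rule hoare_pre)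
      assume "v \<le> K"
      then have "Suc (K - v) = K - (v - 1)" using v by simp
      then show "hoare N j (Inv (K - v)) c (\<lambda>s. \<exists>v'<v. ?I v' s)"
        using v \<open>v \<le> K\<close> assms(1)[of "K - v"]
        by (intro hoare_conseq[OF assms(1)[of "K - v"]]) (auto intro!: exI[of _ "v - 1"])
    qed
  qed (rule assms(3))
  then show ?thesis by (rule hoare_conseq) auto
qed

lemma hoare_down:
  assumes "\<And>y. y < K \<Longrightarrow> hoare N j (Inv (Suc y)) c (Inv y)"
    "\<And>y s. y \<le> K \<Longrightarrow> Inv y s \<Longrightarrow> fst s a = 0 \<and> fst s b = y" "K \<le> N" "K * (j + 2) + 2 \<le> k"
  shows "hoare N k (Inv K) (While_Less a b c) (Inv 0)"
proof -
  let ?I = "\<lambda>v s. v \<le> K \<and> Inv v s"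
  have "hoare N k (?I K) (While_Less a b c) (?I 0)"
  proof (rule hoare_While[where j = j])
    fix v s assume "?I v s"
    then show "(fst s a < fst s b \<longleftrightarrow> 0 < v) \<and> fst s a \<le> N \<and> fst s b \<le> N"
      using assms(2)[of v s] assms(3) by auto
  next
    fix v :: nat assume v: "0 < v"
    then obtain y where y: "v = Suc y" by (cases v) auto
    show "hoare N j (?I v) c (\<lambda>s. \<exists>v'<v. ?I v' s)"
    proof (rule hoare_pre)
      assume "v \<le> K"
      then show "hoare N j (Inv v) c (\<lambda>s. \<exists>v'<v. ?I v' s)"
        unfolding y by (intro hoare_conseq[OF assms(1)[of y]]) auto
    qed
  qed (rule assms(4))
  then show ?thesis by (rule hoare_conseq) auto
qed

section \<open>Program\<close>

definition third_init :: "instr list" where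
  "third_init = [Const 15 3, Arith Div 7 7 15, Const 14 0]"

definition close_body :: "instr list" where
  "close_body =
     [Arith Add 16 14 14, Arith Add 16 16 14, Const 15 2, Arith Add 16 16 15, Arith Add 16 16 3,
      Load 17 16, Arith Add 18 3 14, Store 18 17, Const 15 1, Arith Add 14 14 15]"

definition pop :: "instr list" where
  "pop = [Const 15 2, Arith Sub 6 6 15]"

definition close_com :: com where
  "close_com = Basic third_init ;; While_Less 14 7 (Basic close_body) ;; Basic pop"

text \<open>A rising index works in place: entry \<open>y\<close> is read from index
  \<open>3 * y + 2\<close>, which lies above all entries overwritten so far.\<close>

lemma hoare_close:
  assumes b: "bounds N n vp t d d' (c # cs) (3 * Z) A"
  shows "hoare N (20 * Z + 20)
    (\<lambda>s. ram_state n I vp t d d' (c # cs) (3 * Z) A s) close_com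
    (\<lambda>s. ram_state n I vp t d d' cs Z (\<lambda>x. A (3 * x + 2)) s)"
proof -
  define Inv where "Inv = (\<lambda>y s. globals n I vp t d d' (c # cs) s \<and> fst s 7 = Z \<and> fst s 14 = y \<and>
    (\<forall>x<y. snd s (table_base n + x) = A (3 * x + 2)) \<and>
    (\<forall>x. y \<le> x \<and> x < 3 * Z \<longrightarrow> snd s (table_base n + x) = A x))"
  have N: "2000 + 200 * n + 10 * (3 * Z) \<le> N" "2 * length (c # cs) \<le> 16 * n"
      "\<And>x. x < 3 * Z \<Longrightarrow> A x \<le> 1"
    using b by (auto simp: bounds_def)
  have tb: "table_base n \<le> 1 + 37 * n" by (simp add: table_base_def)
  have 1: "hoare N 3 (\<lambda>s. ram_state n I vp t d d' (c # cs) (3 * Z) A s)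
      (Basic third_init) (Inv 0)"
    by (rule hoare_Basic) (use N in \<open>auto simp: Inv_def table_def third_init_def\<close>)
  have 2: "hoare N 10 (Inv y) (Basic close_body) (Inv (Suc y))" if y: "y < Z" for y
  proof (rule hoare_Basic)
    fix R M assume "Inv y (R, M)"
    then have I: "globals n I vp t d d' (c # cs) (R, M)" "R 7 = Z" "R 14 = y"
        "\<And>x. x < y \<Longrightarrow> M (table_base n + x) = A (3 * x + 2)"
        "\<And>x. y \<le> x \<Longrightarrow> x < 3 * Z \<Longrightarrow> M (table_base n + x) = A x"
      by (auto simp: Inv_def)
    obtain z where z: "z = 3 * y + 2" by simp
    have a: "Suc (Suc (y + y + y + table_base n)) = table_base n + z" by (simp add: z)
    have rd: "M (table_base n + z) = A z" "A z \<le> 1"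
      using I(5)[of z] N(3)[of z] y by (auto simp: z)
    have eff: "block_eff close_body (R, M) =
        (R(16 := table_base n + z, 17 := A z, 18 := table_base n + y, 15 := 1,
           14 := Suc y), M(table_base n + y := A z))"
      by (simp add: close_body_def a rd globalsD[OF I(1)] I(3))
    have "block_ok N close_body (R, M)"
      using globalsD[OF I(1)] I(3) N(1) y tb rd z by (simp add: close_body_def a)
    moreover have "Inv (Suc y) (block_eff close_body (R, M))"
      unfolding eff using I N(2) by (auto simp: Inv_def globals_mem less_Suc_eq z)
    ultimately show "block_ok N close_body (R, M) \<and> Inv (Suc y) (block_eff close_body (R, M))" ..
  qed (simp add: close_body_def)
  have 3: "hoare N (Z * 12 + 2) (Inv 0) (While_Less 14 7 (Basic close_body)) (Inv Z)"
    by (rule hoare_up[where Inv = Inv and j = 10, OF 2]) (use N in \<open>auto simp: Inv_def\<close>)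
  have 4: "hoare N 2 (Inv Z) (Basic pop)
      (\<lambda>s. ram_state n I vp t d d' cs Z (\<lambda>x. A (3 * x + 2)) s)"
    by (rule hoare_Basic) (use N in \<open>auto simp: Inv_def globals_def table_def pop_def\<close>)
  show ?thesis unfolding close_com_def
    by (rule hoare_Seq[OF 1 hoare_Seq[OF 3 4 order_refl]]) simp
qed

section \<open>Merging two classes\<close>

text \<open>Free of branches: with truncated subtraction, \<open>1 - (1 - x)\<close> is
  \<open>min 1 x\<close>, and for a digit \<open>s\<close> the numbers \<open>1 - (1 - s)\<close>
  and \<open>s - 1\<close> test whether \<open>s\<close> is at least 1 and whether it is 2.\<close>

definition merge_body :: "instr list" where
  "merge_body =
     [Const 15 3, Arith Mod 16 14 15, Arith Add 17 14 14, Arith Add 17 17 14, Arith Sub 17 17 16,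
      Arith Sub 17 17 16, Arith Add 17 17 3, Load 18 17, Const 15 2, Arith Add 17 17 15, Load 19 17,
      Arith Add 17 17 15, Load 20 17, Const 15 1, Arith Sub 21 15 16, Arith Sub 21 15 21,
      Arith Mul 19 19 21, Arith Sub 21 16 15, Arith Mul 20 20 21, Arith Add 18 18 19,
      Arith Add 18 18 20, Arith Sub 18 15 18, Arith Sub 18 15 18, Arith Add 17 3 14, Store 17 18,
      Arith Add 14 14 15]"

text \<open>The outer end of a class is found without a comparison, as the sum of the codes of both
  ends minus the code of the glued end. The class on top has to contain the twin (register 13), and
  the one below the dart itself (register 12).\<close>

definition merge_stack :: "instr list" where
  "merge_stack =
     [Arith Add 16 2 6, Const 15 1, Arith Sub 16 16 15, Load 17 16, Arith Sub 16 16 15, Load 18 16,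
      Arith Add 17 18 17, Arith Sub 17 17 13, Arith Sub 16 16 15, Load 18 16, Arith Sub 16 16 15,
      Load 19 16, Arith Add 18 19 18, Arith Sub 18 18 12, Store 16 17, Arith Add 16 16 15,
      Store 16 18, Const 15 2, Arith Sub 6 6 15]"

definition merge_com :: com where
  "merge_com = Basic third_init ;; While_Less 14 7 (Basic merge_body) ;; Basic merge_stack"

lemma hoare_merge:
  assumes b: "bounds N n vp t d d' (c # e # cs) (9 * Z) A"
  shows "hoare N (90 * Z + 30)
    (\<lambda>s. ram_state n I vp t d d' (c # e # cs) (9 * Z) A s) merge_com
    (\<lambda>s. ram_state n I vp t d d' ((fst c + snd c - d', fst e + snd e - d) # cs) (3 * Z) (merge_table A) s)"
proof -
  define Inv where "Inv = (\<lambda>y s. globals n I vp t d d' (c # e # cs) s \<and> fst s 7 = 3 * Z \<and>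
    fst s 14 = y \<and> (\<forall>x<y. snd s (table_base n + x) = merge_table A x) \<and>
    (\<forall>x. y \<le> x \<and> x < 9 * Z \<longrightarrow> snd s (table_base n + x) = A x))"
  have N: "2000 + 200 * n + 10 * (9 * Z) \<le> N" "2 * length (c # e # cs) \<le> 16 * n"
      "\<And>x. x < 9 * Z \<Longrightarrow> A x \<le> 1"
    using b by (auto simp: bounds_def)
  have tb: "table_base n \<le> 1 + 37 * n" by (simp add: table_base_def)
  have 1: "hoare N 3 (\<lambda>s. ram_state n I vp t d d' (c # e # cs) (9 * Z) A s)
      (Basic third_init) (Inv 0)"
    by (rule hoare_Basic) (use N in \<open>auto simp: Inv_def table_def third_init_def\<close>)
  have 2: "hoare N 26 (Inv y) (Basic merge_body) (Inv (Suc y))" if y: "y < 3 * Z" for y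
  proof (rule hoare_Basic)
    fix R M assume "Inv y (R, M)"
    then have I: "globals n I vp t d d' (c # e # cs) (R, M)" "R 7 = 3 * Z" "R 14 = y"
        "\<And>x. x < y \<Longrightarrow> M (table_base n + x) = merge_table A x"
        "\<And>x. y \<le> x \<Longrightarrow> x < 9 * Z \<Longrightarrow> M (table_base n + x) = A x"
      by (auto simp: Inv_def)
    obtain s where s: "y mod 3 = s" by simp
    then have s3: "s < 3" by auto
    obtain z where z: "z = 3 * y - 2 * s" by simp
    \<comment> \<open>The three entries read lie at \<open>y\<close> or above, so a rising index
      again works in place; the last one is at most \<open>2 + 9 * (Z - 1) + 4\<close>, inside the
      table.\<close>
    have z_le: "y \<le> z" "z + 4 < 9 * Z" "2 * s \<le> 3 * y"
    proof -
      have "y = 3 * (y div 3) + s" "y div 3 < Z" using s y by auto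
      then show "y \<le> z" "z + 4 < 9 * Z" "2 * s \<le> 3 * y" using s3 unfolding z by linarith+
    qed
    have a: "y + y + y - (s + s) + table_base n = table_base n + z" using z_le by (simp add: z)
    obtain v0 v1 v2 where v: "v0 = A z" "v1 = A (z + 2)" "v2 = A (z + 4)" by simp
    have rd: "M (table_base n + z) = v0" "M (Suc (Suc (table_base n + z))) = v1"
        "M (Suc (Suc (Suc (Suc (table_base n + z))))) = v2"
      using I(5)[of z] I(5)[of "z + 2"] I(5)[of "z + 4"] z_le by (auto simp: v eval_nat_numeral)
    have v_le: "v0 \<le> 1" "v1 \<le> 1" "v2 \<le> 1" using N(3) z_le unfolding v by auto
    obtain r where r: "Suc 0 - (Suc 0 - (v0 + v1 * (Suc 0 - (Suc 0 - s)) + v2 * (s - Suc 0))) = r" by simp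
    have "s = 0 \<or> s = 1 \<or> s = 2" using s3 by auto
    then have mt: "merge_table A y = r"
      unfolding merge_table_def Let_def s z[symmetric] r[symmetric] v[symmetric] by auto
    have eff: "block_eff merge_body (R, M) =
        (R(16 := s, 17 := table_base n + y, 18 := r, 19 := v1 * (1 - (1 - s)), 20 := v2 * (s - 1),
           21 := s - 1, 15 := 1, 14 := Suc y), M(table_base n + y := r))"
      by (simp add: merge_body_def s a rd r globalsD[OF I(1)] I(3)) (rule ext, simp)
    have "v0 + v1 * (Suc 0 - (Suc 0 - s)) \<le> 2" "v2 * (s - Suc 0) \<le> 1" "v1 * (Suc 0 - (Suc 0 - s)) \<le> 1"
      using v_le s3 by (auto simp: le_Suc_eq numeral_eq_Suc less_Suc_eq)
    moreover have "r \<le> 1" using r by simp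
    moreover have "y + y + y - s \<le> N" "y + y + y - (s + s) \<le> N" "Suc 0 - k \<le> N" "s - Suc 0 \<le> N" for k
      using N(1) y s3 by auto
    ultimately have "block_ok N merge_body (R, M)"
      using globalsD[OF I(1)] I(3) N(1) y tb rd v_le s3 z_le
      by (simp add: merge_body_def s a r)
    moreover have "Inv (Suc y) (block_eff merge_body (R, M))"
      unfolding eff using I N(2) by (auto simp: Inv_def globals_mem less_Suc_eq mt)
    ultimately show "block_ok N merge_body (R, M) \<and> Inv (Suc y) (block_eff merge_body (R, M))" ..
  qed (simp add: merge_body_def)
  have 3: "hoare N (3 * Z * 28 + 2) (Inv 0) (While_Less 14 7 (Basic merge_body)) (Inv (3 * Z))"
    by (rule hoare_up[where Inv = Inv and j = 26, OF 2]) (use N in \<open>auto simp: Inv_def\<close>)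
  have 4: "hoare N 19 (Inv (3 * Z)) (Basic merge_stack)
      (\<lambda>s. ram_state n I vp t d d' ((fst c + snd c - d', fst e + snd e - d) # cs) (3 * Z) (merge_table A) s)"
  proof (rule hoare_Basic)
    fix R M assume "Inv (3 * Z) (R, M)"
    then have I: "globals n I vp t d d' (c # e # cs) (R, M)" "table n (3 * Z) (merge_table A) (R, M)"
      by (auto simp: Inv_def table_def)
    obtain l where l: "l = stack_base n + 2 * length cs" by simp
    have l_le: "l + 4 \<le> table_base n" "stack_base n \<le> l"
      using N(2) by (auto simp: l stack_base_def table_base_def)
    have a: "Suc (Suc (Suc (Suc (stack_base n + 2 * length cs)))) = Suc (Suc (Suc (Suc l)))"
      by (simp add: l)
    have rd: "M (Suc (Suc (Suc l))) = snd c" "M (Suc (Suc l)) = fst c" "M (Suc l) = snd e" "M l = fst e"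
      using I(1) by (auto simp: globals_def l eval_nat_numeral)
    have le: "fst c < 16 * n" "snd c < 16 * n" "fst e < 16 * n" "snd e < 16 * n" "d < 16 * n" "d' < 16 * n"
      using b by (auto simp: bounds_def)
    have "fst c + snd c - d' \<le> N" "fst e + snd e - d \<le> N" using N(1) le by auto
    note le = le this
    have eff: "block_eff merge_stack (R, M) =
        (R(16 := l + 1, 17 := fst c + snd c - d', 18 := fst e + snd e - d, 19 := fst e, 15 := 2,
          6 := 2 * length (c # e # cs) - 2),
         M(l := fst c + snd c - d', l + 1 := fst e + snd e - d))"
      using globalsD[OF I(1)] rd
      by (simp add: merge_stack_def l) (rule ext, simp)
    have st: "stack (M(l := x, Suc l := y)) (stack_base n) cs" for x y
      using I(1) stack_cong[of "stack_base n" cs M "M(l := x, Suc l := y)"]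
      by (auto simp: globals_def l)
    have "block_ok N merge_stack (R, M)"
      using globalsD[OF I(1)] N(1,2) tb rd le l_le
      by (simp add: merge_stack_def a)
    moreover have "globals n I vp t d d' ((fst c + snd c - d', fst e + snd e - d) # cs) (block_eff merge_stack (R, M))"
      unfolding eff using I(1) st l_le by (auto simp: globals_def l)
    moreover have "table n (3 * Z) (merge_table A) (block_eff merge_stack (R, M))"
      unfolding eff using I(2) l_le by (simp add: table_mem)
    ultimately show "block_ok N merge_stack (R, M) \<and> globals n I vp t d d'
        ((fst c + snd c - d', fst e + snd e - d) # cs) (block_eff merge_stack (R, M)) \<and>
        table n (3 * Z) (merge_table A) (block_eff merge_stack (R, M))" by blast
  qed (simp add: merge_stack_def)
  show ?thesis unfolding merge_com_def
    by (rule hoare_Seq[OF 1 hoare_Seq[OF 3 4 order_refl]]) simp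
qed

section \<open>Appending six digits\<close>

definition add_init :: "instr list" where
  "add_init = [Const 15 729, Arith Mul 7 7 15, Arith Add 14 7 9]"

text \<open>\<open>(r - c) + (c - r)\<close> is the distance of \<open>r\<close> and
  \<open>c\<close>, and subtracting it from 1 tests for equality. The values of \<open>c\<close> are
  the three admissible contents of the six low digits.\<close>

definition add_body :: "instr list" where
  "add_body =
     [Const 15 1, Arith Sub 14 14 15, Const 15 729, Arith Div 16 14 15, Arith Mod 17 14 15,
      Arith Add 16 16 3, Load 18 16,
      Const 15 4, Arith Sub 19 17 15, Arith Sub 20 15 17, Arith Add 19 19 20, Const 20 1, Arith Sub 21 20 19,
      Const 15 36, Arith Sub 19 17 15, Arith Sub 20 15 17, Arith Add 19 19 20, Const 20 1, Arith Sub 22 20 19,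
      Const 15 324, Arith Sub 19 17 15, Arith Sub 20 15 17, Arith Add 19 19 20, Const 20 1, Arith Sub 23 20 19,
      Arith Add 21 21 22, Arith Add 21 21 23, Arith Mul 18 18 21, Arith Add 16 3 14, Store 16 18]"

definition add_table_com :: com where
  "add_table_com = Basic add_init ;; While_Less 9 14 (Basic add_body)"

text \<open>The table grows, so the index has to fall: entry \<open>y\<close> is read from
  \<open>y div 729\<close>, which is at most \<open>y\<close> and still holds its old value.\<close>

lemma hoare_add_table:
  assumes b: "bounds N n vp t d d' cs Z A" and N': "2000 + 200 * n + 10 * (729 * Z) \<le> N"
  shows "hoare N (729 * 40 * Z + 10)
    (\<lambda>s. ram_state n I vp t d d' cs Z A s) add_table_com
    (\<lambda>s. ram_state n I vp t d d' cs (729 * Z) (add_table A) s)"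
proof -
  define Inv where "Inv = (\<lambda>y s. globals n I vp t d d' cs s \<and> fst s 7 = 729 * Z \<and> fst s 14 = y \<and>
    (\<forall>x. y \<le> x \<and> x < 729 * Z \<longrightarrow> snd s (table_base n + x) = add_table A x) \<and>
    (\<forall>x. x < y \<and> x < Z \<longrightarrow> snd s (table_base n + x) = A x))"
  have N: "2 * length cs \<le> 16 * n" "\<And>x. x < Z \<Longrightarrow> A x \<le> 1"
    using b by (auto simp: bounds_def)
  have tb: "table_base n \<le> 1 + 37 * n" by (simp add: table_base_def)
  have 1: "hoare N 3 (\<lambda>s. ram_state n I vp t d d' cs Z A s)
      (Basic add_init) (Inv (729 * Z))"
  proof (rule hoare_Basic)
    fix R M assume "ram_state n I vp t d d' cs Z A (R, M)"
    then have I: "globals n I vp t d d' cs (R, M)" "R 7 = Z" "\<And>x. x < Z \<Longrightarrow> M (table_base n + x) = A x"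
      by (auto simp: table_def)
    have gl: "globals n I vp t d d' cs (R(15 := 729, 7 := Z * 729, 14 := Z * 729), M)"
      using I(1) by simp
    show "block_ok N add_init (R, M) \<and> Inv (729 * Z) (block_eff add_init (R, M))"
      using globalsD[OF I(1)] I(2,3) gl N' by (simp add: Inv_def add_init_def)
  qed (simp add: add_init_def)
  have 2: "hoare N 30 (Inv (Suc y)) (Basic add_body) (Inv y)" if y: "y < 729 * Z" for y
  proof (rule hoare_Basic)
    fix R M assume "Inv (Suc y) (R, M)"
    then have I: "globals n I vp t d d' cs (R, M)" "R 7 = 729 * Z" "R 14 = Suc y"
        "\<And>x. Suc y \<le> x \<Longrightarrow> x < 729 * Z \<Longrightarrow> M (table_base n + x) = add_table A x"
        "\<And>x. x < Suc y \<Longrightarrow> x < Z \<Longrightarrow> M (table_base n + x) = A x"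
      by (auto simp: Inv_def)
    obtain q r where qr: "y div 729 = q" "y mod 729 = r" by simp
    have q: "q \<le> y" "q < Z" "r < 729" using qr y by auto
    have a: "q + table_base n = table_base n + q" by simp
    obtain v where v: "v = A q" by simp
    have rd: "M (table_base n + q) = v" "v \<le> 1" using I(5)[of q] N(2)[of q] q v by auto
    obtain e1 e2 e3 where e: "Suc 0 - (r - 4 + (4 - r)) = e1" "Suc 0 - (r - 36 + (36 - r)) = e2"
        "Suc 0 - (r - 324 + (324 - r)) = e3" by simp
    have e_eq: "e1 = (if r = 4 then 1 else 0)" "e2 = (if r = 36 then 1 else 0)"
        "e3 = (if r = 324 then 1 else 0)" using e by auto
    have at: "add_table A y = v * (e1 + e2 + e3)"
      unfolding add_table_def qr v e_eq by auto
    have eff: "block_eff add_body (R, M) =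
        (R(16 := table_base n + y, 17 := r, 18 := v * (e1 + e2 + e3), 19 := r - 324 + (324 - r),
           20 := 1, 21 := e1 + e2 + e3, 22 := e2, 23 := e3, 15 := 324, 14 := y),
         M(table_base n + y := v * (e1 + e2 + e3)))"
      by (simp add: add_body_def qr a rd e globalsD[OF I(1)] I(3)) (rule ext, simp)
    have diffs: "r - 4 + (4 - r) \<le> N" "r - 36 + (36 - r) \<le> N" "r - 324 + (324 - r) \<le> N"
        "r - 4 \<le> N" "r - 36 \<le> N" "r - 324 \<le> N" "4 - r \<le> N" "36 - r \<le> N" "324 - r \<le> N"
      using N' q(3) by auto
    have "e1 + e2 + e3 \<le> 1" unfolding e_eq by auto
    moreover from this have "v * (e1 + e2 + e3) \<le> 1 * 1" using rd(2) by (intro mult_le_mono)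
    moreover have "e1 \<le> 1" "e2 \<le> 1" "e3 \<le> 1" unfolding e_eq by auto
    ultimately have "block_ok N add_body (R, M)"
      using N' y tb rd(2) q
      by (simp add: add_body_def qr a e diffs rd(1) globalsD[OF I(1)] I(3))
    moreover have "Inv y (block_eff add_body (R, M))"
      unfolding eff using I N(1) by (auto simp: Inv_def globals_mem at[symmetric] le_Suc_eq)
    ultimately show "block_ok N add_body (R, M) \<and> Inv y (block_eff add_body (R, M))" ..
  qed (simp add: add_body_def)
  have 3: "hoare N (729 * Z * 32 + 2) (Inv (729 * Z)) (While_Less 9 14 (Basic add_body)) (Inv 0)"
    by (rule hoare_down[where Inv = Inv and j = 30, OF 2])
      (use N' in \<open>auto simp: Inv_def globals_def\<close>)
  have 4: "hoare N (729 * Z * 32 + 2) (Inv (729 * Z)) (While_Less 9 14 (Basic add_body))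
      (\<lambda>s. ram_state n I vp t d d' cs (729 * Z) (add_table A) s)"
    by (rule hoare_conseq[OF 3]) (auto simp: Inv_def table_def)
  show ?thesis unfolding add_table_com_def
    by (rule hoare_Seq[OF 1 4]) simp
qed

section \<open>Codes of darts, and pushing a class\<close>

definition push_pair :: "nat \<Rightarrow> nat \<Rightarrow> instr list" where
  "push_pair f g =
     [Const 15 16, Arith Mul 17 5 15, Const 15 (4 * f + g), Arith Add 18 17 15, Const 15 (4 * g + f),
      Arith Add 17 17 15, Arith Add 16 2 6, Store 16 18, Const 15 1, Arith Add 16 16 15, Store 16 17,
      Const 15 2, Arith Add 6 6 15]"

fun dart_code :: "dart \<Rightarrow> nat" where
  "dart_code (t, f, g) = 16 * t + 4 * f + g"

lemma hoare_push_pair: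
  assumes N: "2000 + 200 * n + 10 * Z \<le> N" "2 * length cs + 2 \<le> 16 * n" "t < n" "f < 4" "g < 4"
  shows "hoare N 13 (\<lambda>s. ram_state n I vp t d d' cs Z A s) (Basic (push_pair f g))
    (\<lambda>s. ram_state n I vp t d d' ((dart_code (t, f, g), dart_code (t, g, f)) # cs) Z A s)"
proof (rule hoare_Basic)
  fix R M assume "ram_state n I vp t d d' cs Z A (R, M)"
  then have I: "globals n I vp t d d' cs (R, M)" "table n Z A (R, M)" by auto
  obtain l where l: "stack_base n + 2 * length cs = l" by simp
  have l_le: "l + 2 \<le> table_base n" "stack_base n \<le> l" "table_base n \<le> 1 + 37 * n"
    using N(2) by (auto simp: l[symmetric] stack_base_def table_base_def)
  have st: "stack (M(l := x, Suc l := y)) (stack_base n) cs" for x y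
    using I(1) stack_cong[of "stack_base n" cs M "M(l := x, Suc l := y)"]
    by (auto simp: globals_def l)
  obtain x y where xy: "dart_code (t, f, g) = x" "dart_code (t, g, f) = y"
    "t * 16 + (4 * f + g) = x" "t * 16 + (4 * g + f) = y" by simp
  have xy_le: "x < 16 * n" "y < 16 * n" using N unfolding xy(1,2)[symmetric] by auto
  have eff: "block_eff (push_pair f g) (R, M) =
      (R(16 := l + 1, 17 := y, 18 := x, 15 := 2, 6 := 2 * length cs + 2), M(l := x, l + 1 := y))"
    by (simp add: push_pair_def xy l globalsD[OF I(1)]) (rule ext, simp)
  have "block_ok N (push_pair f g) (R, M)"
    using globalsD[OF I(1)] N l_le xy_le by (simp add: push_pair_def xy l)
  moreover have "globals n I vp t d d' ((x, y) # cs) (block_eff (push_pair f g) (R, M))"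
    unfolding eff using I(1) st l_le by (auto simp: globals_def l)
  moreover have "table n Z A (block_eff (push_pair f g) (R, M))"
    unfolding eff using I(2) l_le by (simp add: table_mem)
  ultimately show "block_ok N (push_pair f g) (R, M) \<and>
      globals n I vp t d d' ((dart_code (t, f, g), dart_code (t, g, f)) # cs) (block_eff (push_pair f g) (R, M)) \<and>
      table n Z A (block_eff (push_pair f g) (R, M))" unfolding xy(1,2) by blast
qed (simp add: push_pair_def)

section \<open>Search for a dart on the stack\<close>

definition find_init :: "instr list" where
  "find_init = [Arith Add 10 6 9, Const 11 1, Arith Add 14 6 9]"

text \<open>Register 19 becomes 1 if neither end of the class is the dart sought, and 0 otherwise,
  and it scales all updates: on a miss the offset in register 10 drops by 2 and the power in
  register 11 triples; on a hit both stay, and register 14, which controls the loop, becomes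
  0.\<close>

definition find_body :: "nat \<Rightarrow> instr list" where
  "find_body k =
     [Const 15 1, Arith Add 16 2 10, Arith Sub 16 16 15, Load 17 16, Arith Sub 16 16 15, Load 18 16,
      Arith Sub 19 17 k, Arith Sub 20 k 17, Arith Add 19 19 20, Arith Sub 19 15 19,
      Arith Sub 20 18 k, Arith Sub 21 k 18, Arith Add 20 20 21, Arith Sub 20 15 20,
      Arith Add 19 19 20, Arith Sub 19 15 19,
      Arith Sub 10 10 19, Arith Sub 10 10 19, Arith Mul 20 11 19, Arith Add 11 11 20, Arith Add 11 11 20,
      Arith Mul 14 10 19]"

definition find_com :: "nat \<Rightarrow> com" where
  "find_com k = Basic find_init ;; While_Less 9 14 (Basic (find_body k))"

definition first_pos :: "nat \<Rightarrow> (nat \<times> nat) list \<Rightarrow> nat" where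
  "first_pos x cs = length (takeWhile (\<lambda>c. fst c \<noteq> x \<and> snd c \<noteq> x) cs)"

text \<open>Register 10 is the offset of the upper end of entry \<open>p\<close>, so that 0 signals
  a failed search. The weight 3^p of the digit is obtained along with the search.\<close>

definition found_at :: "nat \<Rightarrow> nat \<Rightarrow> store \<Rightarrow> bool" where
  "found_at l p s \<longleftrightarrow> fst s 10 = 2 * (l - p) \<and> fst s 11 = 3 ^ p"

lemma hoare_find:
  assumes b: "bounds N n vp t d d' cs (3 ^ length cs) A" and k: "k = 12 \<and> x = d \<or> k = 13 \<and> x = d'"
  shows "hoare N (24 * length cs + 10)
    (\<lambda>s. ram_state n I vp t d d' cs (3 ^ length cs) A s) (find_com k)
    (\<lambda>s. globals n I vp t d d' cs s \<and>
      table n (3 ^ length cs) A s \<and>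
      found_at (length cs) (first_pos x cs) s)"
proof -
  let ?l = "length cs" and ?f = "first_pos x cs"
  let ?G = "\<lambda>s. ram_state n I vp t d d' cs (3 ^ ?l) A s"
  have f: "?f \<le> ?l" by (simp add: first_pos_def length_takeWhile_le)
  \<comment> \<open>The first alternative is the state after a hit, with the variant dropped to 0;
    the second is a search still under way or exhausted.\<close>
  define Inv where "Inv = (\<lambda>v s. \<exists>p \<le> ?f. ?G s \<and> found_at ?l p s \<and>
    (fst s 14 = 0 \<and> v = 0 \<and> p = ?f \<or> fst s 14 = 2 * (?l - p) \<and> v = ?l - p))"
  have N: "2000 + 200 * n + 10 * 3 ^ ?l \<le> N" "2 * ?l \<le> 16 * n" "d < 16 * n" "d' < 16 * n"
      "\<And>c. c \<in> set cs \<Longrightarrow> fst c < 16 * n \<and> snd c < 16 * n"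
    using b by (auto simp: bounds_def)
  have 1: "hoare N 3 ?G (Basic find_init) (Inv ?l)"
  proof (rule hoare_Basic)
    fix R M assume I: "?G (R, M)"
    show "block_ok N find_init (R, M) \<and> Inv ?l (block_eff find_init (R, M))"
      using globalsD[of n I vp t d d' cs R M] I N(1,2)
      by (simp add: Inv_def find_init_def found_at_def) (rule exI[of _ 0], simp)
  qed (simp add: find_init_def)
  have 2: "hoare N 22 (Inv v) (Basic (find_body k)) (\<lambda>s. \<exists>v'<v. Inv v' s)" if v: "0 < v" for v
  proof (rule hoare_Basic)
    fix R M assume "Inv v (R, M)"
    then obtain p where I: "p \<le> ?f" "globals n I vp t d d' cs (R, M)" "table n (3 ^ ?l) A (R, M)"
        "R 10 = 2 * (?l - p)" "R 11 = 3 ^ p" "R 14 = 2 * (?l - p)" "v = ?l - p"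
      using v by (auto simp: Inv_def found_at_def)
    have p: "p < ?l" using I(7) v by simp
    have Rk: "R k = x" "x < 16 * n" using k globalsD[OF I(2)] N by auto
    have kn: "k \<noteq> 10" "k \<noteq> 11" "k \<noteq> 14" "k \<noteq> 15" "k \<noteq> 16" "k \<noteq> 17" "k \<noteq> 18" "k \<noteq> 19" "k \<noteq> 20" "k \<noteq> 21"
      using k by auto
    obtain l where l: "stack_base n + 2 * (?l - 1 - p) = l" by simp
    have l': "stack_base n + 2 * (?l - p) = Suc (Suc l)" using p l by simp
    have l_le: "Suc (Suc l) \<le> table_base n" "table_base n \<le> 1 + 37 * n"
      using N(2) p l' by (auto simp: stack_base_def table_base_def)
    have rd: "M (Suc l) = snd (cs ! p)" "M l = fst (cs ! p)"
    proof -
      have "stack M (stack_base n) cs" using I(2) by (simp add: globals_def)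
      then have "M (stack_base n + 2 * (?l - 1 - p)) = fst (cs ! p) \<and>
          M (stack_base n + 2 * (?l - 1 - p) + 1) = snd (cs ! p)"
        using p unfolding stack_iff_nth by blast
      then show "M (Suc l) = snd (cs ! p)" "M l = fst (cs ! p)" unfolding l by simp_all
    qed
    obtain a c where ac: "fst (cs ! p) = a" "snd (cs ! p) = c" by simp
    have ac_le: "a < 16 * n" "c < 16 * n" using N(5)[of "cs ! p"] p ac by auto
    obtain e where e: "Suc 0 - (Suc 0 - (c - x + (x - c)) + (Suc 0 - (a - x + (x - a)))) = e" by simp
    have e_eq: "e = (if a \<noteq> x \<and> c \<noteq> x then 1 else 0)" using e by auto
    have e_le: "e \<le> 1" by (simp add: e_eq)
    have eff: "\<exists>R'. block_eff (find_body k) (R, M) = (R', M) \<and> R' 10 = 2 * (?l - p) - (e + e) \<and>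
        R' 11 = 3 ^ p + 3 ^ p * e + 3 ^ p * e \<and> R' 14 = (2 * (?l - p) - (e + e)) * e \<and>
        (\<forall>r. r \<notin> {10, 11, 14, 15, 16, 17, 18, 19, 20, 21} \<longrightarrow> R' r = R r)"
      by (simp add: find_body_def l' rd ac e Rk(1) kn globalsD[OF I(2)] I(4-6))
    then obtain R' where R': "block_eff (find_body k) (R, M) = (R', M)" "R' 10 = 2 * (?l - p) - (e + e)"
        "R' 11 = 3 ^ p + 3 ^ p * e + 3 ^ p * e" "R' 14 = (2 * (?l - p) - (e + e)) * e"
        "\<And>r. r \<notin> {10, 11, 14, 15, 16, 17, 18, 19, 20, 21} \<Longrightarrow> R' r = R r"
      by blast
    have pw: "3 ^ p + 3 ^ p + 3 ^ p \<le> (3::nat) ^ ?l"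
      using power_increasing[of "Suc p" ?l "3::nat"] p by simp
    have diffs: "c - x \<le> N" "x - c \<le> N" "a - x \<le> N" "x - a \<le> N" "c - x + (x - c) \<le> N"
        "a - x + (x - a) \<le> N" "Suc 0 - j \<le> N" "Suc 0 - j + (Suc 0 - j') \<le> N"
        "2 * (?l - p) - j \<le> N" for j j'
      using N(1,2) ac_le Rk(2) by auto
    have "3 ^ p * e \<le> (3 ^ p :: nat)" using e_le by (cases e) auto
    then have pe: "3 ^ p * e \<le> N" "3 ^ p + 3 ^ p * e \<le> N" using pw N(1) by linarith+
    have pb: "stack_base n \<le> N" "2 * (?l - p) \<le> N" using N(1,2) by (auto simp: stack_base_def)
    have "block_ok N (find_body k) (R, M)"
      using N(1,2) l_le ac_le e_le pw Rk(2)
      by (simp add: find_body_def l' rd ac e pe pb diffs Rk(1) kn globalsD[OF I(2)] I(4-6))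
    moreover have "?G (R', M)"
      using I(2,3) R'(5) by (simp add: globals_def table_def)
    moreover have "\<exists>v'<v. Inv v' (R', M)"
    proof (cases "a \<noteq> x \<and> c \<noteq> x")
      case True
      have "p \<noteq> ?f"
        using nth_length_takeWhile[of "\<lambda>c. fst c \<noteq> x \<and> snd c \<noteq> x" cs] p True ac
        unfolding first_pos_def by auto
      then have "Suc p \<le> ?f" using I(1) by simp
      moreover have "?l - p = Suc (?l - Suc p)" using p by simp
      ultimately show ?thesis using True R'(2-4) \<open>?G (R', M)\<close> I(7) v e_eq
        by (intro exI[of _ "?l - Suc p"]) (auto simp: Inv_def found_at_def intro!: exI[of _ "Suc p"])
    next
      case False
      have "\<not> p < ?f"
        using False ac takeWhile_nth[of p "\<lambda>c. fst c \<noteq> x \<and> snd c \<noteq> x" cs]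
          set_takeWhileD[OF nth_mem[of p "takeWhile (\<lambda>c. fst c \<noteq> x \<and> snd c \<noteq> x) cs"]]
        unfolding first_pos_def by auto
      then have "p = ?f" using I(1) by simp
      then show ?thesis using False R'(2-4) \<open>?G (R', M)\<close> v e_eq
        by (intro exI[of _ 0]) (auto simp: Inv_def found_at_def)
    qed
    ultimately show "block_ok N (find_body k) (R, M) \<and> (\<exists>v'<v. Inv v' (block_eff (find_body k) (R, M)))"
      unfolding R'(1) by blast
  qed (simp add: find_body_def)
  have 3: "hoare N (?l * 24 + 2) (Inv ?l) (While_Less 9 14 (Basic (find_body k))) (Inv 0)"
  proof (rule hoare_While[where j = 22, OF _ 2])
    fix v s assume "Inv v s"
    then show "(fst s 9 < fst s 14 \<longleftrightarrow> 0 < v) \<and> fst s 9 \<le> N \<and> fst s 14 \<le> N"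
      using N f by (cases s) (auto simp: Inv_def dest: globalsD)
  qed auto
  have 4: "hoare N (?l * 24 + 2) (Inv ?l) (While_Less 9 14 (Basic (find_body k)))
      (\<lambda>s. ?G s \<and> found_at ?l ?f s)"
  proof (rule hoare_conseq[OF 3])
    fix s assume "Inv 0 s"
    then obtain p where "p \<le> ?f" "?G s" "found_at ?l p s" "p = ?f \<or> ?l \<le> p"
      by (auto simp: Inv_def)
    moreover from this f have "p = ?f" by linarith
    ultimately show "?G s \<and> found_at ?l ?f s" by simp
  qed auto
  show ?thesis unfolding find_com_def
    by (rule hoare_conseq[OF hoare_Seq[OF 1 4 order_refl]]) auto
qed

text \<open>
  Exchanging digits 0 and \<open>p\<close> of a table index; \<open>u\<close> is \<open>3^(p - 1)\<close>, and \<open>digit_index u h b l a\<close>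
  has digit \<open>a\<close> at position 0, digit \<open>b\<close> at position \<open>p\<close>, and \<open>l\<close>, \<open>h\<close> stand for the digits
  below and above position \<open>p\<close>.
\<close>

definition digit_index :: "nat \<Rightarrow> nat \<Rightarrow> nat \<Rightarrow> nat \<Rightarrow> nat \<Rightarrow> nat" where
  "digit_index u h b l a = a + 3 * (l + u * (b + 3 * h))"

text \<open>A specification only: the program does not perform these divisions but enumerates the
  digits. Digit 0 is removed first, so that digit \<open>p\<close> then has weight 3^(p -
  1).\<close>

definition swap_table :: "nat \<Rightarrow> (nat \<Rightarrow> nat) \<Rightarrow> nat \<Rightarrow> nat" where
  "swap_table p A x = (if p = 0 then A x else
     (let u = 3 ^ (p - 1) in
       A (digit_index u (x div 3 div u div 3) (x mod 3) (x div 3 mod u) (x div 3 div u mod 3))))"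

lemma digit_index_digits:
  assumes "a < 3" "b < 3" "l < u" "x = digit_index u h b l a"
  shows "x mod 3 = a" "x div 3 mod u = l" "x div 3 div u mod 3 = b" "x div 3 div u div 3 = h"
proof -
  define k where "k = b + 3 * h"
  define w where "w = l + u * k"
  have "x = a + 3 * w" using assms(4) by (simp only: digit_index_def w_def k_def)
  then have x: "x mod 3 = a" "x div 3 = w" using assms(1) by auto
  have w: "w mod u = l" "w div u = k" using assms(3) by (auto simp: w_def)
  have k: "k mod 3 = b" "k div 3 = h" using assms(2) by (auto simp: k_def)
  show "x mod 3 = a" "x div 3 mod u = l" "x div 3 div u mod 3 = b" "x div 3 div u div 3 = h"
    by (simp_all only: x w k)
qed

lemma digit_index_inj:
  assumes "a < 3" "b < 3" "l < u" "a' < 3" "b' < 3" "l' < u"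
  shows "digit_index u h b l a = digit_index u h' b' l' a' \<longleftrightarrow> h = h' \<and> b = b' \<and> l = l' \<and> a = a'"
proof
  assume eq: "digit_index u h b l a = digit_index u h' b' l' a'"
  show "h = h' \<and> b = b' \<and> l = l' \<and> a = a'"
    using digit_index_digits[OF assms(1-3) refl, of h] digit_index_digits[OF assms(4-6) eq] by simp
qed simp

lemma swap_table_digit_index:
  assumes "0 < p" "a < 3" "b < 3" "l < 3 ^ (p - 1)"
  shows "swap_table p A (digit_index (3 ^ (p - 1)) h b l a) = A (digit_index (3 ^ (p - 1)) h a l b)"
  using digit_index_digits[OF assms(2-4) refl, of h] assms(1) by (simp add: swap_table_def)

lemma swap_table_enc:
  assumes "p < length ds" "set ds \<subseteq> {..<3}"
  shows "swap_table p A (enc ds) = A (enc (swap_head p ds))"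
proof (cases "p = 0")
  case True
  then show ?thesis by (simp add: swap_table_def swap_head_def)
next
  case False
  define lo hi where "lo = take (p - 1) (tl ds)" and "hi = drop (Suc p) ds"
  have ds: "ds = ds ! 0 # lo @ ds ! p # hi"
  proof -
    obtain d ds' where d: "ds = d # ds'" using assms(1) by (cases ds) auto
    have "ds' = take (p - 1) ds' @ ds' ! (p - 1) # drop (Suc (p - 1)) ds'"
      using assms(1) False d by (intro id_take_nth_drop) auto
    then show ?thesis using False d unfolding lo_def hi_def by (cases p) auto
  qed
  have len: "length lo = p - 1" using assms(1) by (simp add: lo_def)
  have sub: "set lo \<subseteq> {..<3}" "ds ! 0 \<in> {..<3}" "ds ! p \<in> {..<3}"
    using assms(2) by (subst (asm) ds, simp)+
  then have lt: "ds ! 0 < 3" "ds ! p < 3" "enc lo < 3 ^ (p - 1)"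
    using enc_less[OF sub(1)] by (auto simp: len)
  have e: "enc (x # lo @ y # hi) = digit_index (3 ^ (p - 1)) (enc hi) y (enc lo) x" for x y
    by (simp add: enc_append digit_index_def len)
  have "swap_head p (x # lo @ y # hi) = y # lo @ x # hi" for x y
    using len False by (cases p) (auto simp: swap_head_def nth_append)
  then have "enc (swap_head p ds) = digit_index (3 ^ (p - 1)) (enc hi) (ds ! 0) (enc lo) (ds ! p)"
    using e ds by metis
  moreover have "enc ds = digit_index (3 ^ (p - 1)) (enc hi) (ds ! p) (enc lo) (ds ! 0)"
    using e ds by metis
  ultimately show ?thesis using swap_table_digit_index[of p "ds ! 0" "ds ! p" "enc lo"] False lt by simp
qed

section \<open>Exchange of two digits in place\<close>

definition swap_stack :: "instr list" where
  "swap_stack =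
     [Arith Add 16 2 10, Const 15 1, Arith Sub 16 16 15, Arith Add 17 2 6, Arith Sub 17 17 15,
      Load 18 16, Load 19 17, Store 16 19, Store 17 18, Arith Sub 16 16 15, Arith Sub 17 17 15,
      Load 18 16, Load 19 17, Store 16 19, Store 17 18]"

definition swap_init :: "instr list" where
  "swap_init = [Const 14 0, Arith Add 16 11 11]"

text \<open>For fixed other digits, the digits at \<open>p\<close> and 0 index a 3 by 3 matrix of
  entries that is to be transposed. Registers 19 and 20 visit the positions (0,1) and (1,0), then
  (0,2) and (2,0), then (1,2) and (2,1), with column step 1 and row step 3^p.\<close>

definition swap_body :: "instr list" where
  "swap_body =
     [Arith Add 18 3 14, Const 15 1, Arith Add 19 18 15, Arith Add 20 18 11,
      Load 21 19, Load 22 20, Store 19 22, Store 20 21,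
      Arith Add 19 19 15, Arith Add 20 20 11,
      Load 21 19, Load 22 20, Store 19 22, Store 20 21,
      Arith Add 19 19 11, Arith Add 20 20 15,
      Load 21 19, Load 22 20, Store 19 22, Store 20 21,
      Const 15 3, Arith Add 14 14 15]"

text \<open>Register 14 runs through the indices whose digits at 0 and \<open>p\<close> vanish.
  Steps of 3 count through the digits in between; adding twice 3^p then passes over the values 1 and
  2 of digit \<open>p\<close>.\<close>

definition swap_table_com :: com where
  "swap_table_com =
     Basic swap_init ;;
     While_Less 14 7
       (Basic [Arith Add 17 14 11] ;;
        While_Less 14 17 (Basic swap_body) ;;
        Basic [Arith Add 14 14 16])"

text \<open>\<open>swap_stack\<close> leaves 1 in register 15, so the test is 1 < 3^p, that is,
  \<open>p\<close> is positive. For \<open>p = 0\<close> the exchange is trivial.\<close>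

definition swap_com :: com where
  "swap_com =
     Basic swap_stack ;;
     If_Less 15 11 swap_table_com (Basic [])"

lemma swap_head_0: "swap_head 0 xs = xs"
  by (simp add: swap_head_def)

text \<open>The two inequations say that the stack entries at \<open>ap\<close> and
  \<open>a0\<close> either share no cell or coincide, as they do for \<open>p = 0\<close>.\<close>

lemma swap_stack_ok:
  assumes "sb + J = Suc (Suc ap)" "sb + L = Suc (Suc a0)" "R 2 = sb" "R 10 = J" "R 6 = L"
    "M a0 = x" "M (Suc a0) = y" "M ap = z" "M (Suc ap) = w" "ap \<noteq> Suc a0" "a0 \<noteq> Suc ap"
    "x \<le> N" "y \<le> N" "z \<le> N" "w \<le> N" "Suc (Suc ap) \<le> N" "Suc ap \<le> N" "ap \<le> N"
    "Suc (Suc a0) \<le> N" "Suc a0 \<le> N" "a0 \<le> N" "J \<le> N" "L \<le> N" "sb \<le> N" "Suc 0 \<le> N"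
  shows "block_ok N swap_stack (R, M)"
  by (simp add: swap_stack_def assms assms(10,11)[symmetric])

lemma hoare_swap_stack:
  assumes b: "bounds N n vp t d d' cs (3 ^ length cs) A" and p: "p < length cs"
  shows "hoare N 15
    (\<lambda>s. globals n I vp t d d' cs s \<and>
      table n (3 ^ length cs) A s \<and> found_at (length cs) p s)
    (Basic swap_stack)
    (\<lambda>s. globals n I vp t d d' (swap_head p cs) s \<and>
      table n (3 ^ length cs) A s \<and>
      fst s 11 = 3 ^ p \<and> fst s 15 = 1)"
proof (rule hoare_Basic)
  fix R M
  assume "globals n I vp t d d' cs (R, M) \<and>
      table n (3 ^ length cs) A (R, M) \<and> found_at (length cs) p (R, M)"
  then have I: "globals n I vp t d d' cs (R, M)" "table n (3 ^ length cs) A (R, M)"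
      "R 10 = 2 * (length cs - p)" "R 11 = 3 ^ p" by (auto simp: found_at_def)
  have N: "2000 + 200 * n + 10 * 3 ^ length cs \<le> N" "2 * length cs \<le> 16 * n"
      "\<And>c. c \<in> set cs \<Longrightarrow> fst c < 16 * n \<and> snd c < 16 * n"
    using b by (auto simp: bounds_def)
  define addr where "addr = (\<lambda>q. stack_base n + 2 * (length cs - 1 - q))"
  have st: "M (addr q) = fst (cs ! q) \<and> M (Suc (addr q)) = snd (cs ! q)" if "q < length cs" for q
  proof -
    have "stack M (stack_base n) cs" using I(1) by (simp add: globals_def)
    then show ?thesis using that unfolding stack_iff_nth addr_def by simp
  qed
  obtain J where J: "2 * (length cs - p) = J" by simp
  have a: "stack_base n + J = Suc (Suc (addr p))" "stack_base n + 2 * length cs = Suc (Suc (addr 0))"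
    using p by (auto simp: addr_def J[symmetric])
  have R10: "R 10 = J" using I(3) J by simp
  have J_le: "J \<le> 16 * n" using N(2) J by linarith
  have addr_le: "Suc (Suc (addr q)) \<le> table_base n" "stack_base n \<le> addr q" "table_base n \<le> 1 + 37 * n"
      if "q < length cs" for q
    using N(2) that by (auto simp: addr_def stack_base_def table_base_def)
  have addr_eq: "addr q = addr q' \<longleftrightarrow> q = q'" "addr q \<noteq> Suc (addr q')" if "q < length cs" "q' < length cs" for q q'
    using that unfolding addr_def by (auto, presburger?)
  have pos: "0 < length cs" using p by linarith
  define x y z w where "x = fst (cs ! 0)" "y = snd (cs ! 0)" "z = fst (cs ! p)" "w = snd (cs ! p)"
  note xyzw = this
  have le: "x < 16 * n" "y < 16 * n" "z < 16 * n" "w < 16 * n"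
    using N(3)[of "cs ! 0"] N(3)[of "cs ! p"] p pos by (auto simp: xyzw)
  have rd: "M (addr 0) = x" "M (Suc (addr 0)) = y" "M (addr p) = z" "M (Suc (addr p)) = w"
    using st[OF p] st[OF pos] by (auto simp: xyzw)
  define M' where "M' = M(Suc (addr p) := y, Suc (addr 0) := w, addr p := x, addr 0 := z)"
  have ne: "addr p \<noteq> Suc (addr 0)" "addr 0 \<noteq> Suc (addr p)"
    using addr_eq(2)[OF p pos] addr_eq(2)[OF pos p] by auto
  have eff: "block_eff swap_stack (R, M) =
      (R(16 := addr p, 17 := addr 0, 18 := z, 19 := x, 15 := 1), M')"
    by (simp add: swap_stack_def a rd ne ne[symmetric] globalsD[OF I(1)] R10 M'_def) (rule ext, simp)
  have les: "x \<le> N" "y \<le> N" "z \<le> N" "w \<le> N" "Suc (Suc (addr p)) \<le> N" "Suc (addr p) \<le> N" "addr p \<le> N"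
      "Suc (Suc (addr 0)) \<le> N" "Suc (addr 0) \<le> N" "addr 0 \<le> N" "J \<le> N" "2 * length cs \<le> N"
      "stack_base n \<le> N" "Suc 0 \<le> N"
    using N(1,2) le addr_le[OF p] addr_le[OF pos] J_le by linarith+
  have "block_ok N swap_stack (R, M)"
    by (rule swap_stack_ok[where sb = "stack_base n" and J = J and L = "2 * length cs" and ap = "addr p"
          and ?a0.0 = "addr 0" and x = x and y = y and z = z and w = w])
      (fact a rd ne les R10 globalsD[OF I(1)])+
  moreover have "stack M' (stack_base n) (swap_head p cs)"
    unfolding stack_iff_nth length_swap_head
  proof (intro allI impI)
    fix q assume q: "q < length cs"
    show "M' (stack_base n + 2 * (length cs - 1 - q)) = fst (swap_head p cs ! q) \<and>
        M' (stack_base n + 2 * (length cs - 1 - q) + 1) = snd (swap_head p cs ! q)"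
    proof -
      note e = addr_eq[OF q pos] addr_eq[OF q p] addr_eq(2)[OF pos q] addr_eq(2)[OF p q]
      have "M' (addr q) = fst (swap_head p cs ! q) \<and> M' (Suc (addr q)) = snd (swap_head p cs ! q)"
      proof (cases "q = 0 \<or> q = p")
        case True
        then show ?thesis
          by (elim disjE; cases "p = 0") (simp_all add: M'_def nth_swap_head[OF p p]
              nth_swap_head[OF p pos] swap_head_0 ne ne[symmetric] xyzw addr_eq(1)[OF p pos])
      next
        case False
        then show ?thesis
          by (simp add: M'_def nth_swap_head p q e e(2,4,5,6)[symmetric] st[OF q])
      qed
      then show ?thesis by (simp only: addr_def Suc_eq_plus1)
    qed
  qed
  moreover have "M' b = M b" if "b < stack_base n \<or> table_base n \<le> b" for b
  proof -
    have "b \<noteq> addr p" "b \<noteq> Suc (addr p)" "b \<noteq> addr 0" "b \<noteq> Suc (addr 0)"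
      using that addr_le(1,2)[OF p] addr_le(1,2)[OF pos] by linarith+
    then show ?thesis by (simp add: M'_def)
  qed
  ultimately show "block_ok N swap_stack (R, M) \<and>
      globals n I vp t d d' (swap_head p cs) (block_eff swap_stack (R, M)) \<and>
      table n (3 ^ length cs) A (block_eff swap_stack (R, M)) \<and>
      fst (block_eff swap_stack (R, M)) 11 = 3 ^ p \<and> fst (block_eff swap_stack (R, M)) 15 = 1"
    using I(1,2,4) unfolding eff globals_def table_def case_prod_conv by auto
qed (simp add: swap_stack_def)

definition swap_inv :: "nat \<Rightarrow> nat \<Rightarrow> (nat \<Rightarrow> nat) \<Rightarrow> nat \<Rightarrow> nat \<Rightarrow> nat \<Rightarrow> store \<Rightarrow> bool" where
  "swap_inv n u A H h l s \<longleftrightarrow> (case s of (R, M) \<Rightarrow>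
     R 7 = 9 * u * H \<and> R 11 = 3 * u \<and> R 16 = 6 * u \<and> R 14 = 9 * u * h + 3 * l \<and>
     (\<forall>h'<H. \<forall>b<3. \<forall>l'<u. \<forall>a<3. M (table_base n + digit_index u h' b l' a) =
       (if h' < h \<or> h' = h \<and> l' < l then A (digit_index u h' a l' b)
        else A (digit_index u h' b l' a))))"

lemma digit_index_less:
  assumes "a < 3" "b < 3" "l < u" "h < H"
  shows "digit_index u h b l a < 9 * u * H"
proof -
  have "l + u * (b + 3 * h) < u * (b + 3 * h + 1)" using assms(3) by simp
  also have "\<dots> \<le> u * (3 * H)" using assms by (intro mult_le_mono2) linarith
  finally have "l + u * (b + 3 * h) < u * (3 * H)" .
  moreover have "a + 3 * X < 3 * Y" if "X < Y" for X Y :: nat using that assms(1) by linarith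
  ultimately have "digit_index u h b l a < 3 * (u * (3 * H))" unfolding digit_index_def by blast
  then show ?thesis by (simp add: mult.assoc mult.left_commute)
qed

lemma hoare_swap_body:
  assumes N: "2000 + 200 * n + 10 * (9 * u * H) \<le> N" "2 * length cs \<le> 16 * n"
    "\<And>x. x < 9 * u * H \<Longrightarrow> A x \<le> 1" and hl: "h < H" "l < u"
  shows "hoare N 22
    (\<lambda>s. globals n I vp t d d' cs s \<and> swap_inv n u A H h l s \<and> fst s 17 = 9 * u * h + 3 * u)
    (Basic swap_body)
    (\<lambda>s. globals n I vp t d d' cs s \<and> swap_inv n u A H h (Suc l) s \<and> fst s 17 = 9 * u * h + 3 * u)"
proof (rule hoare_Basic)
  fix R M
  assume "globals n I vp t d d' cs (R, M) \<and> swap_inv n u A H h l (R, M) \<and> fst (R, M) 17 = 9 * u * h + 3 * u"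
  then have I: "globals n I vp t d d' cs (R, M)" "R 7 = 9 * u * H" "R 11 = 3 * u" "R 16 = 6 * u"
      "R 14 = 9 * u * h + 3 * l" "R 17 = 9 * u * h + 3 * u"
    and tab: "\<And>h' b l' a. h' < H \<Longrightarrow> b < 3 \<Longrightarrow> l' < u \<Longrightarrow> a < 3 \<Longrightarrow>
      M (table_base n + digit_index u h' b l' a) =
       (if h' < h \<or> h' = h \<and> l' < l then A (digit_index u h' a l' b) else A (digit_index u h' b l' a))"
    by (auto simp: swap_inv_def)
  define c where "c = (\<lambda>b a. table_base n + digit_index u h b l a)"
  define v where "v = (\<lambda>b a. A (digit_index u h b l a))"
  obtain q where q: "9 * u * h + 3 * l = q" by simp
  obtain U where U: "3 * u = U" by simp
  have c_eq: "table_base n + q = c 0 0" "Suc (c 0 0) = c 0 1" "c 0 0 + U = c 1 0" "Suc (c 0 1) = c 0 2"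
      "c 1 0 + U = c 2 0" "c 0 2 + U = c 1 2" "Suc (c 2 0) = c 2 1"
    unfolding c_def digit_index_def q[symmetric] U[symmetric] by (auto simp: algebra_simps)
  have c_inj: "c b a = c b' a' \<longleftrightarrow> b = b' \<and> a = a'" if "a < 3" "b < 3" "a' < 3" "b' < 3" for b a b' a'
    using digit_index_inj[OF that(1,2) hl(2) that(3,4) hl(2), of h h] by (auto simp: c_def)
  have rd: "M (c b a) = v b a" if "a < 3" "b < 3" for b a
    using tab[OF hl(1) that(2) hl(2) that(1)] by (simp add: c_def v_def)
  have v_le: "v b a \<le> 1" if "a < 3" "b < 3" for b a
    using N(3) digit_index_less[OF that hl(2,1)] by (simp add: v_def)
  have c_le: "c b a \<le> N" "table_base n \<le> c b a" if "a < 3" "b < 3" for b a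
    using digit_index_less[OF that hl(2,1)] N(1) by (auto simp: c_def table_base_def)
  have qU: "q + U \<le> 9 * u * H"
  proof -
    have "9 * u * (h + 1) \<le> 9 * u * H" using hl(1) by (intro mult_le_mono2) simp
    then show ?thesis using hl(2) unfolding q[symmetric] U[symmetric] by (simp add: algebra_simps)
  qed
  define M' where "M' = M(c 0 1 := v 1 0, c 1 0 := v 0 1, c 0 2 := v 2 0, c 2 0 := v 0 2,
    c 1 2 := v 2 1, c 2 1 := v 1 2)"
  have eff: "block_eff swap_body (R, M) =
      (R(18 := c 0 0, 19 := c 1 2, 20 := c 2 1, 21 := v 1 2, 22 := v 2 1, 15 := 3, 14 := q + 3), M')"
    using c_eq by (simp add: swap_body_def c_inj rd globalsD[OF I(1)] I(3,5) q U M'_def)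
  have les: "q \<le> N" "U \<le> N" "3 \<le> N" "Suc 0 \<le> N" "table_base n \<le> N"
    using N(1) qU by (auto simp: table_base_def)
  have v_le': "v b a \<le> N" if "a < 3" "b < 3" for b a using v_le[OF that] les(4) by simp
  have ok: "block_ok N swap_body (R, M)"
    using c_eq by (simp add: swap_body_def c_inj rd globalsD[OF I(1)] I(3,5) q U les v_le' c_le(1))
  have gl: "globals n I vp t d d' cs (block_eff swap_body (R, M))"
    unfolding eff M'_def using I(1) N(2) by (simp add: globals_mem c_le(2))
  have M'_c: "M' (c b a) = v a b" if "b < 3" "a < 3" for b a
  proof -
    have "b = 0 \<or> b = 1 \<or> b = 2" "a = 0 \<or> a = 1 \<or> a = 2" using that by auto
    then show ?thesis by (elim disjE) (simp_all add: M'_def c_inj rd)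
  qed
  have M'_other: "M' (table_base n + digit_index u h' b l' a) = M (table_base n + digit_index u h' b l' a)"
    if "b < 3" "l' < u" "a < 3" "h' \<noteq> h \<or> l' \<noteq> l" for h' b l' a
  proof -
    have "table_base n + digit_index u h' b l' a \<noteq> c b' a'" if "a' < 3" "b' < 3" for b' a'
      using digit_index_inj[OF \<open>a < 3\<close> \<open>b < 3\<close> \<open>l' < u\<close> that hl(2), of h' h] \<open>h' \<noteq> h \<or> l' \<noteq> l\<close>
      by (auto simp: c_def)
    then show ?thesis by (simp add: M'_def)
  qed
  have "M' (table_base n + digit_index u h' b l' a) =
      (if h' < h \<or> h' = h \<and> l' < Suc l then A (digit_index u h' a l' b) else A (digit_index u h' b l' a))"
    if "h' < H" "b < 3" "l' < u" "a < 3" for h' b l' a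
  proof (cases "h' = h \<and> l' = l")
    case True
    then show ?thesis using M'_c[OF that(2,4)] by (simp add: c_def v_def)
  next
    case False
    then have "M' (table_base n + digit_index u h' b l' a) = M (table_base n + digit_index u h' b l' a)"
      using M'_other[OF that(2-4)] by blast
    then show ?thesis using tab[OF that] False by auto
  qed
  then have "swap_inv n u A H h (Suc l) (block_eff swap_body (R, M))"
    unfolding eff swap_inv_def using I(2-5) q by simp
  with ok gl show "block_ok N swap_body (R, M) \<and>
      globals n I vp t d d' cs (block_eff swap_body (R, M)) \<and>
      swap_inv n u A H h (Suc l) (block_eff swap_body (R, M)) \<and>
      fst (block_eff swap_body (R, M)) 17 = 9 * u * h + 3 * u"
    unfolding eff using I(6) by simp
qed (simp add: swap_body_def)

lemma hoare_swap_table: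
  assumes b: "bounds N n vp t d d' cs (9 * u * H) A" and u: "0 < u" and H: "0 < H"
  shows "hoare N (30 * (9 * u * H) + 10)
    (\<lambda>s. globals n I vp t d d' cs s \<and>
      table n (9 * u * H) A s \<and> fst s 11 = 3 * u)
    swap_table_com
    (\<lambda>s. globals n I vp t d d' cs s \<and> swap_inv n u A H H 0 s)"
proof -
  have N: "2000 + 200 * n + 10 * (9 * u * H) \<le> N" "2 * length cs \<le> 16 * n"
      "\<And>x. x < 9 * u * H \<Longrightarrow> A x \<le> 1"
    using b by (auto simp: bounds_def)
  let ?I = "\<lambda>h s. globals n I vp t d d' cs s \<and> swap_inv n u A H h 0 s"
  let ?J = "\<lambda>h l s. globals n I vp t d d' cs s \<and> swap_inv n u A H h l s \<and> fst s 17 = 9 * u * h + 3 * u"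
  have small: "9 * u * h + 9 * u \<le> 9 * u * H" if "h < H" for h
  proof -
    have "9 * u * (h + 1) \<le> 9 * u * H" using that by (intro mult_le_mono2) simp
    then show ?thesis by (simp add: algebra_simps)
  qed
    have "9 * u \<le> 9 * u * H" using H by simp
    then have u_le: "10 * (9 * u) \<le> N" using N(1) by linarith
    have 1: "hoare N 2 (\<lambda>s. globals n I vp t d d' cs s \<and>
      table n (9 * u * H) A s \<and> fst s 11 = 3 * u)
        (Basic swap_init) (?I 0)"
    proof (rule hoare_Basic)
      fix R M
      assume "globals n I vp t d d' cs (R, M) \<and>
      table n (9 * u * H) A (R, M) \<and> fst (R, M) 11 = 3 * u"
      then have I: "globals n I vp t d d' cs (R, M)" "R 7 = 9 * u * H" "R 11 = 3 * u"
          "\<And>x. x < 9 * u * H \<Longrightarrow> M (table_base n + x) = A x" by (auto simp: table_def)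
      have "block_ok N swap_init (R, M)" using u_le I(3) by (simp add: swap_init_def)
      moreover have "globals n I vp t d d' cs (block_eff swap_init (R, M))"
        using I(1) by (simp add: swap_init_def)
      moreover have "swap_inv n u A H 0 0 (block_eff swap_init (R, M))"
        using I(2-4) digit_index_less by (simp add: swap_init_def swap_inv_def)
      ultimately show "block_ok N swap_init (R, M) \<and> ?I 0 (block_eff swap_init (R, M))" by blast
    qed (simp add: swap_init_def)
    have 2: "hoare N (24 * u + 4) (?I h)
        (Basic [Arith Add 17 14 11] ;; While_Less 14 17 (Basic swap_body) ;; Basic [Arith Add 14 14 16])
        (?I (Suc h))" if h: "h < H" for h
    proof -
      have a: "hoare N 1 (?I h) (Basic [Arith Add 17 14 11]) (?J h 0)"
        by (rule hoare_Basic)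
          (use small[OF h] N(1) in \<open>auto simp: swap_inv_def\<close>)
      have b: "hoare N (u * (22 + 2) + 2) (?J h 0) (While_Less 14 17 (Basic swap_body)) (?J h u)"
      proof (rule hoare_up[where Inv = "?J h" and j = 22])
        fix l assume "l < u"
        from hoare_swap_body[OF N h this]
        show "hoare N 22 (?J h l) (Basic swap_body) (?J h (Suc l))" .
      next
        fix l s assume "l \<le> u" "?J h l s"
        then have "fst s 14 = 9 * u * h + 3 * l" "fst s 17 = 9 * u * h + 3 * u"
          by (auto simp: swap_inv_def split: prod.splits)
        then show "(fst s 14 < fst s 17 \<longleftrightarrow> l < u) \<and> fst s 14 \<le> N \<and> fst s 17 \<le> N"
          using small[OF h] N(1) \<open>l \<le> u\<close> by auto
      qed simp
      have c: "hoare N 1 (?J h u) (Basic [Arith Add 14 14 16]) (?I (Suc h))"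
      proof (rule hoare_Basic)
        fix R M assume J: "?J h u (R, M)"
        then have r: "R 14 = 9 * u * h + 3 * u" "R 16 = 6 * u" by (auto simp: swap_inv_def)
        have "block_ok N [Arith Add 14 14 16] (R, M)" using r small[OF h] N(1) by simp
        moreover have "swap_inv n u A H (Suc h) 0 (R(14 := 9 * u * h + 3 * u + 6 * u), M)"
        proof -
          \<comment> \<open>The end of one inner loop is the start of the next:
            \<open>(h, u)\<close> and \<open>(Suc h, 0)\<close> describe the same progress.\<close>
          have "h' < Suc h \<or> h' = Suc h \<and> l' < 0 \<longleftrightarrow> h' < h \<or> h' = h \<and> l' < u" if "l' < u" for h' l'
            using that by auto
          then show ?thesis using J unfolding swap_inv_def by (simp add: algebra_simps)
        qed
        ultimately show "block_ok N [Arith Add 14 14 16] (R, M) \<and> ?I (Suc h) (block_eff [Arith Add 14 14 16] (R, M))"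
          using J r by simp
      qed simp
      show ?thesis by (rule hoare_Seq[OF a hoare_Seq[OF b c order_refl]]) simp
    qed
    have 3: "hoare N (H * (24 * u + 4 + 2) + 2) (?I 0)
        (While_Less 14 7 (Basic [Arith Add 17 14 11] ;; While_Less 14 17 (Basic swap_body) ;;
          Basic [Arith Add 14 14 16])) (?I H)"
    proof (rule hoare_up[where Inv = ?I, OF 2])
      fix h s assume "h \<le> H" "?I h s"
      then have "fst s 14 = 9 * u * h" "fst s 7 = 9 * u * H"
        by (auto simp: swap_inv_def split: prod.splits)
      moreover have "9 * u * h \<le> 9 * u * H" using \<open>h \<le> H\<close> by (intro mult_le_mono2)
      then have "9 * u * h \<le> N" "9 * u * H \<le> N" using N(1) by linarith+
      moreover have "9 * u * h < 9 * u * H \<longleftrightarrow> h < H" using u by simp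
      ultimately show "(fst s 14 < fst s 7 \<longleftrightarrow> h < H) \<and> fst s 14 \<le> N \<and> fst s 7 \<le> N"
        by simp
    qed auto
    \<comment> \<open>The overhead of an outer round is absorbed by its inner loop, which runs at
      least once; so the cost per entry is constant for every \<open>p\<close>.\<close>
    have "H * (24 * u + 4 + 2) \<le> H * (30 * u)" using u by (intro mult_le_mono2) linarith
    moreover have "H * (30 * u) = 30 * (u * H)" "30 * (9 * u * H) = 9 * (30 * (u * H))" by simp_all
    ultimately have "2 + (H * (24 * u + 4 + 2) + 2) \<le> 30 * (9 * u * H) + 10" by linarith
    then show ?thesis unfolding swap_table_com_def by (rule hoare_Seq[OF 1 3])
qed

lemma hoare_swap:
  assumes b: "bounds N n vp t d d' cs (3 ^ length cs) A" and p: "p < length cs"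
  shows "hoare N (30 * 3 ^ length cs + 30)
    (\<lambda>s. globals n I vp t d d' cs s \<and>
      table n (3 ^ length cs) A s \<and> found_at (length cs) p s)
    swap_com
    (\<lambda>s. ram_state n I vp t d d' (swap_head p cs) (3 ^ length cs) (swap_table p A) s)"
proof -
  let ?G = "globals n I vp t d d' (swap_head p cs)"
  let ?Q = "\<lambda>s. ?G s \<and> table n (3 ^ length cs) A s \<and> fst s 11 = 3 ^ p \<and> fst s 15 = 1"
  let ?R = "\<lambda>s. ?G s \<and> table n (3 ^ length cs) (swap_table p A) s"
  have b': "bounds N n vp t d d' (swap_head p cs) (3 ^ length cs) A"
    using b p by (simp add: bounds_def)
  have N: "2000 + 200 * n + 10 * 3 ^ length cs \<le> N" using b by (simp add: bounds_def)
  have "(3::nat) ^ p \<le> 3 ^ length cs" using p by (intro power_increasing) auto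
  then have pN: "3 ^ p \<le> N" using N by linarith
  have "hoare N (30 * 3 ^ length cs + 12) ?Q
      (If_Less 15 11
        swap_table_com
        (Basic [])) ?R"
  proof (rule hoare_If[where j = "30 * 3 ^ length cs + 10"])
    fix s assume "?Q s"
    then show "fst s 15 \<le> N \<and> fst s 11 \<le> N" using pN N by simp
  next
    show "hoare N (30 * 3 ^ length cs + 10) (\<lambda>s. ?Q s \<and> fst s 15 < fst s 11)
      swap_table_com ?R"
    proof (cases "p = 0")
      case True
      have "\<not> (?Q s \<and> fst s 15 < fst s 11)" for s using True by auto
      then show ?thesis unfolding hoare_def by blast
    next
      case False
      \<comment> \<open>\<open>u\<close> and \<open>H\<close> count the values of the digits
        strictly between 0 and \<open>p\<close> and of those above \<open>p\<close>.\<close>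
      define u H where "u = (3::nat) ^ (p - 1)" and "H = (3::nat) ^ (length cs - p - 1)"
      have u3: "3 ^ p = 3 * u" using False by (cases p) (auto simp: u_def)
      have "length cs = (p - 1) + (2 + (length cs - p - 1))" using p False by simp
      then have "(3::nat) ^ length cs = 3 ^ (p - 1) * (3 ^ 2 * 3 ^ (length cs - p - 1))"
        by (metis power_add)
      then have Z: "3 ^ length cs = 9 * u * H" by (simp add: u_def H_def)
      have swapped: "table n (9 * u * H) (swap_table p A) s" if "swap_inv n u A H H 0 s" for s
      proof -
        obtain R M where s: "s = (R, M)" by (cases s)
        have "M (table_base n + x) = swap_table p A x" if x: "x < 9 * u * H" for x
        proof -
          define a l b h where "a = x mod 3" and "l = x div 3 mod u" and "b = x div 3 div u mod 3"
            and "h = x div 3 div u div 3"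
          have lt: "a < 3" "b < 3" "l < u" by (auto simp: a_def b_def l_def u_def)
          have "h < H" using x by (simp add: h_def div_mult2_eq[symmetric] less_mult_imp_div_less mult.commute mult.left_commute)
          moreover have "x = digit_index u h b l a"
            unfolding digit_index_def a_def b_def l_def h_def by simp
          ultimately show ?thesis
            using \<open>swap_inv n u A H H 0 s\<close> lt swap_table_digit_index[of p a b l A h] False
            unfolding swap_inv_def s by (simp add: u_def)
        qed
        then show ?thesis using \<open>swap_inv n u A H H 0 s\<close> by (auto simp: swap_inv_def table_def s)
      qed
      have 0: "0 < u" "0 < H" by (auto simp: u_def H_def)
      show ?thesis unfolding Z u3
        by (rule hoare_conseq[OF hoare_swap_table[OF b'[unfolded Z] 0]]) (auto dest: swapped)
    qed
  next
    show "hoare N (30 * 3 ^ length cs + 10) (\<lambda>s. ?Q s \<and> \<not> fst s 15 < fst s 11) (Basic []) ?R"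
    proof (rule hoare_Basic)
      fix R M assume Q: "?Q (R, M) \<and> \<not> fst (R, M) 15 < fst (R, M) 11"
      then have "\<not> (1::nat) < 3 ^ p" by simp
      then have "p = 0" using one_less_power[of "3::nat" p] by auto
      then have "swap_table p A = A" by (simp add: swap_table_def fun_eq_iff)
      then show "block_ok N [] (R, M) \<and> ?R (block_eff [] (R, M))" using Q by simp
    qed simp
  qed simp
  then show ?thesis unfolding swap_com_def
    by (rule hoare_Seq[OF hoare_swap_stack[OF b p]]) simp
qed

lemma hoare_If_True:
  assumes "\<And>s. P s \<Longrightarrow> fst s a < fst s b \<and> fst s b \<le> N" "hoare N j P c Q" "j + 2 \<le> k"
  shows "hoare N k P (If_Less a b c d) Q"
proof (rule hoare_If[where j = j])
  have "\<not> (P s \<and> \<not> fst s a < fst s b)" for s using assms(1) by blast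
  then show "hoare N j (\<lambda>s. P s \<and> \<not> fst s a < fst s b) d Q" unfolding hoare_def by blast
  show "hoare N j (\<lambda>s. P s \<and> fst s a < fst s b) c Q" by (rule hoare_conseq[OF assms(2)]) auto
  show "fst s a \<le> N \<and> fst s b \<le> N" if "P s" for s using assms(1)[OF that] by auto
qed (rule assms(3))

lemma hoare_If_False:
  assumes "\<And>s. P s \<Longrightarrow> \<not> fst s a < fst s b \<and> fst s a \<le> N" "hoare N j P d Q" "j + 2 \<le> k"
  shows "hoare N k P (If_Less a b c d) Q"
proof (rule hoare_If[where j = j])
  have "\<not> (P s \<and> fst s a < fst s b)" for s using assms(1) by blast
  then show "hoare N j (\<lambda>s. P s \<and> fst s a < fst s b) c Q" unfolding hoare_def by blast
  show "hoare N j (\<lambda>s. P s \<and> \<not> fst s a < fst s b) d Q" by (rule hoare_conseq[OF assms(2)]) auto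
  show "fst s a \<le> N \<and> fst s b \<le> N" if "P s" for s using assms(1)[OF that] by auto
qed (rule assms(3))

lemma hoare_skip: "(\<And>s. P s \<Longrightarrow> Q s) \<Longrightarrow> hoare N j P (Basic []) Q"
  by (rule hoare_Basic) auto

section \<open>Gluing a dart to its twin\<close>

text \<open>The record of face \<open>f\<close> starts at address \<open>1 + 20 * t + 5 * f\<close>
  with the other tetrahedron, followed by the images of the four vertices; those of \<open>f\<close>
  and \<open>g\<close> name the twin.\<close>

definition load_codes :: "nat \<Rightarrow> nat \<Rightarrow> instr list" where
  "load_codes f g =
     [Const 15 16, Arith Mul 12 5 15, Const 15 (4 * f + g), Arith Add 12 12 15,
      Const 15 20, Arith Mul 16 5 15, Const 15 (1 + 5 * f), Arith Add 16 16 15, Load 17 16,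
      Const 15 (1 + f), Arith Add 18 16 15, Load 18 18,
      Const 15 (1 + g), Arith Add 19 16 15, Load 19 19,
      Const 15 16, Arith Mul 13 17 15, Const 15 4, Arith Mul 18 18 15,
      Arith Add 13 13 18, Arith Add 13 13 19]"

lemma hoare_load_codes:
  assumes N: "2000 + 200 * n \<le> N" and t: "t < n" "f < 4" "g < 4"
    and I: "I (1 + 20 * t + 5 * f) = u" "I (2 + 20 * t + 5 * f + f) = p" "I (2 + 20 * t + 5 * f + g) = q"
    and u: "u < n" "p < 4" "q < 4"
  shows "hoare N 21 (\<lambda>s. ram_state n I vp t d d' cs Z A s) (Basic (load_codes f g))
    (\<lambda>s. ram_state n I vp t (dart_code (t, f, g)) (dart_code (u, p, q)) cs Z A s)"
proof (rule hoare_Basic)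
  fix R M assume "ram_state n I vp t d d' cs Z A (R, M)"
  then have G: "globals n I vp t d d' cs (R, M)" "table n Z A (R, M)" by auto
  obtain a where a: "Suc (t * 20 + 5 * f) = a" by simp
  obtain b where b: "Suc (a + f) = b" by simp
  obtain c where c: "Suc (a + g) = c" by simp
  have lt: "a < stack_base n" "b < stack_base n" "c < stack_base n" "a \<le> N" "b \<le> N" "c \<le> N" "t * 20 \<le> N"
    using t N unfolding a[symmetric] b[symmetric] c[symmetric] stack_base_def by auto
  have mem: "M x = I x" if "x < stack_base n" for x using G(1) that by (auto simp: globals_def)
  have rd: "M a = u" "M b = p" "M c = q"
    using mem[OF lt(1)] mem[OF lt(2)] mem[OF lt(3)] I
    unfolding a[symmetric] b[symmetric] c[symmetric] by (auto simp: algebra_simps)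
  obtain x y where xy: "t * 16 + (4 * f + g) = x" "u * 16 + p * 4 + q = y" by simp
  have xy': "dart_code (t, f, g) = x" "dart_code (u, p, q) = y" using xy by auto
  have eff: "\<exists>R'. block_eff (load_codes f g) (R, M) = (R', M) \<and> R' 12 = x \<and> R' 13 = y \<and>
      (\<forall>r. r \<notin> {12, 13, 15, 16, 17, 18, 19} \<longrightarrow> R' r = R r)"
    by (simp add: load_codes_def a b c rd xy globalsD[OF G(1)])
  then obtain R' where R': "block_eff (load_codes f g) (R, M) = (R', M)" "R' 12 = x" "R' 13 = y"
      "\<And>r. r \<notin> {12, 13, 15, 16, 17, 18, 19} \<Longrightarrow> R' r = R r" by blast
  have "block_ok N (load_codes f g) (R, M)"
    using N t u by (simp add: load_codes_def a b c rd xy globalsD[OF G(1)] lt)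
  moreover have "globals n I vp t x y cs (R', M)" "table n Z A (R', M)"
    using G R'(2-4) by (simp_all add: globals_def table_def)
  ultimately show "block_ok N (load_codes f g) (R, M) \<and>
      globals n I vp t (dart_code (t, f, g)) (dart_code (u, p, q)) cs (block_eff (load_codes f g) (R, M)) \<and>
      table n Z A (block_eff (load_codes f g) (R, M))" unfolding R'(1) xy' by blast
qed (simp add: load_codes_def)

text \<open>Imitates a search that has stopped at position 1: the offset is two below the size of
  the stack, and the weight of the digit is 3.\<close>

definition select_second :: "instr list" where
  "select_second = [Const 15 2, Arith Sub 10 6 15, Const 11 3]"

text \<open>The class of the dart is on top. If its twin is there too, the class closes. Otherwise
  the top class moves to second place, and the twin is searched anew, because this exchange may have
  moved its class; bringing that class to the top gives the arrangement that merging
  expects.\<close>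

definition partners_com :: com where
  "partners_com =
     If_Less 10 6
       (Basic select_second ;; swap_com ;;
        find_com 13 ;; swap_com ;; merge_com)
       close_com"

definition glue_com :: "nat \<Rightarrow> nat \<Rightarrow> com" where
  "glue_com f g =
     Basic (load_codes f g) ;; find_com 12 ;;
     If_Less 9 10
       (swap_com ;; find_com 13 ;;
        If_Less 9 10 partners_com (Basic []))
       (Basic [])"

definition codes :: "((nat \<times> nat set) set \<times> dart \<times> dart) list \<Rightarrow> (nat \<times> nat) list" where
  "codes zs = map (\<lambda>(P, a, b). (dart_code a, dart_code b)) zs"

lemma length_codes [simp]: "length (codes zs) = length zs"
  by (simp add: codes_def)

lemma codes_swap_head: "p < length zs \<Longrightarrow> swap_head p (codes zs) = codes (swap_head p zs)"
  by (simp add: codes_def map_swap_head)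

lemma dart_code_digits:
  assumes "f < 4" "g < 4"
  shows "dart_code (t, f, g) mod 4 = g" "dart_code (t, f, g) div 4 mod 4 = f"
    "dart_code (t, f, g) div 4 div 4 = t"
proof -
  obtain k where k: "k = f + 4 * t" by simp
  then have 1: "dart_code (t, f, g) = g + 4 * k" by simp
  have 2: "k mod 4 = f" "k div 4 = t" using assms(1) by (auto simp: k)
  have 3: "(g + 4 * k) mod 4 = g" "(g + 4 * k) div 4 = k" using assms(2) by auto
  show "dart_code (t, f, g) mod 4 = g" "dart_code (t, f, g) div 4 mod 4 = f"
    "dart_code (t, f, g) div 4 div 4 = t" unfolding 1 3 2 by simp_all
qed

lemma dart_code_inj:
  assumes "a \<in> darts_in X" "b \<in> darts_in Y" shows "dart_code a = dart_code b \<longleftrightarrow> a = b"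
proof
  obtain t f g where a: "a = (t, f, g)" "f < 4" "g < 4" using assms by (auto simp: darts_in_def)
  obtain t' f' g' where b: "b = (t', f', g')" "f' < 4" "g' < 4" using assms by (auto simp: darts_in_def)
  assume "dart_code a = dart_code b"
  then show "a = b"
    using dart_code_digits[OF a(2,3), of t] dart_code_digits[OF b(2,3), of t'] a(1) b(1) by simp
qed simp

lemma nat_le_3_power: "(m::nat) \<le> 3 ^ m"
  by (rule order_trans[OF less_imp_le[OF less_exp] power_mono]) auto

context closed_triangulation
begin

lemma dart_code_less: "d \<in> darts \<Longrightarrow> dart_code d < 16 * n"
  by (auto simp: darts_in_def)

lemma card_darts_le: "finite darts" "card darts \<le> 16 * n"
proof -
  have s: "darts \<subseteq> {..<n} \<times> {..<4} \<times> {..<4}" by (auto simp: darts_in_def)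
  show "finite darts" by (rule finite_subset[OF s]) simp
  have "card darts \<le> card ({..<n} \<times> {..<4::nat} \<times> {..<4::nat})" by (rule card_mono[OF _ s]) simp
  then show "card darts \<le> 16 * n" by simp
qed

text \<open>The height of the stack is controlled through the set of open darts. Gluing can only
  shrink this set, so one bound serves all gluings of a tetrahedron.\<close>

definition fits :: "nat \<Rightarrow> nat \<Rightarrow> nat \<Rightarrow> dart set \<Rightarrow> bool" where
  "fits N K vp D \<longleftrightarrow> 2000 + 200 * n + 10 * 3 ^ K \<le> N \<and> vp \<le> stack_base n \<and> card D \<le> 2 * K"

lemma dp_bounds:
  assumes inv: "dp_inv X zs Ks A" and fit: "fits N K vp (open_darts zs)"
    and t: "t < n" "d < 16 * n" "d' < 16 * n"
  shows "bounds N n vp t d d' (codes zs) (3 ^ length zs) A" "length zs \<le> K" "(3::nat) ^ length zs \<le> 3 ^ K"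
proof -
  note od = dp_inv_open_darts[OF inv]
  have "2 * length zs \<le> card darts" using od card_mono[OF card_darts_le(1) od(1)] by simp
  then have len: "2 * length zs \<le> 16 * n" using card_darts_le(2) by linarith
  show K: "length zs \<le> K" using fit od(3) by (simp add: fits_def)
  then show pw: "(3::nat) ^ length zs \<le> 3 ^ K" by (intro power_increasing) auto
  have "fst c < 16 * n \<and> snd c < 16 * n" if "c \<in> set (codes zs)" for c
    using that inv dart_code_less unfolding codes_def dp_inv_def open_class_def by fastforce
  moreover have "2000 + 200 * n + 10 * 3 ^ length zs \<le> N"
    using fit pw unfolding fits_def by linarith
  ultimately show "bounds N n vp t d d' (codes zs) (3 ^ length zs) A"
    using fit len t dp_inv_table_le[OF inv] unfolding bounds_def fits_def by auto
qed

lemma first_pos_codes: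
  assumes inv: "dp_inv X zs Ks A" and x: "x \<in> darts"
  shows "x \<in> open_darts zs \<Longrightarrow> first_pos (dart_code x) (codes zs) < length zs \<and>
      (\<exists>P a b. zs ! first_pos (dart_code x) (codes zs) = (P, a, b) \<and> x \<in> {a, b})"
    and "x \<notin> open_darts zs \<Longrightarrow> first_pos (dart_code x) (codes zs) = length zs"
    and "zs ! 0 = (P, a, b) \<Longrightarrow> zs \<noteq> [] \<Longrightarrow> x \<in> {a, b} \<Longrightarrow> first_pos (dart_code x) (codes zs) = 0"
proof -
  let ?P = "\<lambda>c. fst c \<noteq> dart_code x \<and> snd c \<noteq> dart_code x"
  have eq: "first_pos (dart_code x) (codes zs) = length (takeWhile (\<lambda>(P, a, b). a \<noteq> x \<and> b \<noteq> x) zs)"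
  proof -
    have "takeWhile (?P \<circ> (\<lambda>(P, a, b). (dart_code a, dart_code b))) zs =
        takeWhile (\<lambda>(P, a, b). a \<noteq> x \<and> b \<noteq> x) zs"
    proof (rule takeWhile_cong)
      fix z assume "z \<in> set zs"
      then have "open_class X z" using inv by (simp only: dp_inv_def)
      then show "(?P \<circ> (\<lambda>(P, a, b). (dart_code a, dart_code b))) z = (\<lambda>(P, a, b). a \<noteq> x \<and> b \<noteq> x) z"
        using dart_code_inj[OF _ x] by (cases z) (auto simp: open_class_def)
    qed simp
    then show ?thesis unfolding first_pos_def codes_def takeWhile_map length_map by simp
  qed
  let ?Q = "\<lambda>(P, a, b). a \<noteq> x \<and> b \<noteq> x"
  show "first_pos (dart_code x) (codes zs) < length zs \<and>
      (\<exists>P a b. zs ! first_pos (dart_code x) (codes zs) = (P, a, b) \<and> x \<in> {a, b})"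
    if "x \<in> open_darts zs"
  proof -
    have "takeWhile ?Q zs \<noteq> zs"
    proof
      assume "takeWhile ?Q zs = zs"
      then have "\<forall>z\<in>set zs. ?Q z" by (simp add: takeWhile_eq_all_conv)
      then show False using that by (auto simp: open_darts_def)
    qed
    then have lt: "length (takeWhile ?Q zs) < length zs"
      by (metis length_takeWhile_le nat_less_le takeWhile_eq_take take_all_iff)
    obtain P a b where z: "zs ! length (takeWhile ?Q zs) = (P, a, b)"
      by (cases "zs ! length (takeWhile ?Q zs)")
    have "\<not> ?Q (zs ! length (takeWhile ?Q zs))" by (rule nth_length_takeWhile[OF lt])
    with z lt show ?thesis unfolding eq by auto
  qed
  show "first_pos (dart_code x) (codes zs) = length zs" if "x \<notin> open_darts zs"
  proof -
    have "?Q z" if "z \<in> set zs" for z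
      using \<open>x \<notin> open_darts zs\<close> that by (cases z) (fastforce simp: open_darts_def)
    then have "takeWhile ?Q zs = zs" unfolding takeWhile_eq_all_conv by blast
    then show ?thesis unfolding eq by (simp only:)
  qed
  show "first_pos (dart_code x) (codes zs) = 0"
    if "zs ! 0 = (P, a, b)" "zs \<noteq> []" "x \<in> {a, b}"
    unfolding eq using that by (cases zs) auto
qed

definition input_ok :: "(nat \<Rightarrow> nat) \<Rightarrow> nat list \<Rightarrow> bool" where
  "input_ok I vs \<longleftrightarrow> I 0 = n \<and> (\<forall>i<n. I (1 + 20 * n + i) = vs ! i) \<and>
     (\<forall>t<n. \<forall>f<4. \<forall>u p. glue T t f = Some (u, p) \<longrightarrow>
       I (1 + 20 * t + 5 * f) = u \<and> (\<forall>v<4. I (2 + 20 * t + 5 * f + v) = p v))"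

definition dp_globals ::
    "(nat \<Rightarrow> nat) \<Rightarrow> nat \<Rightarrow> dart \<Rightarrow> ((nat \<times> nat set) set \<times> dart \<times> dart) list \<Rightarrow> (nat \<Rightarrow> nat) \<Rightarrow> store \<Rightarrow> bool" where
  "dp_globals I vp x zs A s \<longleftrightarrow>
     ram_state n I vp (fst x) (dart_code x) (dart_code (twin x)) (codes zs) (3 ^ length zs) A s"

text \<open>The order of the stack, the table and the codes left in the dart registers are hidden;
  only the set of open darts is prescribed. So a gluing abandoned after an exchange still leaves a
  valid state.\<close>

definition dp_state :: "(nat \<Rightarrow> nat) \<Rightarrow> nat \<Rightarrow> nat set \<Rightarrow> dart set \<Rightarrow> nat \<Rightarrow> store \<Rightarrow> bool" where
  "dp_state I vp X D t s \<longleftrightarrow> (\<exists>zs Ks A d d'. dp_inv X zs Ks A \<and> open_darts zs = D \<and>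
     d < 16 * n \<and> d' < 16 * n \<and> ram_state n I vp t d d' (codes zs) (3 ^ length zs) A s)"

lemma dp_stateI:
  assumes "dp_inv X zs Ks A" "open_darts zs = D" "x \<in> darts" "fst x = t" "dp_globals I vp x zs A s"
  shows "dp_state I vp X D t s"
  unfolding dp_state_def
  using assms(1,2,5) dart_code_less[OF assms(3)] dart_code_less[OF twin_in[OF assms(3)]]
  unfolding dp_globals_def assms(4) by blast

lemma dp_inv_swap_table:
  assumes "dp_inv X zs Ks A" "p < length zs"
  shows "dp_inv X (swap_head p zs) Ks (swap_table p A)"
  using assms by (intro dp_inv_swap) (auto simp: swap_table_enc)

lemma hoare_dp_find:
  assumes inv: "dp_inv X zs Ks A" and fit: "fits N K vp (open_darts zs)" and x: "x \<in> darts"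
    and k: "k = 12 \<and> y = x \<or> k = 13 \<and> y = twin x"
  shows "hoare N (24 * 3 ^ K + 10) (dp_globals I vp x zs A) (find_com k)
    (\<lambda>s. dp_globals I vp x zs A s \<and> found_at (length zs) (first_pos (dart_code y) (codes zs)) s)"
proof -
  have t: "fst x < n" using x by (auto simp: darts_in_def)
  note b = dp_bounds[OF inv fit t dart_code_less[OF x] dart_code_less[OF twin_in[OF x]]]
  have "length zs \<le> 3 ^ K" using nat_le_3_power[of "length zs"] b(3) by linarith
  then have "24 * length zs + 10 \<le> 24 * 3 ^ K + 10" by simp
  moreover have k': "k = 12 \<and> dart_code y = dart_code x \<or> k = 13 \<and> dart_code y = dart_code (twin x)"
    using k by auto
  have "bounds N n vp (fst x) (dart_code x) (dart_code (twin x)) (codes zs) (3 ^ length (codes zs)) A"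
    using b(1) by simp
  note hoare_find[OF this k', of I]
  ultimately show ?thesis unfolding dp_globals_def length_codes
    by (elim hoare_conseq) simp_all
qed

lemma hoare_dp_swap:
  assumes inv: "dp_inv X zs Ks A" and fit: "fits N K vp (open_darts zs)" and x: "x \<in> darts"
    and p: "p < length zs"
  shows "hoare N (30 * 3 ^ K + 30) (\<lambda>s. dp_globals I vp x zs A s \<and> found_at (length zs) p s) swap_com
    (dp_globals I vp x (swap_head p zs) (swap_table p A))"
proof -
  have t: "fst x < n" using x by (auto simp: darts_in_def)
  note b = dp_bounds[OF inv fit t dart_code_less[OF x] dart_code_less[OF twin_in[OF x]]]
  have "bounds N n vp (fst x) (dart_code x) (dart_code (twin x)) (codes zs) (3 ^ length (codes zs)) A"
    using b(1) by simp
  from hoare_swap[OF this, of p I] p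
  have "hoare N (30 * 3 ^ length zs + 30)
      (\<lambda>s. globals n I vp (fst x) (dart_code x) (dart_code (twin x)) (codes zs) s \<and>
      table n (3 ^ length zs) A s \<and> found_at (length zs) p s) swap_com
      (\<lambda>s. ram_state n I vp (fst x) (dart_code x) (dart_code (twin x)) (codes (swap_head p zs)) (3 ^ length zs) (swap_table p A) s)"
    by (simp add: codes_swap_head)
  then show ?thesis unfolding dp_globals_def length_swap_head
    by (rule hoare_conseq) (use b(3) in auto)
qed

lemma hoare_glue_partners:
  assumes inv: "dp_inv X zs Ks A" and fit: "fits N K vp (open_darts zs)" and x: "x \<in> darts"
    and zs: "zs = (P, a, b) # zs'" "x \<in> {a, b}" and tw: "twin x \<in> open_darts zs"
  shows "hoare N (230 * 3 ^ K + 200)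
    (\<lambda>s. dp_globals I vp x zs A s \<and> found_at (length zs) (first_pos (dart_code (twin x)) (codes zs)) s)
    partners_com
    (dp_state I vp X (open_darts zs - {x, twin x}) (fst x))"
proof -
  let ?m = "length zs" and ?d = "dart_code x" and ?d' = "dart_code (twin x)"
  let ?p = "first_pos ?d' (codes zs)"
  have t: "fst x < n" using x by (auto simp: darts_in_def)
  note b = dp_bounds[OF inv fit t dart_code_less[OF x] dart_code_less[OF twin_in[OF x]]]
  have tx: "twin x \<in> darts" "twin (twin x) = x" "x \<noteq> twin x"
    using x twin_neq[OF x, symmetric] by auto
  note fp = first_pos_codes[OF inv tx(1)]
  have R6: "fst s 10 = 2 * (?m - ?p) \<and> fst s 6 = 2 * ?m"
    if "dp_globals I vp x zs A s \<and> found_at ?m ?p s" for s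
    using that by (cases s) (auto simp: dp_globals_def found_at_def globals_def)
  have mN: "2 * ?m \<le> N" "3 * 3 ^ (?m - 1) \<le> N"
    using b(1) zs(1) by (auto simp: bounds_def)
  show ?thesis
  proof (cases "?p = 0")
    case True
    then have ab: "twin x \<in> {a, b}" using fp(1)[OF tw] zs(1) by auto
    then have ab': "{a, b} = {x, twin x}" "twin a = b" using zs(2) tx by auto
    note cl = dp_inv_close[OF inv[unfolded zs(1)] ab'(2)]
    have pw: "(3::nat) ^ ?m = 3 * 3 ^ length zs'" by (simp add: zs(1))
    have c: "codes zs = (dart_code a, dart_code b) # codes zs'" by (simp add: zs(1) codes_def)
    have h: "hoare N (20 * 3 ^ length zs' + 20) (dp_globals I vp x zs A) close_com
        (dp_globals I vp x zs' (\<lambda>y. A (3 * y + 2)))"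
      using hoare_close[OF b(1)[unfolded c pw], of I] unfolding dp_globals_def c pw .
    show ?thesis unfolding partners_com_def
    proof (rule hoare_If_False)
      fix s assume "dp_globals I vp x zs A s \<and> found_at ?m ?p s"
      then show "\<not> fst s 10 < fst s 6 \<and> fst s 10 \<le> N" using R6[of s] True mN by simp
    next
      show "hoare N (20 * 3 ^ length zs' + 20)
        (\<lambda>s. dp_globals I vp x zs A s \<and> found_at ?m ?p s) close_com
        (dp_state I vp X (open_darts zs - {x, twin x}) (fst x))"
      proof (rule hoare_conseq[OF h])
        fix s assume "dp_globals I vp x zs' (\<lambda>y. A (3 * y + 2)) s"
        then show "dp_state I vp X (open_darts zs - {x, twin x}) (fst x) s"
          using dp_stateI[OF cl(1) cl(2) x refl] unfolding zs(1) ab'(1) by blast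
      qed auto
      show "20 * 3 ^ length zs' + 20 + 2 \<le> 230 * 3 ^ K + (200::nat)"
        using b(3) unfolding pw by linarith
    qed
  next
    case False
    let ?zs1 = "swap_head 1 zs" and ?A1 = "swap_table 1 A"
    have p: "?p < ?m" using fp(1)[OF tw] by blast
    then have m: "1 < ?m" using False by linarith
    note inv1 = dp_inv_swap_table[OF inv m]
    have od1: "open_darts ?zs1 = open_darts zs" using m by simp
    have x1: "?zs1 ! 1 = (P, a, b)" using m zs(1) by (simp add: nth_swap_head)
    let ?q = "first_pos ?d' (codes ?zs1)"
    obtain Q c e where q: "?q < length ?zs1" "?zs1 ! ?q = (Q, c, e)" "twin x \<in> {c, e}"
      using first_pos_codes(1)[OF inv1 tx(1)] tw od1 by auto
    \<comment> \<open>Position 1 now holds the class of \<open>x\<close>, which does not contain the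
      twin; hence exchanging positions 0 and \<open>?q\<close> leaves it there.\<close>
    have q1: "?q \<noteq> 1"
    proof
      assume "?q = 1"
      then have "twin x \<in> {a, b}" using q x1 by auto
      then have "?p = 0" using fp(3)[of P a b] zs by auto
      then show False using False by simp
    qed
    let ?zs2 = "swap_head ?q ?zs1" and ?A2 = "swap_table ?q ?A1"
    note inv2 = dp_inv_swap_table[OF inv1 q(1)]
    have od2: "open_darts ?zs2 = open_darts zs" using q m by simp
    have l1: "0 < length ?zs1" "1 < length ?zs1" using m by (simp_all only: length_swap_head)
    have n2: "?zs2 ! 0 = (Q, c, e)" "?zs2 ! 1 = (P, a, b)"
      using nth_swap_head[OF q(1) l1(1)] nth_swap_head[OF q(1) l1(2)] q(2) x1 q1 by simp_all
    have "1 < length ?zs2" using m by (simp only: length_swap_head)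
    with n2 obtain zs3 where zs3: "?zs2 = (Q, c, e) # (P, a, b) # zs3"
      by (cases ?zs2; cases "tl ?zs2") auto
    then have len3: "?m = Suc (Suc (length zs3))" by (metis length_Cons length_swap_head)
    obtain c' where c': "{c, e} = {twin x, c'}" "dart_code c + dart_code e - ?d' = dart_code c'"
    proof (cases "c = twin x")
      case True
      show ?thesis by (rule that[of e]) (simp_all add: True)
    next
      case False
      then have "e = twin x" using q(3) by simp
      then show ?thesis by (intro that[of c]) (simp_all add: insert_commute)
    qed
    obtain a' where a': "{a, b} = {x, a'}" "dart_code a + dart_code b - ?d = dart_code a'"
    proof (cases "a = x")
      case True
      show ?thesis by (rule that[of b]) (simp_all add: True)
    next
      case False
      then have "b = x" using zs(2) by simp
      then show ?thesis by (intro that[of a]) (simp_all add: insert_commute)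
    qed
    note mg = dp_inv_merge[OF inv2[unfolded zs3] c'(1) a'(1) refl]
    let ?zs4 = "(Q \<union> P, c', a') # zs3"
    have pw: "(3::nat) ^ length ?zs2 = 9 * 3 ^ length zs3" "(3::nat) ^ length ?zs4 = 3 * 3 ^ length zs3"
      by (simp_all add: len3)
    have cd: "codes ?zs2 = (dart_code c, dart_code e) # (dart_code a, dart_code b) # codes zs3"
      "codes ?zs4 = (dart_code c', dart_code a') # codes zs3"
      unfolding zs3 by (simp_all add: codes_def)
    have fit2: "fits N K vp (open_darts ?zs1)" "fits N K vp (open_darts ?zs2)" using fit od1 od2 by auto
    note b2 = dp_bounds[OF inv2 fit2(2) t dart_code_less[OF x] dart_code_less[OF tx(1)]]
    have 1: "hoare N 3 (\<lambda>s. dp_globals I vp x zs A s \<and> found_at ?m ?p s)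
        (Basic select_second)
        (\<lambda>s. dp_globals I vp x zs A s \<and> found_at ?m 1 s)"
    proof (rule hoare_Basic)
      fix R M assume a: "dp_globals I vp x zs A (R, M) \<and> found_at ?m ?p (R, M)"
      then show "block_ok N select_second (R, M) \<and>
          dp_globals I vp x zs A (block_eff select_second (R, M)) \<and>
          found_at ?m 1 (block_eff select_second (R, M))"
        using R6[OF a] mN m b(1) by (auto simp: select_second_def dp_globals_def found_at_def bounds_def)
    qed (simp add: select_second_def)
    have 2: "hoare N (30 * 3 ^ K + 30) (\<lambda>s. dp_globals I vp x zs A s \<and> found_at ?m 1 s) swap_com
        (dp_globals I vp x ?zs1 ?A1)"
      by (rule hoare_dp_swap[OF inv fit x m])
    have 3: "hoare N (24 * 3 ^ K + 10) (dp_globals I vp x ?zs1 ?A1) (find_com 13)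
        (\<lambda>s. dp_globals I vp x ?zs1 ?A1 s \<and> found_at (length ?zs1) ?q s)"
      by (rule hoare_dp_find[OF inv1 fit2(1) x]) simp
    have 4: "hoare N (30 * 3 ^ K + 30)
        (\<lambda>s. dp_globals I vp x ?zs1 ?A1 s \<and> found_at (length ?zs1) ?q s) swap_com
        (dp_globals I vp x ?zs2 ?A2)"
      by (rule hoare_dp_swap[OF inv1 fit2(1) x q(1)])
    have h: "hoare N (90 * 3 ^ length zs3 + 30) (dp_globals I vp x ?zs2 ?A2) merge_com
        (dp_globals I vp x ?zs4 (merge_table ?A2))"
      using hoare_merge[OF b2(1)[unfolded cd pw], of I]
      unfolding dp_globals_def cd pw fst_conv snd_conv c'(2) a'(2) .
    have 5: "hoare N (10 * 3 ^ K + 30) (dp_globals I vp x ?zs2 ?A2) merge_com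
        (dp_state I vp X (open_darts zs - {x, twin x}) (fst x))"
    proof (rule hoare_conseq[OF h])
      have "open_darts ?zs4 = open_darts zs - {x, twin x}"
        using mg(2) unfolding zs3[symmetric] od2 by (simp add: insert_commute)
      then show "dp_state I vp X (open_darts zs - {x, twin x}) (fst x) s"
        if "dp_globals I vp x ?zs4 (merge_table ?A2) s" for s
        using dp_stateI[OF mg(1) _ x refl that] by blast
      show "90 * 3 ^ length zs3 + 30 \<le> 10 * 3 ^ K + (30::nat)"
        using b2(3) unfolding pw by linarith
    qed
    note h = hoare_Seq[OF 1 hoare_Seq[OF 2 hoare_Seq[OF 3 hoare_Seq[OF 4 5 order_refl] order_refl]
        order_refl] order_refl]
    show ?thesis unfolding partners_com_def
    proof (rule hoare_If_True[OF _ h])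
      fix s assume "dp_globals I vp x zs A s \<and> found_at ?m ?p s"
      then show "fst s 10 < fst s 6 \<and> fst s 6 \<le> N" using R6[of s] False p mN by simp
    qed simp
  qed
qed


text \<open>The two ways in which a search can fail are exactly the cases in which
  \<open>glue_dart\<close> leaves \<open>D\<close> as it is.\<close>

lemma hoare_glue:
  assumes fit: "fits N K vp D" and inp: "input_ok I vs" and t: "t < n" "f < 4" "g < 4" "f \<noteq> g"
  shows "hoare N (400 * 3 ^ K + 400) (dp_state I vp X D t) (glue_com f g)
    (dp_state I vp X (glue_dart (t, f, g) D) t)"
  unfolding dp_state_def[of I vp X D t]
proof (intro hoare_ex)
  fix zs Ks A d d'
  define x where "x = (t, f, g)"
  have x: "x \<in> darts" "fst x = t" using t by (auto simp: x_def darts_in_def)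
  let ?m = "length zs" and ?G = "dp_globals I vp x zs A"
  let ?P = "\<lambda>s. ram_state n I vp t d d' (codes zs) (3 ^ ?m) A s"
  let ?Q = "dp_state I vp X (glue_dart x D) t"
  have "hoare N (400 * 3 ^ K + 400) ?P (glue_com f g) ?Q"
    if inv: "dp_inv X zs Ks A" and D: "open_darts zs = D" and d: "d < 16 * n" "d' < 16 * n"
  proof -
    have fit': "fits N K vp (open_darts zs)" using fit D by simp
    note b = dp_bounds[OF inv fit' t(1) d]
    have N: "2000 + 200 * n \<le> N" using fit by (simp add: fits_def)
    obtain u p where up: "glue T t f = Some (u, p)" "u < n" "p permutes {..<4}" "p f < 4"
      using glueE[OF t(1,2)] by metis
    have pg: "p g < 4" using permutes_in_image[OF up(3), of g] t(3) by simp
    have tw: "twin x = (u, p f, p g)" using up by (simp add: x_def twin_def)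
    have I: "I (1 + 20 * t + 5 * f) = u" "I (2 + 20 * t + 5 * f + f) = p f"
        "I (2 + 20 * t + 5 * f + g) = p g"
      using inp t up(1) unfolding input_ok_def by blast+
    have 1: "hoare N 21 ?P (Basic (load_codes f g)) ?G"
      using hoare_load_codes[OF N t(1-3) I up(2,4) pg, of vp d d' "codes zs" "3 ^ ?m" A]
      unfolding dp_globals_def tw x(2) unfolding x_def .
    let ?p = "first_pos (dart_code x) (codes zs)"
    have 2: "hoare N (24 * 3 ^ K + 10) ?G (find_com 12) (\<lambda>s. ?G s \<and> found_at ?m ?p s)"
      by (rule hoare_dp_find[OF inv fit' x(1)]) simp
    note fp = first_pos_codes[OF inv x(1)]
    have reg: "fst s 9 = 0 \<and> fst s 10 = 2 * (length ys - q)"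
      if "dp_globals I vp x ys B s \<and> found_at (length ys) q s" for s ys B q
      using that by (cases s) (auto simp: dp_globals_def found_at_def globals_def)
    have mN: "2 * ?m \<le> N" using b(1) by (simp add: bounds_def)
    have 3: "hoare N (320 * 3 ^ K + 300) (\<lambda>s. ?G s \<and> found_at ?m ?p s)
       (If_Less 9 10
         (swap_com ;; find_com 13 ;;
          If_Less 9 10
            partners_com
            (Basic []))
         (Basic [])) ?Q"
    proof (cases "x \<in> D")
      case False
      then have p: "?p = ?m" using fp(2) D by simp
      have Q: "?Q = dp_state I vp X D t" using False by (simp add: glue_dart_def)
      show ?thesis
      proof (rule hoare_If_False)
        show "\<not> fst s 9 < fst s 10 \<and> fst s 9 \<le> N" if "?G s \<and> found_at ?m ?p s" for s
          using reg[OF that] p by simp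
        show "hoare N 0 (\<lambda>s. ?G s \<and> found_at ?m ?p s) (Basic []) ?Q"
          unfolding Q using dp_stateI[OF inv D x(1,2)] by (intro hoare_skip) blast
      qed simp
    next
      case True
      then obtain P a c where p: "?p < ?m" "zs ! ?p = (P, a, c)" "x \<in> {a, c}"
        using fp(1) D by blast
      let ?zs = "swap_head ?p zs" and ?A = "swap_table ?p A"
      note inv1 = dp_inv_swap_table[OF inv p(1)]
      have od1: "open_darts ?zs = D" using p(1) D by simp
      then have fit1: "fits N K vp (open_darts ?zs)" using fit by simp
      have pos: "0 < ?m" using p(1) by linarith
      have "?zs ! 0 = (P, a, c)" using nth_swap_head[OF p(1) pos] p(2) by simp
      moreover have "0 < length ?zs" using pos by simp
      ultimately obtain zs' where zs': "?zs = (P, a, c) # zs'" by (cases ?zs) auto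
      let ?q = "first_pos (dart_code (twin x)) (codes ?zs)"
      let ?G1 = "dp_globals I vp x ?zs ?A"
      note fq = first_pos_codes[OF inv1 twin_in[OF x(1)]]
      have a: "hoare N (30 * 3 ^ K + 30) (\<lambda>s. ?G s \<and> found_at ?m ?p s) swap_com ?G1"
        by (rule hoare_dp_swap[OF inv fit' x(1) p(1)])
      have b: "hoare N (24 * 3 ^ K + 10) ?G1 (find_com 13) (\<lambda>s. ?G1 s \<and> found_at (length ?zs) ?q s)"
        by (rule hoare_dp_find[OF inv1 fit1 x(1)]) simp
      have c: "hoare N (230 * 3 ^ K + 202) (\<lambda>s. ?G1 s \<and> found_at (length ?zs) ?q s)
          (If_Less 9 10
            partners_com
            (Basic [])) ?Q"
      proof (cases "twin x \<in> D")
        case False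
        then have q: "?q = length ?zs" using fq(2) od1 by simp
        have Q: "?Q = dp_state I vp X D t" using False by (simp add: glue_dart_def)
        show ?thesis
        proof (rule hoare_If_False)
          show "\<not> fst s 9 < fst s 10 \<and> fst s 9 \<le> N" if "?G1 s \<and> found_at (length ?zs) ?q s" for s
            using reg[OF that] q by simp
          show "hoare N 0 (\<lambda>s. ?G1 s \<and> found_at (length ?zs) ?q s) (Basic []) ?Q"
            unfolding Q using dp_stateI[OF inv1 od1 x(1,2)] by (intro hoare_skip) blast
        qed simp
      next
        case True
        have Q: "?Q = dp_state I vp X (D - {x, twin x}) t"
          using True \<open>x \<in> D\<close> by (simp add: glue_dart_def)
        have q: "?q < length ?zs" using fq(1) True od1 by blast
        show ?thesis
        proof (rule hoare_If_True)
          show "fst s 9 < fst s 10 \<and> fst s 10 \<le> N" if "?G1 s \<and> found_at (length ?zs) ?q s" for s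
            using reg[OF that] q mN by simp
          show "hoare N (230 * 3 ^ K + 200) (\<lambda>s. ?G1 s \<and> found_at (length ?zs) ?q s)
            partners_com ?Q"
            using hoare_glue_partners[OF inv1 fit1 x(1) zs' p(3)] True
            unfolding Q od1 x(2) by blast
        qed simp
      qed
      show ?thesis
      proof (rule hoare_If_True[OF _ hoare_Seq[OF a hoare_Seq[OF b c order_refl] order_refl]])
        show "fst s 9 < fst s 10 \<and> fst s 10 \<le> N" if "?G s \<and> found_at ?m ?p s" for s
          using reg[OF that] p mN by simp
      qed simp
    qed
    show ?thesis unfolding glue_com_def
      by (rule hoare_Seq[OF 1 hoare_Seq[OF 2 3 order_refl]]) simp
  qed
  then show "hoare N (400 * 3 ^ K + 400) (\<lambda>s. dp_inv X zs Ks A \<and> open_darts zs = D \<and>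
      d < 16 * n \<and> d' < 16 * n \<and> ?P s) (glue_com f g) (dp_state I vp X (glue_dart (t, f, g) D) t)"
    unfolding x_def by (intro hoare_pre) blast
qed

end

section \<open>The program for all tetrahedra\<close>

text \<open>Later pairs are pushed first, so that the first pair ends on top, at digit 0.\<close>

definition push_all :: "(nat \<times> nat) list \<Rightarrow> com" where
  "push_all ps = foldr (\<lambda>(f, g) c. c ;; Basic (push_pair f g)) ps (Basic [])"

definition glue_all :: "(nat \<times> nat) list \<Rightarrow> com" where
  "glue_all ps = foldr (\<lambda>(f, g) c. glue_com f g ;; c) ps (Basic [])"

lemma hoare_push_all:
  assumes "2000 + 200 * n + 10 * Z \<le> N" "t < n" "2 * (length cs + length ps) \<le> 16 * n"
    "\<And>f g. (f, g) \<in> set ps \<Longrightarrow> f < 4 \<and> g < 4"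
  shows "hoare N (13 * length ps) (\<lambda>s. ram_state n I vp t d d' cs Z A s) (push_all ps)
    (\<lambda>s. ram_state n I vp t d d' (map (\<lambda>(f, g). (dart_code (t, f, g), dart_code (t, g, f))) ps @ cs) Z A s)"
  using assms(3,4)
proof (induction ps)
  case Nil
  then show ?case by (simp add: push_all_def hoare_skip)
next
  case (Cons fg ps)
  let ?c = "map (\<lambda>(f, g). (dart_code (t, f, g), dart_code (t, g, f))) ps"
  obtain f g where fg: "fg = (f, g)" by (cases fg)
  have 1: "hoare N (13 * length ps) (\<lambda>s. ram_state n I vp t d d' cs Z A s) (push_all ps)
    (\<lambda>s. ram_state n I vp t d d' (?c @ cs) Z A s)"
    by (rule Cons.IH) (use Cons.prems in auto)
  have e: "push_all (fg # ps) = push_all ps ;; Basic (push_pair f g)" by (simp add: push_all_def fg)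
  have 2: "hoare N 13
    (\<lambda>s. ram_state n I vp t d d' (?c @ cs) Z A s) (Basic (push_pair f g))
    (\<lambda>s. ram_state n I vp t d d' ((dart_code (t, f, g), dart_code (t, g, f)) #
      ?c @ cs) Z A s)"
    by (rule hoare_push_pair) (use assms(1,2) Cons.prems fg in auto)
  have "hoare N (13 * length (fg # ps)) (\<lambda>s. ram_state n I vp t d d' cs Z A s)
      (push_all (fg # ps))
    (\<lambda>s. ram_state n I vp t d d' ((dart_code (t, f, g), dart_code (t, g, f)) #
      ?c @ cs) Z A s)"
    unfolding e by (rule hoare_Seq[OF 1 2]) simp
  then show ?case by (simp only: fg list.map case_prod_conv append_Cons)
qed

definition next_node :: "instr list" where
  "next_node = [Load 5 4, Const 15 1, Arith Add 4 4 15]"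

definition tet_com :: com where
  "tet_com = Basic next_node ;; add_table_com ;; push_all tet_pairs ;;
     glue_all (tet_pairs @ map prod.swap tet_pairs)"

text \<open>Register 15 is still 1 at the last instruction, which makes it the only table entry:
  with no tetrahedron treated, the empty vector of counts is attainable.\<close>

definition init_block :: "instr list" where
  "init_block =
     [Const 9 0, Load 1 9, Const 15 21, Arith Mul 2 1 15, Const 15 1, Arith Add 2 2 15,
      Const 15 37, Arith Mul 3 1 15, Const 15 1, Arith Add 3 3 15,
      Const 15 20, Arith Mul 4 1 15, Const 15 1, Arith Add 4 4 15,
      Const 6 0, Const 7 1, Store 3 15]"

text \<open>The layout is the last part of the input, directly below the stack, so the loop is over
  when its address reaches the base of the stack. The one remaining table entry is the
  answer.\<close>

definition taut_com :: com where
  "taut_com = Basic init_block ;; While_Less 4 2 tet_com ;; Basic [Load 0 3]"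

context closed_triangulation
begin

lemma hoare_glue_all:
  assumes "fits N K vp D" "D \<subseteq> darts" and inp: "input_ok I vs" and t: "t < n"
    and ps: "\<And>f g. (f, g) \<in> set ps \<Longrightarrow> f < 4 \<and> g < 4 \<and> f \<noteq> g"
  shows "hoare N (length ps * (400 * 3 ^ K + 400)) (dp_state I vp X D t) (glue_all ps)
    (dp_state I vp X (fold glue_dart (map (\<lambda>(f, g). (t, f, g)) ps) D) t)"
  using assms(1,2) ps
proof (induction ps arbitrary: D)
  case Nil
  then show ?case by (simp add: glue_all_def hoare_skip)
next
  case (Cons fg ps)
  obtain f g where fg: "fg = (f, g)" by (cases fg)
  have sub: "glue_dart (t, f, g) D \<subseteq> D" by (auto simp: glue_dart_def)
  have "finite D" using Cons.prems(2) card_darts_le(1) by (rule finite_subset)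
  then have "card (glue_dart (t, f, g) D) \<le> card D" using sub by (rule card_mono)
  then have fit: "fits N K vp (glue_dart (t, f, g) D)" using Cons.prems(1) by (auto simp: fits_def)
  have 1: "hoare N (400 * 3 ^ K + 400) (dp_state I vp X D t) (glue_com f g)
      (dp_state I vp X (glue_dart (t, f, g) D) t)"
    by (rule hoare_glue[OF Cons.prems(1) inp t]) (use Cons.prems(3)[of f g] fg in auto)
  have 2: "hoare N (length ps * (400 * 3 ^ K + 400)) (dp_state I vp X (glue_dart (t, f, g) D) t)
      (glue_all ps) (dp_state I vp X
        (fold glue_dart (map (\<lambda>(f, g). (t, f, g)) ps) (glue_dart (t, f, g) D)) t)"
    by (rule Cons.IH[OF fit]) (use sub Cons.prems in auto)
  have e: "glue_all (fg # ps) = glue_com f g ;; glue_all ps" by (simp add: glue_all_def fg)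
  have "hoare N (length (fg # ps) * (400 * 3 ^ K + 400)) (dp_state I vp X D t) (glue_all (fg # ps))
      (dp_state I vp X (fold glue_dart (map (\<lambda>(f, g). (t, f, g)) ps) (glue_dart (t, f, g) D)) t)"
    unfolding e by (rule hoare_Seq[OF 1 2]) simp
  then show ?case by (simp add: fg)
qed


lemma frontier_all: "frontier {..<n} = {}"
proof -
  have "fst (twin d) < n" if "d \<in> darts" for d using twin_in[OF that] by (auto simp: darts_in_def)
  then show ?thesis by (auto simp: frontier_def)
qed

lemma frontier_empty: "frontier {} = {}"
  by (simp add: frontier_def)

text \<open>Twelve gluings with 400 * 3^6 steps per unit of 3^K account for 3499200; the rest covers
  the attachment of the tetrahedron and lower terms.\<close>

abbreviation tet_steps :: "nat \<Rightarrow> nat" where "tet_steps K \<equiv> 4000000 * 3 ^ K"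

lemma hoare_tet:
  assumes N: "2000 + 200 * n + 10 * 3 ^ (K + 6) \<le> N" and inp: "input_ok I vs"
    and vs: "distinct vs" "set vs = {..<n}" and i: "i < n"
    and card: "card (frontier (set (take i vs))) \<le> 2 * K + 1"
    and t0: "t0 < n"
  shows "hoare N (tet_steps K)
    (dp_state I (1 + 20 * n + i) (set (take i vs)) (frontier (set (take i vs))) t0) tet_com
    (dp_state I (1 + 20 * n + Suc i) (set (take (Suc i) vs)) (frontier (set (take (Suc i) vs))) (vs ! i))"
proof -
  define X t where "X = set (take i vs)" and "t = vs ! i"
  have len: "length vs = n" using vs distinct_card[OF vs(1)] by simp
  have t: "t < n" using nth_mem[of i vs] i len vs(2) by (auto simp: t_def)
  have tX: "t \<notin> X" unfolding t_def X_def
    using vs(1) i len by (metis (no_types, lifting) distinct_take id_take_nth_drop not_distinct_conv_prefix take_Suc_conv_app_nth distinct_append disjoint_iff list.set_intros(1))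
  have X': "set (take (Suc i) vs) = insert t X"
    unfolding X_def t_def using i len by (simp add: take_Suc_conv_app_nth)
  have XN: "X \<subseteq> {..<n}" unfolding X_def using vs(2) set_take_subset[of i vs] by simp
  let ?vp = "1 + 20 * n + i" and ?vp' = "1 + 20 * n + Suc i"
  have "hoare N (tet_steps K)
      (\<lambda>s. ram_state n I ?vp t0 d d' (codes zs) (3 ^ length zs) A s) tet_com
      (dp_state I ?vp' (insert t X) (frontier (insert t X)) t)"
    if inv: "dp_inv X zs Ks A" and D: "open_darts zs = frontier X" and d: "d < 16 * n" "d' < 16 * n"
    for zs Ks A d d'
  proof -
    let ?m = "length zs" and ?zs = "tet_classes t @ zs"
    \<comment> \<open>Open darts come in pairs, so even the odd bound gives at most \<open>K\<close>
      open classes.\<close>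
    have "2 * ?m \<le> 2 * K + 1" using dp_inv_open_darts(3)[OF inv] D card by (simp add: X_def)
    then have mK: "?m \<le> K" by simp
    have pw: "(3::nat) ^ ?m \<le> 3 ^ K" using mK by (intro power_increasing) auto
    have p6: "(3::nat) ^ (K + 6) = 729 * 3 ^ K" by (simp add: power_add)
    have N1: "2000 + 200 * n + 10 * 3 ^ K \<le> N" "2000 + 200 * n + 10 * (729 * 3 ^ ?m) \<le> N"
      using N pw unfolding p6 by linarith+
    have fit: "fits N K ?vp' (open_darts zs)"
      using N1 dp_inv_open_darts(3)[OF inv] mK i by (simp add: fits_def stack_base_def)
    note b = dp_bounds[OF inv fit t d]
    note inv' = dp_inv_add[OF inv t tX]
    have od': "open_darts ?zs = darts_in {t} \<union> frontier X" by (simp add: open_darts_tet_classes D)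
    have len6: "length (tet_classes t) = 6" by (simp add: tet_classes_def tet_pairs_def)
    \<comment> \<open>Six classes have been added and nothing is glued yet: the peak of stack and
      table.\<close>
    have fit': "fits N (K + 6) ?vp' (open_darts ?zs)"
      using N dp_inv_open_darts(3)[OF inv'] mK i len6 by (simp add: fits_def stack_base_def)
    note b' = dp_bounds[OF inv' fit' t d]
    have 1: "hoare N 3 (\<lambda>s. ram_state n I ?vp t0 d d' (codes zs) (3 ^ ?m) A s)
        (Basic next_node) (\<lambda>s. ram_state n I ?vp' t d d' (codes zs) (3 ^ ?m) A s)"
    proof (rule hoare_Basic)
      fix R M assume a: "ram_state n I ?vp t0 d d' (codes zs) (3 ^ ?m) A (R, M)"
      then have g: "globals n I ?vp t0 d d' (codes zs) (R, M)" by simp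
      have R: "R 4 = ?vp" using g by (rule globalsD)
      have "?vp < stack_base n" using i by (simp add: stack_base_def)
      then have M: "M ?vp = t" using g inp i by (auto simp: globals_def input_ok_def t_def)
      have le: "?vp \<le> N" "t \<le> N" "1 \<le> N" using N1 i t by auto
      have ok: "block_ok N next_node (R, M)" using R M le by (simp add: next_node_def)
      have eff: "block_eff next_node (R, M) = (R(5 := t, 15 := 1, 4 := ?vp'), M)"
        using R M by (simp add: next_node_def)
      show "block_ok N next_node (R, M) \<and>
          globals n I ?vp' t d d' (codes zs) (block_eff next_node (R, M)) \<and>
          table n (3 ^ ?m) A (block_eff next_node (R, M))"
        using ok a unfolding eff by (simp add: globals_def table_def)
    qed (simp add: next_node_def)
    have 2: "hoare N (729 * 40 * 3 ^ ?m + 10)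
        (\<lambda>s. ram_state n I ?vp' t d d' (codes zs) (3 ^ ?m) A s) add_table_com
        (\<lambda>s. ram_state n I ?vp' t d d' (codes zs) (729 * 3 ^ ?m) (add_table A) s)"
      by (rule hoare_add_table[OF b(1) N1(2)])
    have c: "codes ?zs = map (\<lambda>(f, g). (dart_code (t, f, g), dart_code (t, g, f))) tet_pairs @ codes zs"
      by (simp add: codes_def tet_classes_def tet_pairs_def)
    have "2 * length ?zs \<le> 16 * n" using b'(1) by (simp add: bounds_def)
    then have l: "2 * (length (codes zs) + length tet_pairs) \<le> 16 * n"
      using len6 by (simp add: tet_pairs_def)
    have "hoare N (13 * length tet_pairs)
        (\<lambda>s. ram_state n I ?vp' t d d' (codes zs) (729 * 3 ^ ?m) (add_table A) s)
        (push_all tet_pairs)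
        (\<lambda>s. ram_state n I ?vp' t d d' (codes ?zs) (729 * 3 ^ ?m) (add_table A) s)"
      unfolding c by (rule hoare_push_all[OF N1(2) t l]) (auto simp: tet_pairs_def)
    then have 3: "hoare N 78
        (\<lambda>s. ram_state n I ?vp' t d d' (codes zs) (729 * 3 ^ ?m) (add_table A) s)
        (push_all tet_pairs) (dp_state I ?vp' (insert t X) (darts_in {t} \<union> frontier X) t)"
    proof (rule hoare_conseq)
      fix s assume s: "ram_state n I ?vp' t d d' (codes ?zs) (729 * 3 ^ ?m) (add_table A) s"
      have "(3::nat) ^ length ?zs = 729 * 3 ^ ?m" by (simp add: len6 power_add)
      then show "dp_state I ?vp' (insert t X) (darts_in {t} \<union> frontier X) t s"
        unfolding dp_state_def using inv' od' d s
        by (intro exI[of _ ?zs] exI[of _ Ks] exI[of _ "add_table A"] exI[of _ d] exI[of _ d'] conjI)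
          simp_all
    qed (auto simp: tet_pairs_def)
    have D': "darts_in {t} \<union> frontier X \<subseteq> darts"
      using dp_inv_open_darts(1)[OF inv'] od' by simp
    have "hoare N (length (tet_pairs @ map prod.swap tet_pairs) * (400 * 3 ^ (K + 6) + 400))
        (dp_state I ?vp' (insert t X) (darts_in {t} \<union> frontier X) t)
        (glue_all (tet_pairs @ map prod.swap tet_pairs))
        (dp_state I ?vp' (insert t X) (fold glue_dart
          (map (\<lambda>(f, g). (t, f, g)) (tet_pairs @ map prod.swap tet_pairs)) (darts_in {t} \<union> frontier X)) t)"
      by (rule hoare_glue_all[OF fit'[unfolded od'] D' inp t]) (auto simp: tet_pairs_def)
    then have 4: "hoare N (12 * (400 * 3 ^ (K + 6) + 400))
        (dp_state I ?vp' (insert t X) (darts_in {t} \<union> frontier X) t)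
        (glue_all (tet_pairs @ map prod.swap tet_pairs))
        (dp_state I ?vp' (insert t X) (frontier (insert t X)) t)"
      unfolding tet_darts_def[symmetric] frontier_insert[OF XN t tX]
      by (rule hoare_conseq) (auto simp: tet_pairs_def)
    have "3 + (729 * 40 * x + 10 + (78 + 12 * (400 * (729 * y) + 400))) \<le> 4000000 * y"
      if "x \<le> y" "1 \<le> y" for x y :: nat using that by simp
    from this[OF pw] have "3 + (729 * 40 * 3 ^ ?m + 10 + (78 + 12 * (400 * 3 ^ (K + 6) + 400))) \<le> tet_steps K"
      unfolding p6 by simp
    then show ?thesis unfolding tet_com_def
      by (rule hoare_Seq[OF 1 hoare_Seq[OF 2 hoare_Seq[OF 3 4 order_refl] order_refl]])
  qed
  then show ?thesis unfolding X' X_def[symmetric] t_def[symmetric]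
    unfolding dp_state_def[of I ?vp X "frontier X" t0]
    by (intro hoare_ex hoare_pre) blast
qed

lemma hoare_taut:
  assumes N: "2000 + 200 * n + 10 * 3 ^ (K + 6) \<le> N" and inp: "input_ok I vs"
    and vs: "distinct vs" "set vs = {..<n}"
    and card: "\<And>i. i < n \<Longrightarrow> card (frontier (set (take i vs))) \<le> 2 * K + 1"
  shows "hoare N (n * (tet_steps K + 2) + 20) (\<lambda>s. s = (\<lambda>_. 0, I)) taut_com
    (\<lambda>s. fst s 0 = (if \<exists>m. taut_angle_structure T m then 1 else 0))"
proof -
  have n: "0 < n" using tri by (simp add: triangulation_def)
  have len: "length vs = n" using vs distinct_card[OF vs(1)] by simp
  let ?I = "\<lambda>i s. \<exists>t. t < n \<and>
    dp_state I (1 + 20 * n + i) (set (take i vs)) (frontier (set (take i vs))) t s"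
  have N1: "2000 + 200 * n \<le> N" using N by simp
  have 1: "hoare N 17 (\<lambda>s. s = (\<lambda>_. 0, I)) (Basic init_block) (?I 0)"
  proof (rule hoare_Basic)
    fix R M :: "nat \<Rightarrow> nat" assume "(R, M) = (\<lambda>_. 0, I)"
    then have RM: "R = (\<lambda>_. 0)" "M = I" by auto
    have I0: "I 0 = n" using inp by (simp add: input_ok_def)
    have ok: "block_ok N init_block (R, M)"
      using N1 by (simp add: init_block_def RM I0)
    obtain R' where R': "block_eff init_block (R, M) = (R', I(table_base n := 1))"
        "R' 1 = n" "R' 2 = stack_base n" "R' 3 = table_base n" "R' 4 = 1 + 20 * n" "R' 5 = 0" "R' 6 = 0"
        "R' 7 = 1" "R' 9 = 0" "R' 12 = 0" "R' 13 = 0"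
      by (simp add: init_block_def RM I0 stack_base_def table_base_def mult.commute[of n])
    have "globals n I (1 + 20 * n + 0) 0 0 0 (codes []) (R', I(table_base n := 1))"
      using R' by (simp add: globals_def codes_def stack_base_def table_base_def)
    moreover have "table n (3 ^ length ([] :: (_ \<times> dart \<times> dart) list)) (\<lambda>_. 1) (R', I(table_base n := 1))"
      using R' by (simp add: table_def)
    ultimately have "dp_state I (1 + 20 * n + 0) {} {} 0 (R', I(table_base n := 1))"
      unfolding dp_state_def using dp_inv_init n
      by (intro exI[of _ "[]"] exI[of _ "{}"] exI[of _ "\<lambda>_. 1"] exI[of _ 0] conjI)
        (simp_all add: open_darts_def)
    then show "block_ok N init_block (R, M) \<and> ?I 0 (block_eff init_block (R, M))"
      using ok n unfolding R'(1) by (auto simp: frontier_empty)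
  qed (simp add: init_block_def)
  have 2: "hoare N (n * (tet_steps K + 2) + 2) (?I 0) (While_Less 4 2 tet_com) (?I n)"
  proof (rule hoare_up[where Inv = ?I and j = "tet_steps K"])
    fix i assume i: "i < n"
    have v: "vs ! i < n" using nth_mem[of i vs] i len vs(2) by auto
    show "hoare N (tet_steps K) (?I i) tet_com (?I (Suc i))"
    proof (intro hoare_ex hoare_pre)
      fix t0 assume "t0 < n"
      from hoare_tet[OF N inp vs i card[OF i] this]
      show "hoare N (tet_steps K)
        (dp_state I (1 + 20 * n + i) (set (take i vs)) (frontier (set (take i vs))) t0) tet_com (?I (Suc i))"
        by (rule hoare_conseq) (use v in auto)
    qed
  next
    fix i s assume "i \<le> n" "?I i s"
    then obtain t cs d d' where "globals n I (1 + 20 * n + i) t d d' cs s"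
      unfolding dp_state_def by blast
    then have "fst s 4 = 1 + 20 * n + i" "fst s 2 = stack_base n"
      by (cases s; simp add: globals_def)+
    then show "(fst s 4 < fst s 2 \<longleftrightarrow> i < n) \<and> fst s 4 \<le> N \<and> fst s 2 \<le> N"
      using N1 \<open>i \<le> n\<close> by (auto simp: stack_base_def)
  qed simp
  have 3: "hoare N 1 (?I n) (Basic [Load 0 3])
      (\<lambda>s. fst s 0 = (if \<exists>m. taut_angle_structure T m then 1 else 0))"
  proof (rule hoare_Basic)
    fix R M assume "?I n (R, M)"
    then obtain zs Ks A t d d' where s: "dp_inv {..<n} zs Ks A" "open_darts zs = {}"
        "globals n I (1 + 20 * n + n) t d d' (codes zs) (R, M)" "table n (3 ^ length zs) A (R, M)"
      using len vs(2) unfolding dp_state_def by (auto simp: frontier_all)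
    \<comment> \<open>Without open darts the stack is empty, and the table has the single index
      0.\<close>
    have zs: "zs = []" using dp_inv_open_darts(3)[OF s(1)] s(2) by simp
    have "M (table_base n) = A 0" "R 3 = table_base n"
      using s(3,4) by (auto simp: zs table_def globals_def)
    moreover have A0: "A 0 = (if \<exists>m. taut_angle_structure T m then 1 else 0)"
      using dp_inv_final s(1) zs by simp
    moreover have "A 0 \<le> 1" unfolding A0 by simp
    ultimately show "block_ok N [Load 0 3] (R, M) \<and> fst (block_eff [Load 0 3] (R, M)) 0 =
        (if \<exists>m. taut_angle_structure T m then 1 else 0)"
      using N1 n by (simp add: table_base_def)
  qed simp
  show ?thesis unfolding taut_com_def
    by (rule hoare_Seq[OF 1 hoare_Seq[OF 2 3 order_refl]]) simp
qed

end

section \<open>Layout of the input\<close>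

lemma nth_concat_const:
  assumes "\<And>i. i < k \<Longrightarrow> length (f i) = c" "i < k" "j < c"
  shows "concat (map f [0..<k]) ! (c * i + j) = f i ! j"
    and "length (concat (map f [0..<k])) = c * k"
proof -
  have len: "length (concat (map f [0..<m])) = c * m" if "m \<le> k" for m
    using that assms(1) by (induction m) auto
  show "length (concat (map f [0..<k])) = c * k" by (rule len) simp
  show "concat (map f [0..<k]) ! (c * i + j) = f i ! j"
    using assms(2,1)
  proof (induction k)
    case (Suc m)
    have l: "length (concat (map f [0..<m])) = c * m"
      using Suc.prems(2) by (induction m) auto
    show ?case
    proof (cases "i < m")
      case True
      then have "c * i + j < c * m"
        using assms(3) mult_le_mono2[of "Suc i" m c] by simp
      then show ?thesis using Suc.IH[OF True] Suc.prems(2) l by (simp add: nth_append)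
    next
      case False
      then have "i = m" using Suc.prems(1) by simp
      then show ?thesis using l by (simp add: nth_append)
    qed
  qed simp
qed

lemma length_encode_face: "length (encode_face T t f) = 5"
  by (simp add: encode_face_def split: option.splits)

context closed_triangulation
begin

abbreviation initial_mem :: "nat list \<Rightarrow> nat \<Rightarrow> nat" where
  "initial_mem vs \<equiv> \<lambda>a. if a < length (encode_input T vs) then encode_input T vs ! a else 0"

lemma input_ok_encode:
  assumes "length vs = n"
  shows "input_ok (initial_mem vs) vs"
proof -
  let ?F = "\<lambda>t. concat (map (encode_face T t) [0..<4])"
  let ?C = "concat (map ?F [0..<n])"
  have F: "length (?F t) = 20" "f < 4 \<Longrightarrow> j < 5 \<Longrightarrow> ?F t ! (5 * f + j) = encode_face T t f ! j" for t f j
    using nth_concat_const[of 4 "encode_face T t" 5 f j] nth_concat_const(2)[of 4 "encode_face T t" 5 0 0]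
    by (simp_all add: length_encode_face)
  have n: "0 < n" using tri by (simp add: triangulation_def)
  have C: "length ?C = 20 * n" "t < n \<Longrightarrow> j < 20 \<Longrightarrow> ?C ! (20 * t + j) = ?F t ! j" for t j
    using nth_concat_const(1)[of n ?F 20 t j] nth_concat_const(2)[of n ?F 20 0 0] F(1) n by simp_all
  have e: "encode_input T vs = n # ?C @ vs" by (simp add: encode_input_def encode_tri_def)
  have len: "length (encode_input T vs) = 1 + 21 * n" using C(1) assms unfolding e by simp
  have face: "initial_mem vs (1 + 20 * t + 5 * f + j) = encode_face T t f ! j"
    if "t < n" "f < 4" "j < 5" for t f j
  proof -
    have lt: "5 * f + j < 20" "20 * t + (5 * f + j) < 20 * n" using that by auto
    have "encode_input T vs ! (1 + 20 * t + 5 * f + j) = (?C @ vs) ! (20 * t + (5 * f + j))"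
      unfolding e by (simp add: add.assoc)
    also have "\<dots> = ?C ! (20 * t + (5 * f + j))" using lt C(1) by (simp add: nth_append)
    also have "\<dots> = encode_face T t f ! j" unfolding C(2)[OF that(1) lt(1)] by (rule F(2)[OF that(2,3)])
    finally show ?thesis using lt unfolding len by simp
  qed
  show ?thesis unfolding input_ok_def
  proof (intro conjI allI impI)
    show "initial_mem vs 0 = n" unfolding len by (simp add: e)
  next
    fix i assume i: "i < n"
    have "encode_input T vs ! (1 + 20 * n + i) = (?C @ vs) ! (20 * n + i)" unfolding e by simp
    also have "\<dots> = vs ! i" using C(1) by (simp add: nth_append)
    finally show "initial_mem vs (1 + 20 * n + i) = vs ! i" using i unfolding len by simp
  next
    fix t f u p assume a: "t < n" "f < 4" "glue T t f = Some (u, p)"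
    show "initial_mem vs (1 + 20 * t + 5 * f) = u"
      using face[OF a(1,2), of 0] a(3) unfolding add_0_right by (simp add: encode_face_def)
    fix v :: nat assume v: "v < 4"
    then have "initial_mem vs (1 + 20 * t + 5 * f + Suc v) = encode_face T t f ! Suc v"
      by (intro face a) simp
    also have "\<dots> = p v"
    proof -
      have "v = 0 \<or> v = 1 \<or> v = 2 \<or> v = 3" using v by auto
      then show ?thesis using a(3) by (elim disjE) (simp_all add: encode_face_def)
    qed
    moreover have "1 + 20 * t + 5 * f + Suc v = 2 + 20 * t + 5 * f + v" by simp
    ultimately show "initial_mem vs (2 + 20 * t + 5 * f + v) = p v" by (simp only:)
  qed
qed

end

section \<open>Length of the operands and the final estimate\<close>

text \<open>As 3^K is at most 4^K, each summand is bounded by a multiple of the product of 2^w and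
  2^(2K), where w is the word size; this gives at most 14 + w + 2K bits. Since w is at least 1,
  division by w turns the summand w into one word and does not increase the rest.\<close>

lemma num_words_bound:
  assumes "0 < n"
  shows "num_words (bit_length n) (2000 + 200 * n + 10 * 3 ^ (K + 6)) \<le> 15 + 2 * K"
proof -
  let ?w = "bit_length n"
  have w: "0 < ?w"
    using less_power_bit_length[of n] assms by (cases ?w) auto
  have n: "n \<le> 2 ^ ?w" using less_power_bit_length[of n] by simp
  have "(3::nat) ^ K \<le> 4 ^ K" by (rule power_mono) auto
  then have K: "(3::nat) ^ K \<le> 2 ^ (2 * K)" by (simp add: power_mult)
  let ?X = "(2::nat) ^ ?w" and ?Y = "(2::nat) ^ (2 * K)"
  \<comment> \<open>7290 is 10 * 3^6, and the coefficients on the left add up to 9490, which is less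
    than 2^14.\<close>
  have "2000 + 200 * x + 7290 * y < 16384 * z" if "1 \<le> z" "x \<le> z" "y \<le> z" for x y z :: nat
    using that by linarith
  moreover have a: "1 \<le> ?X" "1 \<le> ?Y" by simp_all
  ultimately have "2000 + 200 * ?X + 7290 * ?Y < 16384 * (?X * ?Y)"
    using mult_le_mono[OF a] mult_le_mono2[OF a(2), of ?X] mult_le_mono1[OF a(1), of ?Y]
    unfolding mult_1 mult_1_right by blast
  moreover have "2000 + 200 * n + 10 * 3 ^ (K + 6) \<le> 2000 + 200 * ?X + 7290 * ?Y"
    using n K by (simp add: power_add)
  moreover have "16384 * (?X * ?Y) = 2 ^ (14 + ?w + 2 * K)" by (simp add: power_add)
  ultimately have "bit_length (2000 + 200 * n + 10 * 3 ^ (K + 6)) \<le> 14 + ?w + 2 * K"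
    by (intro bit_length_le) linarith
  also have "\<dots> \<le> ?w * (15 + 2 * K)"
  proof -
    have "1 * (14 + 2 * K) \<le> ?w * (14 + 2 * K)" using w by (intro mult_le_mono1) simp
    then show ?thesis by (simp add: algebra_simps)
  qed
  finally have "real (bit_length (2000 + 200 * n + 10 * 3 ^ (K + 6))) \<le> real ?w * real (15 + 2 * K)"
    by (metis of_nat_le_iff of_nat_mult)
  then have "real (bit_length (2000 + 200 * n + 10 * 3 ^ (K + 6))) / real ?w \<le> real (15 + 2 * K)"
    using w by (simp add: divide_le_eq mult.commute)
  then show ?thesis unfolding num_words_def by (simp only: nat_le_iff ceiling_le_iff of_int_of_nat_eq)
qed

theorem theorem2:
  shows "\<exists>(P :: program) (C :: real). \<forall>(k :: nat) (T :: tri) (vs :: nat list).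
    0 < k \<longrightarrow>
    triangulation T \<longrightarrow> orientable T \<longrightarrow> no_boundary_faces T \<longrightarrow>
    cutwidth (face_pairing_graph T) \<le> k \<longrightarrow>
    layout (face_pairing_graph T) vs \<longrightarrow> layout_width_le (face_pairing_graph T) vs k \<longrightarrow>
    (\<exists>t. decides_in_time (bit_length (ntet T)) P (encode_input T vs)
           (\<exists>m. taut_angle_structure T m) t \<and>
         real t \<le> C * (real (ntet T) * real k * 3 powr (3 * real k / 2)))"
proof (intro exI[of _ "compile 0 taut_com"] exI[of _ "836004598 :: real"] allI impI)
  fix k :: nat and T :: tri and vs :: "nat list"
  assume k: "0 < k" and T: "triangulation T" "no_boundary_faces T"
    and lay: "layout (face_pairing_graph T) vs" "layout_width_le (face_pairing_graph T) vs k"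
  interpret closed_triangulation T by standard (rule T)+
  let ?n = "ntet T" and ?w = "bit_length (ntet T)" and ?P = "compile 0 taut_com"
  define K where "K = 3 * k div 2"
  define N where "N = 2000 + 200 * ?n + 10 * 3 ^ (K + 6)"
  have n: "0 < ?n" using T by (simp add: triangulation_def)
  have vs: "distinct vs" "set vs = {..<?n}" using lay(1) by (auto simp: layout_def face_pairing_graph_def)
  have len: "length vs = ?n" using vs distinct_card[OF vs(1)] by simp
  have w: "0 < ?w" using less_power_bit_length[of ?n] n by (cases ?w) auto
  \<comment> \<open>Three darts for each of at most \<open>k\<close> faces make
    \<open>3 * k\<close>, and this is at most \<open>2 * K + 1\<close>, since rounding down loses at
    most one half.\<close>
  have card: "card (frontier (set (take i vs))) \<le> 2 * K + 1" if "i < ?n" for i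
  proof -
    have "cut_width (face_pairing_graph T) (set (take i vs)) (set (drop i vs)) \<le> k"
      using lay(2) that len unfolding layout_width_le_def by simp
    then show ?thesis using card_frontier_le[OF vs, of i] unfolding K_def by linarith
  qed
  have "2000 + 200 * ?n + 10 * 3 ^ (K + 6) \<le> N" by (simp add: N_def)
  from hoare_taut[OF this input_ok_encode[OF len] vs card]
  obtain i s where s: "exec N taut_com (\<lambda>_. 0, initial_mem vs) i s"
      "i \<le> ?n * (tet_steps K + 2) + 20" "fst s 0 = (if \<exists>m. taut_angle_structure T m then 1 else 0)"
    unfolding hoare_def by blast
  have "code_at ?P 0 (compile 0 taut_com)" by (simp add: code_at_def)
  moreover have "runs ?w ?P (at_pc (0 + csize taut_com) s) 0 (at_pc (0 + csize taut_com) s)"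
    by (rule runs.halt) simp
  ultimately obtain t where t: "runs ?w ?P (at_pc 0 (\<lambda>_. 0, initial_mem vs)) (t + 0) (at_pc (0 + csize taut_com) s)"
      "t \<le> i * max_cost ?w N"
    using compile_correct[OF w s(1)] by blast
  have "decides_in_time ?w ?P (encode_input T vs) (\<exists>m. taut_angle_structure T m) t"
    unfolding decides_in_time_def initial_config_def using t(1) s(3)
    by (intro exI[of _ "at_pc (0 + csize taut_com) s"]) simp
  moreover have "real t \<le> 836004598 * (real ?n * real k * 3 powr (3 * real k / 2))"
  proof -
    \<comment> \<open>As \<open>k\<close> is at least 1, 16 + 3k is at most 19k, and 209 is 11 *
      19.\<close>
    have "max_cost ?w N \<le> 11 * (16 + 2 * K)"
      using num_words_bound[OF n, of K] unfolding max_cost_def N_def by simp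
    also have "\<dots> \<le> 209 * k"
    proof -
      have "2 * K \<le> 3 * k" by (simp add: K_def)
      then show ?thesis using k by simp
    qed
    finally have mc: "max_cost ?w N \<le> 209 * k" .
    \<comment> \<open>The additional 22 absorbs the terms \<open>2 * ?n\<close> and 20, as
      \<open>?n\<close> and 3^K are at least 1; the final constant is 4000022 * 209.\<close>
    have "?n * (tet_steps K + 2) + 20 \<le> ?n * (4000022 * 3 ^ K)"
    proof -
      have "(1::nat) \<le> 3 ^ K" by simp
      from mult_le_mono2[OF this, of ?n] have "?n \<le> ?n * 3 ^ K" unfolding mult_1_right .
      moreover have "?n * (tet_steps K + 2) + 20 = 4000000 * (?n * 3 ^ K) + 2 * ?n + 20"
        by (simp add: algebra_simps)
      moreover have "?n * (4000022 * 3 ^ K) = 4000022 * (?n * 3 ^ K)" by simp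
      ultimately show ?thesis using n by linarith
    qed
    then have "i \<le> ?n * (4000022 * 3 ^ K)" using s(2) by linarith
    then have "t \<le> ?n * (4000022 * 3 ^ K) * (209 * k)"
      using t(2) mult_le_mono[OF _ mc] by (meson order_trans)
    then have "real t \<le> real (?n * (4000022 * 3 ^ K) * (209 * k))" by (simp only: of_nat_le_iff)
    also have "\<dots> = 836004598 * (real ?n * real k * 3 ^ K)" by simp
    also have "\<dots> \<le> 836004598 * (real ?n * real k * 3 powr (3 * real k / 2))"
    proof -
      have "real K \<le> 3 * real k / 2" unfolding K_def by linarith
      then have "3 powr real K \<le> 3 powr (3 * real k / 2)" by simp
      then have "3 ^ K \<le> 3 powr (3 * real k / 2)" by (simp add: powr_realpow)
      then show ?thesis by (intro mult_left_mono) auto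
    qed
    finally show ?thesis .
  qed
  ultimately show "\<exists>t. decides_in_time ?w ?P (encode_input T vs) (\<exists>m. taut_angle_structure T m) t \<and>
      real t \<le> 836004598 * (real ?n * real k * 3 powr (3 * real k / 2))" by blast
qed

end
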